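(* Let $\mu$ be a localized measure on a smoothly stratified metric space $\mathcal M$, with Fréchet mean $\bar\mu$. Gaussian masses $\Gamma_\mu$ induced by $\mu$ exist, and the Gaussian tangent field $G$ induced by $\mu$ is, on the closed fluctuating cone $\overline C_\mu$, the inner product with any Gaussian mass $\Gamma_\mu$: $$G(X)=\langle\Gamma_\mu,X\rangle_{\bar\mu}\quad\text{for all }X\in\overline C_\mu$$ (equality of random fields indexed by $\overline C_\mu$, $G$ being specified through its law).
   Context: CAT($\kappa$) conventions. For a point $p$ of a CAT($\kappa$) space $(\mathcal M,\mathbf d)$, the unit tangent sphere $S_p\mathcal M$ is the space of directions at $p$ (germs of unit-speed geodesics from $p$, identified when the Alexandrov angle between them is $0$), and the tangent cone $T_p\mathcal M$ is the Euclidean cone over it, a CAT(0) space with $\mathbb R_+$-action by scaling and cone point $0$. $\angle(V,W)\in[0,\pi]$ is the angle, $\|V\|$ the distance to the cone point, and $\langle V,W\rangle_p=\|V\|\|W\|\cos\angle(V,W)$. For $v$ with a unique shortest path to $p$, $\log_p v=\mathbf d(p,v)V$ with $V$ the unit initial tangent at $p$ of that path. Smoothly stratified metric space: a complete, geodesic, locally compact CAT($\kappa$) space $\mathcal M=\bigsqcup_{j=0}^d\mathcal M^j$ with disjoint locally closed strata satisfying $\overline{\mathcal M^j}=\bigcup_{k\le j}\mathcal M^k$, such that each $(\mathcal M^j,\mathbf d|_{\mathcal M^j})$ is a smooth manifold whose geodesic distance is $\mathbf d|_{\mathcal M^j}$, and for each $p$ there is $\varepsilon>0$ such that $\log_p$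 restricted to $B(p,\varepsilon)$ is a homeomorphism onto its image; $\exp_p$ is the local inverse. Fréchet function: $F(p)=\frac12\int_{\mathcal M}\mathbf d(p,x)^2\mu(dx)$; its minimizer is the Fréchet mean $\bar\mu$. Directional derivative: $\nabla_{\bar\mu}F(V)=\frac{d}{dt}F(\exp_{\bar\mu}tV)|_{t=0}$ ($t\ge0$). Localized: $\mu$ has unique Fréchet mean $\bar\mu$, $F$ is convex in a neighborhood of $\bar\mu$, and $\log_{\bar\mu}$ is $\mu$-almost surely uniquely defined; then $\hat\mu=(\log_{\bar\mu})_\sharp\mu$. Hulls: $\operatorname{hull}\mathcal S$ is the smallest geodesically convex cone containing $\mathcal S$ in $T_{\bar\mu}\mathcal M$ (or in $\mathbb R^m$); $\operatorname{hull}\mu=\operatorname{hull}\operatorname{supp}\hat\mu$. Escape cone: $E_\mu=\{X\in T_{\bar\mu}\mathcal M\mid\nabla_{\bar\mu}F(X)=0\}$. Fluctuating cone: $C_\mu=E_\mu\cap\operatorname{hull}\mu$, with closure $\overline C_\mu$. Gaussian tangent field induced by $\mu$: the centered Gaussian random field $G$ indexed by $S_{\bar\mu}\mathcal M$ with covariance $\mathbb E\,G(V)G(W)=\int_{\mathcal M}[\langle\log_{\bar\mu}y,V\rangle-m(\mu,V)][\langle\log_{\bar\mu}y,W\rangle-m(\mu,W)]\mu(dy)$, where $m(\mu,V)=\int_{\mathcal M}\langle\log_{\bar\mu}y,V\rangle\mu(dy)$, extended to $T_{\bar\mu}\mathcal M$ by $G(tV)=tG(V)$ for $t\ge0$. Tangential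 collapse of $\mu$: a map $\mathcal L:T_{\bar\mu}\mathcal M\to\mathbb R^m$ to an inner product space such that (1) $\mathcal L_\sharp\hat\mu$ has Fréchet mean $\mathcal L(0)=0$; (2) $\mathcal L|_{\overline C_\mu}$ is injective; (3) $\langle U,V\rangle_{\bar\mu}=\langle\mathcal L(U),\mathcal L(V)\rangle$ for all $U\in C_\mu$, $V\in T_{\bar\mu}\mathcal M$; (4) $\mathcal L(tV)=t\mathcal L(V)$ for $t\ge0$; (5) $\mathcal L$ is continuous. Every localized probability measure on a smoothly stratified metric space admits one that is the composite of a proper map followed by a convex geodesic projection from a CAT(0) space onto a subset; fix such an $\mathcal L$, and set $\mu^{\mathcal L}=\mathcal L_\sharp\hat\mu$, whose hull $\mathbb R^\ell=\operatorname{hull}\operatorname{supp}\mu^{\mathcal L}$ is a linear subspace of $\mathbb R^m$. Discrete measures: $\Delta$ is sampled from a set if $\Delta=\sum_{i\le j}\lambda_i\delta_{Y^i}$ is a finitely supported measure on it; for $\Delta$ sampled from $T_{\bar\mu}\mathcal M$, $\langle\Delta,X\rangle=\sum\lambda_i\langle Y^i,X\rangle$ and $\mathcal L(\Delta)=\sum\lambda_i\mathcal L(Y^i)$. $\overline{\mathbb R_+\mu}$ is the closure of $\{\alpha X\mid X\in\operatorname{supp}\hat\mu,\alpha\ge0\}$. Gaussian mass: let $N_{\mu^{\mathcal L}}\sim\mathcal N(0,\Sigma)$ with $\Sigma=\mathrm{Cov}(\mu^{\mathcal L})$ (supported on $\mathbb R^\ell$). A Gaussian mass $\Gamma_\mu$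 induced by $\mu$ is a section of $N_{\mu^{\mathcal L}}$: a random variable valued in measures sampled from $\overline{\mathbb R_+\mu}$ with $\mathcal L(\Gamma_\mu)=N_{\mu^{\mathcal L}}$. *)

theory Defs
  imports "HOL-Probability.Probability"
begin

section \<open>Geodesics and CAT(kappa) spaces\<close>

text \<open>Metric spaces occur both as types and as carriers (tangent cones), so geodesic notions take
  a carrier \<open>X\<close> and a distance \<open>\<delta>\<close>. Only the values of \<open>\<gamma>\<close> on \<open>{0..l}\<close> matter.\<close>

definition geodesic_on :: "'b set \<Rightarrow> ('b \<Rightarrow> 'b \<Rightarrow> real) \<Rightarrow> real \<Rightarrow> (real \<Rightarrow> 'b) \<Rightarrow> bool" where
  "geodesic_on X \<delta> l \<gamma> \<longleftrightarrow> 0 \<le> l \<and> \<gamma> ` {0..l} \<subseteq> X \<and>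
     (\<forall>s\<in>{0..l}. \<forall>t\<in>{0..l}. \<delta> (\<gamma> s) (\<gamma> t) = \<bar>s - t\<bar>)"

definition joins :: "'b set \<Rightarrow> ('b \<Rightarrow> 'b \<Rightarrow> real) \<Rightarrow> (real \<Rightarrow> 'b) \<Rightarrow> 'b \<Rightarrow> 'b \<Rightarrow> bool" where
  "joins X \<delta> \<gamma> x y \<longleftrightarrow> geodesic_on X \<delta> (\<delta> x y) \<gamma> \<and> \<gamma> 0 = x \<and> \<gamma> (\<delta> x y) = y"

definition geodesic_space :: "'b set \<Rightarrow> ('b \<Rightarrow> 'b \<Rightarrow> real) \<Rightarrow> bool" where
  "geodesic_space X \<delta> \<longleftrightarrow> (\<forall>x\<in>X. \<forall>y\<in>X. \<exists>\<gamma>. joins X \<delta> \<gamma> x y)"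

definition geodesically_convex :: "'b set \<Rightarrow> ('b \<Rightarrow> 'b \<Rightarrow> real) \<Rightarrow> 'b set \<Rightarrow> bool" where
  "geodesically_convex X \<delta> K \<longleftrightarrow> K \<subseteq> X \<and>
     (\<forall>x\<in>K. \<forall>y\<in>K. \<forall>\<gamma>. joins X \<delta> \<gamma> x y \<longrightarrow> \<gamma> ` {0..\<delta> x y} \<subseteq> K)"

text \<open>The model surface of constant curvature \<open>\<kappa>\<close>: rescaled unit sphere, Euclidean plane, or
  rescaled hyperbolic plane (upper sheet of the hyperboloid in Minkowski space).\<close>

definition model_surface :: "real \<Rightarrow> (real^3) set" where
  "model_surface \<kappa> =
     (if \<kappa> > 0 then sphere 0 1
      else if \<kappa> = 0 then {x. x $ 3 = 0}
      else {x. (x $ 1)\<^sup>2 + (x $ 2)\<^sup>2 - (x $ 3)\<^sup>2 = -1 \<and> x $ 3 > 0})"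

definition model_dist :: "real \<Rightarrow> real^3 \<Rightarrow> real^3 \<Rightarrow> real" where
  "model_dist \<kappa> x y =
     (if \<kappa> > 0 then arccos (x \<bullet> y) / sqrt \<kappa>
      else if \<kappa> = 0 then dist x y
      else arcosh (x $ 3 * y $ 3 - x $ 1 * y $ 1 - x $ 2 * y $ 2) / sqrt (- \<kappa>))"

text \<open>In a triangle \<open>p q r\<close> it suffices to compare a point \<open>\<alpha> s\<close> of the side \<open>[p,q]\<close> with a point
  \<open>\<beta> t\<close> of the side \<open>[p,r]\<close>: the other pairs of sides arise by relabelling the vertices, and points
  on a common side are at the same distance as their comparison points.\<close>

definition cat_space :: "real \<Rightarrow> 'b set \<Rightarrow> ('b \<Rightarrow> 'b \<Rightarrow> real) \<Rightarrow> bool" where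
  "cat_space \<kappa> X \<delta> \<longleftrightarrow> geodesic_space X \<delta> \<and>
     (\<forall>p\<in>X. \<forall>q\<in>X. \<forall>r\<in>X. \<forall>\<alpha> \<beta>.
        joins X \<delta> \<alpha> p q \<longrightarrow> joins X \<delta> \<beta> p r \<longrightarrow>
        (\<kappa> > 0 \<longrightarrow> \<delta> p q + \<delta> q r + \<delta> r p < 2 * pi / sqrt \<kappa>) \<longrightarrow>
        (\<forall>p'\<in>model_surface \<kappa>. \<forall>q'\<in>model_surface \<kappa>. \<forall>r'\<in>model_surface \<kappa>.
           model_dist \<kappa> p' q' = \<delta> p q \<longrightarrow> model_dist \<kappa> q' r' = \<delta> q r \<longrightarrow>
           model_dist \<kappa> r' p' = \<delta> r p \<longrightarrow>
           (\<forall>s\<in>{0..\<delta> p q}. \<forall>t\<in>{0..\<delta> p r}.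
            \<forall>x'\<in>model_surface \<kappa>. \<forall>y'\<in>model_surface \<kappa>.
              model_dist \<kappa> p' x' = s \<longrightarrow> model_dist \<kappa> x' q' = \<delta> p q - s \<longrightarrow>
              model_dist \<kappa> p' y' = t \<longrightarrow> model_dist \<kappa> y' r' = \<delta> p r - t \<longrightarrow>
              \<delta> (\<alpha> s) (\<beta> t) \<le> model_dist \<kappa> x' y')))"


section \<open>Tangent cones and logarithm maps\<close>

definition comparison_angle :: "real \<Rightarrow> real \<Rightarrow> real \<Rightarrow> real" where
  "comparison_angle a b c = arccos ((a\<^sup>2 + b\<^sup>2 - c\<^sup>2) / (2 * a * b))"

definition unit_germs :: "'a::metric_space \<Rightarrow> (real \<Rightarrow> 'a) set" where
  "unit_germs p = {\<gamma>. \<gamma> 0 = p \<and> (\<exists>e>0. geodesic_on UNIV dist e \<gamma>)}"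

definition alexandrov_angle :: "(real \<Rightarrow> 'a::metric_space) \<Rightarrow> (real \<Rightarrow> 'a) \<Rightarrow> real" where
  "alexandrov_angle \<gamma> \<gamma>' = real_of_ereal
     (Limsup (at_right 0 \<times>\<^sub>F at_right 0)
        (\<lambda>(s, t). ereal (comparison_angle s t (dist (\<gamma> s) (\<gamma>' t)))))"

definition same_direction :: "'a::metric_space \<Rightarrow> ((real \<Rightarrow> 'a) \<times> (real \<Rightarrow> 'a)) set" where
  "same_direction p =
     {(\<gamma>, \<gamma>'). \<gamma> \<in> unit_germs p \<and> \<gamma>' \<in> unit_germs p \<and> alexandrov_angle \<gamma> \<gamma>' = 0}"

definition directions :: "'a::metric_space \<Rightarrow> (real \<Rightarrow> 'a) set set" where
  "directions p = unit_germs p // same_direction p"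

definition direction_angle :: "(real \<Rightarrow> 'a::metric_space) set \<Rightarrow> (real \<Rightarrow> 'a) set \<Rightarrow> real" where
  "direction_angle V W = alexandrov_angle (SOME \<gamma>. \<gamma> \<in> V) (SOME \<gamma>. \<gamma> \<in> W)"

text \<open>A tangent vector is a pair of its length and its direction. The cone point has no direction;
  it is encoded by the empty set, which is not an equivalence class.\<close>

type_synonym 'a tangent = "real \<times> (real \<Rightarrow> 'a) set"

definition cone_point :: "'a tangent" where
  "cone_point = (0, {})"

definition tangent_cone :: "'a::metric_space \<Rightarrow> 'a tangent set" where
  "tangent_cone p = insert cone_point ({0<..} \<times> directions p)"

definition unit_tangents :: "'a::metric_space \<Rightarrow> 'a tangent set" where
  "unit_tangents p = {1} \<times> directions p"

definition tscale :: "real \<Rightarrow> 'a tangent \<Rightarrow> 'a tangent" where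
  "tscale t V = (if t * fst V = 0 then cone_point else (t * fst V, snd V))"

definition tinner :: "'a::metric_space tangent \<Rightarrow> 'a tangent \<Rightarrow> real" where
  "tinner V W = fst V * fst W * cos (direction_angle (snd V) (snd W))"

text \<open>Distance of the Euclidean cone; the distance from \<open>V\<close> to the cone point is \<open>fst V\<close>.\<close>

definition tdist :: "'a::metric_space tangent \<Rightarrow> 'a tangent \<Rightarrow> real" where
  "tdist V W = sqrt ((fst V)\<^sup>2 + (fst W)\<^sup>2 - 2 * tinner V W)"

definition tangent_topology :: "'a::metric_space \<Rightarrow> 'a tangent topology" where
  "tangent_topology p = Metric_space.mtopology (tangent_cone p) tdist"

definition tangent_borel :: "'a::metric_space \<Rightarrow> 'a tangent measure" where
  "tangent_borel p = sigma (tangent_cone p) {U. openin (tangent_topology p) U}"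

definition unique_shortest_path :: "'a::metric_space \<Rightarrow> 'a \<Rightarrow> bool" where
  "unique_shortest_path p v \<longleftrightarrow> (\<exists>\<gamma>. joins UNIV dist \<gamma> p v) \<and>
     (\<forall>\<gamma> \<gamma>'. joins UNIV dist \<gamma> p v \<longrightarrow> joins UNIV dist \<gamma>' p v \<longrightarrow>
        (\<forall>t\<in>{0..dist p v}. \<gamma> t = \<gamma>' t))"

text \<open>The logarithm takes the dummy value \<open>cone_point\<close> at points without a unique shortest path
  to \<open>p\<close>.\<close>

definition log_map :: "'a::metric_space \<Rightarrow> 'a \<Rightarrow> 'a tangent" where
  "log_map p v =
     (if v \<noteq> p \<and> unique_shortest_path p v
      then (dist p v, same_direction p `` {SOME \<gamma>. joins UNIV dist \<gamma> p v})
      else cone_point)"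

definition log_embeds_ball :: "'a::metric_space \<Rightarrow> real \<Rightarrow> bool" where
  "log_embeds_ball p e \<longleftrightarrow> e > 0 \<and> (\<forall>v\<in>ball p e. unique_shortest_path p v) \<and>
     homeomorphic_map (top_of_set (ball p e))
       (subtopology (tangent_topology p) (log_map p ` ball p e)) (log_map p)"

definition exp_map :: "'a::metric_space \<Rightarrow> 'a tangent \<Rightarrow> 'a" where
  "exp_map p = inv_into (ball p (SOME e. log_embeds_ball p e)) (log_map p)"


section \<open>Smoothly stratified metric spaces\<close>

text \<open>The dimension of a stratum is not fixed in advance, so coordinates live in the library space
  \<open>Euclidean_space n\<close> of sequences supported on \<open>{..<n}\<close>.\<close>

definition partial_deriv :: "nat \<Rightarrow> ((nat \<Rightarrow> real) \<Rightarrow> real) \<Rightarrow> (nat \<Rightarrow> real) \<Rightarrow> real" where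
  "partial_deriv i f x = deriv (\<lambda>t. f (x(i := t))) (x i)"

primrec C_k_on :: "nat \<Rightarrow> nat \<Rightarrow> (nat \<Rightarrow> real) set \<Rightarrow> ((nat \<Rightarrow> real) \<Rightarrow> real) \<Rightarrow> bool" where
  "C_k_on n 0 U f \<longleftrightarrow> continuous_map (subtopology (Euclidean_space n) U) euclideanreal f"
| "C_k_on n (Suc k) U f \<longleftrightarrow>
     continuous_map (subtopology (Euclidean_space n) U) euclideanreal f \<and>
     (\<forall>i<n. (\<forall>x\<in>U. (\<lambda>t. f (x(i := t))) differentiable at (x i)) \<and>
             C_k_on n k U (partial_deriv i f))"

definition smooth_coord :: "nat \<Rightarrow> (nat \<Rightarrow> real) set \<Rightarrow> ((nat \<Rightarrow> real) \<Rightarrow> real) \<Rightarrow> bool" where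
  "smooth_coord n U f \<longleftrightarrow> (\<forall>k. C_k_on n k U f)"

text \<open>A chart \<open>(U, \<phi>, g)\<close> carries the coefficients \<open>g\<close> of the Riemannian metric in the coordinates
  \<open>\<phi>\<close>, as functions on \<open>\<phi> ` U\<close>.\<close>

type_synonym 'a rchart =
  "'a set \<times> ('a \<Rightarrow> nat \<Rightarrow> real) \<times> ((nat \<Rightarrow> real) \<Rightarrow> nat \<Rightarrow> nat \<Rightarrow> real)"

definition riemannian_chart :: "'a::metric_space set \<Rightarrow> nat \<Rightarrow> 'a rchart \<Rightarrow> bool" where
  "riemannian_chart X n = (\<lambda>(U, \<phi>, g).
     openin (top_of_set X) U \<and> openin (Euclidean_space n) (\<phi> ` U) \<and>
     homeomorphic_map (top_of_set U) (subtopology (Euclidean_space n) (\<phi> ` U)) \<phi> \<and>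
     (\<forall>i<n. \<forall>j<n. smooth_coord n (\<phi> ` U) (\<lambda>x. g x i j)) \<and>
     (\<forall>x\<in>\<phi> ` U. (\<forall>i<n. \<forall>j<n. g x i j = g x j i) \<and>
        (\<forall>w. (\<exists>i<n. w i \<noteq> 0) \<longrightarrow> (\<Sum>i<n. \<Sum>j<n. g x i j * w i * w j) > 0)))"

definition compatible_charts :: "nat \<Rightarrow> 'a::metric_space rchart \<Rightarrow> 'a rchart \<Rightarrow> bool" where
  "compatible_charts n = (\<lambda>(U, \<phi>, g) (U', \<phi>', g').
     let W = \<phi> ` (U \<inter> U'); \<tau> = (\<lambda>k x. \<phi>' (inv_into U \<phi> x) k) in
     (\<forall>k<n. smooth_coord n W (\<tau> k)) \<and>
     (\<forall>x\<in>W. \<forall>i<n. \<forall>j<n. g x i j =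
        (\<Sum>k<n. \<Sum>l<n. g' (\<phi>' (inv_into U \<phi> x)) k l *
            partial_deriv i (\<tau> k) x * partial_deriv j (\<tau> l) x)))"

definition riemannian_atlas :: "'a::metric_space set \<Rightarrow> nat \<Rightarrow> 'a rchart set \<Rightarrow> bool" where
  "riemannian_atlas X n \<A> \<longleftrightarrow>
     (\<forall>c\<in>\<A>. riemannian_chart X n c) \<and> \<Union> (fst ` \<A>) = X \<and>
     (\<forall>c\<in>\<A>. \<forall>c'\<in>\<A>. compatible_charts n c c')"

text \<open>\<open>riemannian_path n \<A> x y l\<close>: some piecewise continuously differentiable path from \<open>x\<close> to \<open>y\<close>
  has length \<open>l\<close>.\<close>

inductive riemannian_path :: "nat \<Rightarrow> 'a rchart set \<Rightarrow> 'a \<Rightarrow> 'a \<Rightarrow> real \<Rightarrow> bool"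
  for n :: nat and \<A> :: "'a rchart set" where
  piece: "\<lbrakk>(U, \<phi>, g) \<in> \<A>; c ` {0..1} \<subseteq> \<phi> ` U;
      \<And>i t. i < n \<Longrightarrow> t \<in> {0..1} \<Longrightarrow>
        ((\<lambda>s. c s i) has_real_derivative c' t i) (at t within {0..1});
      \<And>i. i < n \<Longrightarrow> continuous_on {0..1} (\<lambda>t. c' t i);
      x \<in> U; y \<in> U; \<phi> x = c 0; \<phi> y = c 1;
      l = integral {0..1} (\<lambda>t. sqrt (\<Sum>i<n. \<Sum>j<n. g (c t) i j * c' t i * c' t j))\<rbrakk>
    \<Longrightarrow> riemannian_path n \<A> x y l"
| concat: "\<lbrakk>riemannian_path n \<A> x y l; riemannian_path n \<A> y z l'\<rbrakk>
    \<Longrightarrow> riemannian_path n \<A> x z (l + l')"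

text \<open>Strata need not be connected (the open legs of a spider form one stratum), and no geodesic
  distance of the stratum is defined between different components. The ambient distance is therefore
  required to be the geodesic distance of the stratum within each component.\<close>

definition smooth_metric_stratum :: "'a::metric_space set \<Rightarrow> bool" where
  "smooth_metric_stratum X \<longleftrightarrow> (\<exists>n \<A>. riemannian_atlas X n \<A> \<and>
     (\<forall>x\<in>X. \<forall>y\<in>X. (\<exists>l. riemannian_path n \<A> x y l) \<longrightarrow>
        dist x y = Inf {l. riemannian_path n \<A> x y l}))"

definition locally_closed :: "'a::topological_space set \<Rightarrow> bool" where
  "locally_closed X \<longleftrightarrow> (\<exists>U C. open U \<and> closed C \<and> X = U \<inter> C)"

text \<open>The underlying space is the whole type, with strata \<open>S 0, \<dots>, S d\<close>.\<close>

definition smoothly_stratified_space ::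
    "real \<Rightarrow> nat \<Rightarrow> (nat \<Rightarrow> 'a::metric_space set) \<Rightarrow> bool" where
  "smoothly_stratified_space \<kappa> d S \<longleftrightarrow>
     Topological_Spaces.complete (UNIV :: 'a set) \<and> locally_compact_space (euclidean :: 'a topology) \<and>
     geodesic_space (UNIV :: 'a set) dist \<and> cat_space \<kappa> (UNIV :: 'a set) dist \<and>
     (\<Union>j\<le>d. S j) = UNIV \<and> disjoint_family_on S {..d} \<and>
     (\<forall>j\<le>d. locally_closed (S j) \<and> closure (S j) = (\<Union>k\<le>j. S k) \<and>
             smooth_metric_stratum (S j)) \<and>
     (\<forall>p::'a. \<exists>e. log_embeds_ball p e)"


section \<open>Localized measures and the fluctuating cone\<close>

definition frechet_function :: "'b::metric_space measure \<Rightarrow> 'b \<Rightarrow> real" where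
  "frechet_function \<nu> q = (1/2) * (\<integral>x. (dist q x)\<^sup>2 \<partial>\<nu>)"

text \<open>The integrability clause makes the Frechet function finite; without it the Bochner integral
  would silently be \<open>0\<close>.\<close>

definition has_frechet_mean :: "'b::metric_space measure \<Rightarrow> 'b \<Rightarrow> bool" where
  "has_frechet_mean \<nu> b \<longleftrightarrow> (\<forall>q. integrable \<nu> (\<lambda>x. (dist q x)\<^sup>2)) \<and>
     (\<forall>q. q \<noteq> b \<longrightarrow> frechet_function \<nu> b < frechet_function \<nu> q)"

definition localized :: "'a::metric_space measure \<Rightarrow> 'a \<Rightarrow> bool" where
  "localized \<mu> b \<longleftrightarrow> prob_space \<mu> \<and> sets \<mu> = sets borel \<and> has_frechet_mean \<mu> b \<and>
     (\<exists>e>0. \<forall>l \<gamma>. geodesic_on (ball b e) dist l \<gamma> \<longrightarrow>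
        convex_on {0..l} (\<lambda>t. frechet_function \<mu> (\<gamma> t))) \<and>
     (AE v in \<mu>. unique_shortest_path b v)"

definition tangent_measure :: "'a::metric_space measure \<Rightarrow> 'a \<Rightarrow> 'a tangent measure" where
  "tangent_measure \<mu> b = distr \<mu> (tangent_borel b) (log_map b)"

definition tangent_support :: "'a::metric_space measure \<Rightarrow> 'a \<Rightarrow> 'a tangent set" where
  "tangent_support \<mu> b = {X \<in> tangent_cone b.
     \<forall>U. openin (tangent_topology b) U \<longrightarrow> X \<in> U \<longrightarrow> emeasure (tangent_measure \<mu> b) U > 0}"

definition tangent_hull :: "'a::metric_space \<Rightarrow> 'a tangent set \<Rightarrow> 'a tangent set" where
  "tangent_hull b A = \<Inter> {K. A \<subseteq> K \<and> geodesically_convex (tangent_cone b) tdist K \<and>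
     (\<forall>X\<in>K. \<forall>t\<ge>0. tscale t X \<in> K)}"

definition has_directional_deriv ::
    "('a::metric_space \<Rightarrow> real) \<Rightarrow> 'a \<Rightarrow> 'a tangent \<Rightarrow> real \<Rightarrow> bool" where
  "has_directional_deriv F b V D \<longleftrightarrow>
     ((\<lambda>t. F (exp_map b (tscale t V))) has_real_derivative D) (at 0 within {0..})"

definition escape_cone :: "'a::metric_space measure \<Rightarrow> 'a \<Rightarrow> 'a tangent set" where
  "escape_cone \<mu> b = {X \<in> tangent_cone b. has_directional_deriv (frechet_function \<mu>) b X 0}"

definition fluctuating_cone :: "'a::metric_space measure \<Rightarrow> 'a \<Rightarrow> 'a tangent set" where
  "fluctuating_cone \<mu> b = escape_cone \<mu> b \<inter> tangent_hull b (tangent_support \<mu> b)"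

definition closed_fluctuating_cone :: "'a::metric_space measure \<Rightarrow> 'a \<Rightarrow> 'a tangent set" where
  "closed_fluctuating_cone \<mu> b = tangent_topology b closure_of fluctuating_cone \<mu> b"


section \<open>Gaussian tangent fields\<close>

definition normal_law :: "real \<Rightarrow> real \<Rightarrow> real measure" where
  "normal_law m v = (if v = 0 then return borel m else density lborel (normal_density m (sqrt v)))"

definition random_field :: "'w measure \<Rightarrow> 'i set \<Rightarrow> ('i \<Rightarrow> 'w \<Rightarrow> real) \<Rightarrow> bool" where
  "random_field P I X \<longleftrightarrow> prob_space P \<and> (\<forall>i\<in>I. X i \<in> borel_measurable P)"

definition centered_gaussian_field :: "'w measure \<Rightarrow> 'i set \<Rightarrow> ('i \<Rightarrow> 'w \<Rightarrow> real) \<Rightarrow> bool" where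
  "centered_gaussian_field P I X \<longleftrightarrow> random_field P I X \<and>
     (\<forall>J a. finite J \<longrightarrow> J \<subseteq> I \<longrightarrow>
        (\<exists>v\<ge>0. distr P borel (\<lambda>\<omega>. \<Sum>i\<in>J. a i * X i \<omega>) = normal_law 0 v))"

text \<open>Equality of random fields, possibly on different probability spaces: their laws on the
  product space of all real functions on the index set agree.\<close>

definition equal_in_law ::
    "'i set \<Rightarrow> 'v measure \<Rightarrow> ('i \<Rightarrow> 'v \<Rightarrow> real) \<Rightarrow> 'w measure \<Rightarrow> ('i \<Rightarrow> 'w \<Rightarrow> real) \<Rightarrow> bool" where
  "equal_in_law I P X Q Y \<longleftrightarrow> random_field P I X \<and> random_field Q I Y \<and>
     distr P (\<Pi>\<^sub>M i\<in>I. borel) (\<lambda>\<omega>. \<lambda>i\<in>I. X i \<omega>) =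
     distr Q (\<Pi>\<^sub>M i\<in>I. borel) (\<lambda>\<omega>. \<lambda>i\<in>I. Y i \<omega>)"

definition tangent_mean :: "'a::metric_space measure \<Rightarrow> 'a \<Rightarrow> 'a tangent \<Rightarrow> real" where
  "tangent_mean \<mu> b V = (\<integral>y. tinner (log_map b y) V \<partial>\<mu>)"

definition tangent_cov :: "'a::metric_space measure \<Rightarrow> 'a \<Rightarrow> 'a tangent \<Rightarrow> 'a tangent \<Rightarrow> real" where
  "tangent_cov \<mu> b V W = (\<integral>y. (tinner (log_map b y) V - tangent_mean \<mu> b V) *
     (tinner (log_map b y) W - tangent_mean \<mu> b W) \<partial>\<mu>)"

definition gaussian_tangent_field ::
    "'a::metric_space measure \<Rightarrow> 'a \<Rightarrow> 'v measure \<Rightarrow> ('a tangent \<Rightarrow> 'v \<Rightarrow> real) \<Rightarrow> bool" where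
  "gaussian_tangent_field \<mu> b P G \<longleftrightarrow>
     centered_gaussian_field P (unit_tangents b) G \<and>
     (\<forall>V\<in>unit_tangents b. \<forall>W\<in>unit_tangents b.
        (\<integral>\<omega>. G V \<omega> * G W \<omega> \<partial>P) = tangent_cov \<mu> b V W) \<and>
     (\<forall>V\<in>tangent_cone b. \<forall>t\<ge>0. \<forall>\<omega>\<in>space P. G (tscale t V) \<omega> = t * G V \<omega>)"


section \<open>Tangential collapse and Gaussian masses\<close>

definition collapsed_measure ::
    "'a::metric_space measure \<Rightarrow> 'a \<Rightarrow> ('a tangent \<Rightarrow> 'e::euclidean_space) \<Rightarrow> 'e measure" where
  "collapsed_measure \<mu> b L = distr (tangent_measure \<mu> b) borel L"

definition tangential_collapse ::
    "'a::metric_space measure \<Rightarrow> 'a \<Rightarrow> ('a tangent \<Rightarrow> 'e::euclidean_space) \<Rightarrow> bool" where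
  "tangential_collapse \<mu> b L \<longleftrightarrow>
     has_frechet_mean (collapsed_measure \<mu> b L) (L cone_point) \<and> L cone_point = 0 \<and>
     inj_on L (closed_fluctuating_cone \<mu> b) \<and>
     (\<forall>U\<in>fluctuating_cone \<mu> b. \<forall>V\<in>tangent_cone b. tinner U V = L U \<bullet> L V) \<and>
     (\<forall>V\<in>tangent_cone b. \<forall>t\<ge>0. L (tscale t V) = t *\<^sub>R L V) \<and>
     continuous_map (tangent_topology b) euclidean L"

definition sampled_from :: "'a::metric_space \<Rightarrow> 'a tangent set \<Rightarrow> 'a tangent measure \<Rightarrow> bool" where
  "sampled_from b A \<Delta> \<longleftrightarrow> sets \<Delta> = sets (tangent_borel b) \<and>
     (\<exists>Y c. finite Y \<and> Y \<subseteq> A \<and> (\<forall>y\<in>Y. 0 \<le> c y) \<and>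
        (\<forall>B\<in>sets (tangent_borel b). emeasure \<Delta> B = (\<Sum>y\<in>Y \<inter> B. ennreal (c y))))"

definition atoms :: "'b measure \<Rightarrow> 'b set" where
  "atoms \<Delta> = {y \<in> space \<Delta>. measure \<Delta> {y} \<noteq> 0}"

definition mass_inner :: "'a::metric_space tangent measure \<Rightarrow> 'a tangent \<Rightarrow> real" where
  "mass_inner \<Delta> X = (\<Sum>y\<in>atoms \<Delta>. measure \<Delta> {y} * tinner y X)"

definition mass_image ::
    "('a tangent \<Rightarrow> 'e::euclidean_space) \<Rightarrow> 'a tangent measure \<Rightarrow> 'e" where
  "mass_image L \<Delta> = (\<Sum>y\<in>atoms \<Delta>. measure \<Delta> {y} *\<^sub>R L y)"

definition closed_rays :: "'a::metric_space measure \<Rightarrow> 'a \<Rightarrow> 'a tangent set" where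
  "closed_rays \<mu> b = tangent_topology b closure_of
     {tscale \<alpha> X | \<alpha> X. 0 \<le> \<alpha> \<and> X \<in> tangent_support \<mu> b}"

definition covariance_form :: "'e::euclidean_space measure \<Rightarrow> 'e \<Rightarrow> 'e \<Rightarrow> real" where
  "covariance_form \<nu> u v =
     (\<integral>x. (u \<bullet> (x - (\<integral>z. z \<partial>\<nu>))) * (v \<bullet> (x - (\<integral>z. z \<partial>\<nu>))) \<partial>\<nu>)"

definition centered_normal_vector ::
    "('e \<Rightarrow> 'e \<Rightarrow> real) \<Rightarrow> 'w measure \<Rightarrow> ('w \<Rightarrow> 'e::euclidean_space) \<Rightarrow> bool" where
  "centered_normal_vector \<Sigma> P N \<longleftrightarrow> prob_space P \<and> N \<in> borel_measurable P \<and>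
     (\<forall>u. distr P borel (\<lambda>\<omega>. u \<bullet> N \<omega>) = normal_law 0 (\<Sigma> u u))"

definition collapsed_normal ::
    "'a::metric_space measure \<Rightarrow> 'a \<Rightarrow> ('a tangent \<Rightarrow> 'e::euclidean_space) \<Rightarrow>
     'w measure \<Rightarrow> ('w \<Rightarrow> 'e) \<Rightarrow> bool" where
  "collapsed_normal \<mu> b L P N \<longleftrightarrow>
     centered_normal_vector (covariance_form (collapsed_measure \<mu> b L)) P N"

text \<open>\<open>\<Gamma>\<close> is a random measure: the masses of Borel sets are random variables. The section identity is
  an identity of random variables, hence almost sure (a Gaussian vector lies in the span of its
  covariance only almost surely).\<close>

definition gaussian_mass ::
    "'a::metric_space measure \<Rightarrow> 'a \<Rightarrow> ('a tangent \<Rightarrow> 'e::euclidean_space) \<Rightarrow>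
     'w measure \<Rightarrow> ('w \<Rightarrow> 'e) \<Rightarrow> ('w \<Rightarrow> 'a tangent measure) \<Rightarrow> bool" where
  "gaussian_mass \<mu> b L P N \<Gamma> \<longleftrightarrow> collapsed_normal \<mu> b L P N \<and>
     (\<forall>\<omega>\<in>space P. sampled_from b (closed_rays \<mu> b) (\<Gamma> \<omega>)) \<and>
     (\<forall>B\<in>sets (tangent_borel b). (\<lambda>\<omega>. emeasure (\<Gamma> \<omega>) B) \<in> borel_measurable P) \<and>
     (AE \<omega> in P. mass_image L (\<Gamma> \<omega>) = N \<omega>)"

end

theory Submission
  imports Defs
begin

text \<open>Since \<open>\<L>\<close> preserves inner products with vectors of the closed fluctuating cone,
  \<open>\<langle>\<Gamma>, X\<rangle>\<close> is almost surely the inner product of \<open>\<L>(\<Gamma>) = N\<close> with \<open>\<L>(X)\<close>, so on that cone it is a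
  centered Gaussian field with the covariance of \<open>G\<close>, and the two laws agree. A Gaussian mass exists
  because the collapsed measure has mean \<open>0\<close>: no half-space bounded by a hyperplane through the origin
  contains its support without the hyperplane doing so, hence the nonnegative combinations of the support
  fill its linear span, in which \<open>N\<close> almost surely lies. Each of plus and minus a vector of an
  orthonormal basis of the span is such a combination, and weighting these by the positive and negative
  parts of the coordinates of \<open>N\<close> gives masses depending measurably on \<open>N\<close>.\<close>

section \<open>Alexandrov angles\<close>

text \<open>The balance of the half-spaces is an almost sure statement, and it says something about
  the support only because the support has full measure. This holds since the tangent cone is
  Lindelof: it is a countable union of dilations of the compact image of a small ball under the
  logarithm. Using its topology presupposes that \<open>tdist\<close> is a metric, which rests on
  the triangle inequality for Alexandrov angles; hence the geometric beginning. The laws to be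
  compared live on a product over a possibly uncountable index set. They are determined by
  finite-dimensional boxes, and box probabilities are recovered from the laws of linear combinations
  one coordinate at a time. Finally, the inner product with a random measure has to be a random
  variable although the atoms move with the outcome. It is therefore rewritten as a difference of
  integrals against that measure, which inherit measurability from the masses of fixed sets.\<close>

lemma norm_rcis_diff_squared:
  "(cmod (rcis a \<alpha> - rcis c \<beta>))\<^sup>2 = a\<^sup>2 + c\<^sup>2 - 2 * a * c * cos (\<alpha> - \<beta>)"
proof -
  have "(cmod (rcis a \<alpha> - rcis c \<beta>))\<^sup>2 =
      a\<^sup>2 * ((cos \<alpha>)\<^sup>2 + (sin \<alpha>)\<^sup>2) + c\<^sup>2 * ((cos \<beta>)\<^sup>2 + (sin \<beta>)\<^sup>2)
      - 2 * a * c * (cos \<alpha> * cos \<beta> + sin \<alpha> * sin \<beta>)"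
    unfolding cmod_power2 minus_complex.simps Re_rcis Im_rcis by algebra
  then show ?thesis by (simp add: cos_diff)
qed

text \<open>Put the apex at 0, one vertex at angle \<open>\<alpha>\<close> and the other at angle
  \<open>- \<beta>\<close>. As \<open>\<alpha> + \<beta> < pi\<close>, the opposite side crosses the
  positive real axis, and the crossing point, at distance \<open>t\<close>, cuts that side into two
  collinear pieces whose lengths add up. By convexity \<open>t\<close> is at most the longer of the
  other two sides.\<close>

lemma planar_triangle_split:
  fixes s u \<alpha> \<beta> :: real
  assumes s: "0 < s" and u: "0 < u" and \<alpha>: "0 < \<alpha>" and \<beta>: "0 < \<beta>" and sum: "\<alpha> + \<beta> < pi"
  obtains t where "0 < t" "t \<le> max s u"
    "sqrt (s\<^sup>2 + t\<^sup>2 - 2 * s * t * cos \<alpha>) + sqrt (t\<^sup>2 + u\<^sup>2 - 2 * t * u * cos \<beta>) =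
      sqrt (s\<^sup>2 + u\<^sup>2 - 2 * s * u * cos (\<alpha> + \<beta>))"
proof -
  let ?a = "rcis s \<alpha>" and ?c = "rcis u (- \<beta>)"
  have sin: "0 < sin \<alpha>" "0 < sin \<beta>" "0 < sin (\<alpha> + \<beta>)"
    using assms by (auto intro!: sin_gt_zero)
  define D where "D = s * sin \<alpha> + u * sin \<beta>"
  have D: "D > 0" unfolding D_def using s u sin by (simp add: add_pos_pos)
  \<comment> \<open>The weight for which the imaginary parts of the two vertices cancel.\<close>
  define l where "l = u * sin \<beta> / D"
  have l01: "0 \<le> l" "l \<le> 1" and l': "1 - l = s * sin \<alpha> / D"
    using D s u sin by (auto simp: l_def D_def field_simps)
  define t where "t = s * u * sin (\<alpha> + \<beta>) / D"
  have t: "0 < t" unfolding t_def using s u sin D by simp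
  have seg: "of_real l * ?a + of_real (1 - l) * ?c = of_real t"
  proof (rule complex_eqI)
    show "Re (of_real l * ?a + of_real (1 - l) * ?c) = Re (of_real t)"
      unfolding l' unfolding l_def t_def using D by (simp add: sin_add field_simps)
    show "Im (of_real l * ?a + of_real (1 - l) * ?c) = Im (of_real t)"
      unfolding l' unfolding l_def using D by (simp add: field_simps)
  qed
  have "t = cmod (of_real l * ?a + of_real (1 - l) * ?c)"
    unfolding seg using t by simp
  also have "\<dots> \<le> l * s + (1 - l) * u"
    by (rule order_trans[OF norm_triangle_ineq]) (use l01 s u in \<open>simp only: norm_mult norm_of_real, simp add: norm_mult\<close>)
  also have "\<dots> \<le> l * max s u + (1 - l) * max s u"
    using l01 by (intro add_mono mult_left_mono) auto
  finally have "t \<le> max s u" by (simp add: algebra_simps)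
  moreover have "?a - of_real t = of_real (1 - l) * (?a - ?c)" "of_real t - ?c = of_real l * (?a - ?c)"
    unfolding seg[symmetric] by (simp_all add: algebra_simps)
  then have "cmod (?a - of_real t) + cmod (of_real t - ?c) = (1 - l) * cmod (?a - ?c) + l * cmod (?a - ?c)"
    using l01 by (simp only: norm_mult norm_of_real abs_of_nonneg diff_ge_0_iff_ge)
  then have "cmod (?a - of_real t) + cmod (of_real t - ?c) = cmod (?a - ?c)"
    by (simp add: algebra_simps)
  moreover have "cmod (?a - of_real t) = sqrt (s\<^sup>2 + t\<^sup>2 - 2 * s * t * cos \<alpha>)"
    using norm_rcis_diff_squared[of s \<alpha> t 0] by (simp add: rcis_def[of _ 0] real_sqrt_unique)
  moreover have "cmod (of_real t - ?c) = sqrt (t\<^sup>2 + u\<^sup>2 - 2 * t * u * cos \<beta>)"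
    using norm_rcis_diff_squared[of t 0 u "- \<beta>"] by (simp add: rcis_def[of _ 0] real_sqrt_unique)
  moreover have "cmod (?a - ?c) = sqrt (s\<^sup>2 + u\<^sup>2 - 2 * s * u * cos (\<alpha> + \<beta>))"
    using norm_rcis_diff_squared[of s \<alpha> u "- \<beta>"] by (simp add: real_sqrt_unique)
  ultimately show thesis using that t by simp
qed

text \<open>The triangle inequalities for the sides amount to the quotient lying in [-1, 1], the
  range in which \<open>arccos\<close> inverts the cosine.\<close>

lemma comparison_angle_bounds:
  assumes "0 < s" "0 < t" "c \<le> s + t" "\<bar>s - t\<bar> \<le> c"
  shows "0 \<le> comparison_angle s t c" "comparison_angle s t c \<le> pi"
    "cos (comparison_angle s t c) = (s\<^sup>2 + t\<^sup>2 - c\<^sup>2) / (2 * s * t)"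
proof -
  have c: "c\<^sup>2 \<le> (s + t)\<^sup>2" "(s - t)\<^sup>2 \<le> c\<^sup>2"
    using assms by (auto intro!: power_mono simp: abs_le_square_iff[symmetric])
  have st: "s * t > 0" using assms by simp
  have "- 1 \<le> (s\<^sup>2 + t\<^sup>2 - c\<^sup>2) / (2 * s * t)" "(s\<^sup>2 + t\<^sup>2 - c\<^sup>2) / (2 * s * t) \<le> 1"
    using c st by (auto simp: divide_simps power2_eq_square algebra_simps)
  then show "0 \<le> comparison_angle s t c" "comparison_angle s t c \<le> pi"
    "cos (comparison_angle s t c) = (s\<^sup>2 + t\<^sup>2 - c\<^sup>2) / (2 * s * t)"
    unfolding comparison_angle_def by (auto intro!: arccos_lbound arccos_ubound cos_arccos)
qed

text \<open>The cosine is strictly decreasing on [0, pi], so comparing angles amounts to comparing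
  the third side with the one that the law of cosines gives for \<open>\<beta>\<close>. Strict
  bounds on angles near the base point thus become strict bounds on distances.\<close>

lemma comparison_angle_less_iff:
  assumes "0 < s" "0 < t" "0 \<le> c" "c \<le> s + t" "\<bar>s - t\<bar> \<le> c" "0 \<le> \<beta>" "\<beta> \<le> pi"
  shows "comparison_angle s t c < \<beta> \<longleftrightarrow> c < sqrt (s\<^sup>2 + t\<^sup>2 - 2 * s * t * cos \<beta>)"
    and "\<beta> < comparison_angle s t c \<longleftrightarrow> sqrt (s\<^sup>2 + t\<^sup>2 - 2 * s * t * cos \<beta>) < c"
proof -
  note b = comparison_angle_bounds[OF assms(1,2,4,5)]
  have st: "s * t > 0" using assms by simp
  have c2: "c = sqrt (c\<^sup>2)" using assms by simp
  have "comparison_angle s t c < \<beta> \<longleftrightarrow> cos \<beta> < (s\<^sup>2 + t\<^sup>2 - c\<^sup>2) / (2 * s * t)"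
    using cos_mono_less_eq[of \<beta> "comparison_angle s t c"] b assms by simp
  also have "\<dots> \<longleftrightarrow> c < sqrt (s\<^sup>2 + t\<^sup>2 - 2 * s * t * cos \<beta>)"
    by (subst (2) c2, subst real_sqrt_less_iff) (use st assms in \<open>auto simp: field_simps\<close>)
  finally show "comparison_angle s t c < \<beta> \<longleftrightarrow> c < sqrt (s\<^sup>2 + t\<^sup>2 - 2 * s * t * cos \<beta>)" .
  have "\<beta> < comparison_angle s t c \<longleftrightarrow> (s\<^sup>2 + t\<^sup>2 - c\<^sup>2) / (2 * s * t) < cos \<beta>"
    using cos_mono_less_eq[of "comparison_angle s t c" \<beta>] b assms by simp
  also have "\<dots> \<longleftrightarrow> sqrt (s\<^sup>2 + t\<^sup>2 - 2 * s * t * cos \<beta>) < c"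
    by (subst (2) c2, subst real_sqrt_less_iff) (use st assms in \<open>auto simp: field_simps\<close>)
  finally show "\<beta> < comparison_angle s t c \<longleftrightarrow> sqrt (s\<^sup>2 + t\<^sup>2 - 2 * s * t * cos \<beta>) < c" .
qed

section \<open>Germs of geodesics and the angles between them\<close>

lemma unit_germsE:
  assumes "\<gamma> \<in> unit_germs p"
  obtains e where "0 < e" "\<And>s t. s \<in> {0..e} \<Longrightarrow> t \<in> {0..e} \<Longrightarrow> dist (\<gamma> s) (\<gamma> t) = \<bar>s - t\<bar>"
    "\<gamma> 0 = p"
  using assms unfolding unit_germs_def geodesic_on_def by blast

lemma eventually_at_right0_prod_iff:
  "eventually P (at_right (0::real) \<times>\<^sub>F at_right 0) \<longleftrightarrow>
    (\<exists>r>0. \<forall>s\<in>{0<..<r}. \<forall>t\<in>{0<..<r}. P (s, t))"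
proof
  assume "eventually P (at_right (0::real) \<times>\<^sub>F at_right 0)"
  then obtain Pf Pg where "eventually Pf (at_right (0::real))" "eventually Pg (at_right (0::real))"
    and *: "\<forall>x y. Pf x \<longrightarrow> Pg y \<longrightarrow> P (x, y)"
    unfolding eventually_prod_filter by blast
  then obtain r1 r2 where "r1 > 0" "\<forall>y>0. y < r1 \<longrightarrow> Pf y" "r2 > 0" "\<forall>y>0. y < r2 \<longrightarrow> Pg y"
    unfolding eventually_at_right_field by auto
  then show "\<exists>r>0. \<forall>s\<in>{0<..<r}. \<forall>t\<in>{0<..<r}. P (s, t)"
    using * by (intro exI[of _ "min r1 r2"]) auto
next
  assume "\<exists>r>0. \<forall>s\<in>{0<..<r}. \<forall>t\<in>{0<..<r}. P (s, t)"
  then obtain r where r: "r > 0" "\<forall>s\<in>{0<..<r}. \<forall>t\<in>{0<..<r}. P (s, t)" by blast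
  then have "eventually (\<lambda>s. s \<in> {0<..<r}) (at_right 0)"
    by (auto simp: eventually_at_right_field)
  then show "eventually P (at_right (0::real) \<times>\<^sub>F at_right 0)"
    unfolding eventually_prod_filter using r by blast
qed

lemma germ_pair_bounds:
  assumes "\<gamma> \<in> unit_germs p" "\<gamma>' \<in> unit_germs p"
  obtains r where "0 < r" "\<And>s t. 0 < s \<Longrightarrow> s < r \<Longrightarrow> 0 < t \<Longrightarrow> t < r \<Longrightarrow>
    dist (\<gamma> s) (\<gamma>' t) \<le> s + t \<and> \<bar>s - t\<bar> \<le> dist (\<gamma> s) (\<gamma>' t)"
proof -
  obtain e1 where e1: "0 < e1" "\<And>s t. s \<in> {0..e1} \<Longrightarrow> t \<in> {0..e1} \<Longrightarrow> dist (\<gamma> s) (\<gamma> t) = \<bar>s - t\<bar>" "\<gamma> 0 = p"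
    using assms(1) by (rule unit_germsE) blast
  obtain e2 where e2: "0 < e2" "\<And>s t. s \<in> {0..e2} \<Longrightarrow> t \<in> {0..e2} \<Longrightarrow> dist (\<gamma>' s) (\<gamma>' t) = \<bar>s - t\<bar>" "\<gamma>' 0 = p"
    using assms(2) by (rule unit_germsE) blast
  have "dist (\<gamma> s) (\<gamma>' t) \<le> s + t \<and> \<bar>s - t\<bar> \<le> dist (\<gamma> s) (\<gamma>' t)"
    if "0 < s" "s < min e1 e2" "0 < t" "t < min e1 e2" for s t
  proof -
    have "dist (\<gamma> s) p = s" "dist (\<gamma>' t) p = t"
      using e1(2)[of s 0] e2(2)[of t 0] e1 e2 that by auto
    then show ?thesis
      using dist_triangle2[of "\<gamma> s" "\<gamma>' t" p] dist_triangle3[of "\<gamma> s" p "\<gamma>' t"]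
        dist_triangle3[of "\<gamma>' t" p "\<gamma> s"] by (simp add: dist_commute)
  qed
  then show thesis using that[of "min e1 e2"] e1 e2 by simp
qed

text \<open>\<open>real_of_ereal\<close> would hide an infinite upper limit. Near the base point all
  comparison angles lie in [0, pi], and the filter is nontrivial, so the upper limit is finite and
  the conversion loses nothing.\<close>

lemma
  assumes "\<gamma> \<in> unit_germs p" "\<gamma>' \<in> unit_germs p"
  shows alexandrov_angle_nonneg: "0 \<le> alexandrov_angle \<gamma> \<gamma>'"
    and alexandrov_angle_le_pi: "alexandrov_angle \<gamma> \<gamma>' \<le> pi"
    and ereal_alexandrov_angle: "ereal (alexandrov_angle \<gamma> \<gamma>') =
      Limsup (at_right 0 \<times>\<^sub>F at_right 0) (\<lambda>(s, t). ereal (comparison_angle s t (dist (\<gamma> s) (\<gamma>' t))))"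
proof -
  let ?F = "at_right (0::real) \<times>\<^sub>F at_right (0::real)"
  let ?f = "\<lambda>(s, t). ereal (comparison_angle s t (dist (\<gamma> s) (\<gamma>' t)))"
  obtain r where r: "0 < r" "\<And>s t. 0 < s \<Longrightarrow> s < r \<Longrightarrow> 0 < t \<Longrightarrow> t < r \<Longrightarrow>
    dist (\<gamma> s) (\<gamma>' t) \<le> s + t \<and> \<bar>s - t\<bar> \<le> dist (\<gamma> s) (\<gamma>' t)"
    using germ_pair_bounds[OF assms] by blast
  have "eventually (\<lambda>x. 0 \<le> ?f x) ?F" "eventually (\<lambda>x. ?f x \<le> ereal pi) ?F"
    unfolding eventually_at_right0_prod_iff using r comparison_angle_bounds by (auto intro!: exI[of _ r])
  then have "0 \<le> Limsup ?F ?f" "Limsup ?F ?f \<le> ereal pi"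
    by (auto intro!: le_Limsup Limsup_bounded simp: prod_filter_eq_bot trivial_limit_at_right_real)
  moreover from this have "ereal (alexandrov_angle \<gamma> \<gamma>') = Limsup ?F ?f"
    unfolding alexandrov_angle_def by (intro ereal_real') auto
  ultimately show "0 \<le> alexandrov_angle \<gamma> \<gamma>'" "alexandrov_angle \<gamma> \<gamma>' \<le> pi"
    "ereal (alexandrov_angle \<gamma> \<gamma>') = Limsup ?F ?f"
    by (metis ereal_less_eq(3,5))+
qed

lemma alexandrov_angle_commute:
  "alexandrov_angle \<gamma> \<gamma>' = alexandrov_angle \<gamma>' \<gamma>"
proof -
  let ?F = "at_right (0::real) \<times>\<^sub>F at_right (0::real)"
  have "?F = filtermap prod.swap ?F" by (rule prod_filter_commute)
  then have "Limsup ?F f = Limsup ?F (\<lambda>x. f (prod.swap x))" for f :: "real \<times> real \<Rightarrow> ereal"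
    by (metis (no_types) Limsup_filtermap_eq inj_swap)
  note this[of "\<lambda>(s, t). ereal (comparison_angle s t (dist (\<gamma> s) (\<gamma>' t)))"]
  then show ?thesis
    unfolding alexandrov_angle_def
    by (simp add: case_prod_unfold comparison_angle_def dist_commute add.commute mult.commute mult.left_commute)
qed

lemma alexandrov_angle_cong:
  assumes "0 < e" "\<And>t. t \<in> {0..e} \<Longrightarrow> \<gamma>1 t = \<gamma>2 t"
  shows "alexandrov_angle \<gamma>1 \<gamma> = alexandrov_angle \<gamma>2 \<gamma>"
proof -
  have "eventually (\<lambda>(s, t). ereal (comparison_angle s t (dist (\<gamma>1 s) (\<gamma> t))) =
      ereal (comparison_angle s t (dist (\<gamma>2 s) (\<gamma> t)))) (at_right 0 \<times>\<^sub>F at_right 0)"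
    unfolding eventually_at_right0_prod_iff using assms by (intro exI[of _ e]) auto
  then show ?thesis unfolding alexandrov_angle_def
    by (intro arg_cong[of _ _ real_of_ereal] Limsup_eq) (auto simp: case_prod_unfold)
qed

lemma alexandrov_angle_refl:
  assumes "\<gamma> \<in> unit_germs p"
  shows "alexandrov_angle \<gamma> \<gamma> = 0"
proof -
  obtain e where e: "0 < e" "\<And>s t. s \<in> {0..e} \<Longrightarrow> t \<in> {0..e} \<Longrightarrow> dist (\<gamma> s) (\<gamma> t) = \<bar>s - t\<bar>"
    using assms by (rule unit_germsE) blast
  have "comparison_angle s t (dist (\<gamma> s) (\<gamma> t)) = 0" if "s \<in> {0<..<e}" "t \<in> {0<..<e}" for s t
  proof -
    have "(s\<^sup>2 + t\<^sup>2 - (dist (\<gamma> s) (\<gamma> t))\<^sup>2) / (2 * s * t) = 1"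
    proof -
      have "s\<^sup>2 + t\<^sup>2 - (dist (\<gamma> s) (\<gamma> t))\<^sup>2 = 2 * s * t"
        using that e(2)[of s t] by (simp add: power2_diff)
      then show ?thesis using that by simp
    qed
    then show ?thesis unfolding comparison_angle_def by (simp only: arccos_1)
  qed
  then have "eventually (\<lambda>(s, t). ereal (comparison_angle s t (dist (\<gamma> s) (\<gamma> t))) = ereal 0)
    (at_right 0 \<times>\<^sub>F at_right 0)"
    unfolding eventually_at_right0_prod_iff using e by (intro exI[of _ e]) auto
  then have "Limsup (at_right 0 \<times>\<^sub>F at_right 0) (\<lambda>(s, t). ereal (comparison_angle s t (dist (\<gamma> s) (\<gamma> t)))) =
    Limsup (at_right 0 \<times>\<^sub>F at_right 0) (\<lambda>x::real \<times> real. ereal 0)"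
    by (intro Limsup_eq) (auto simp: case_prod_unfold)
  also have "\<dots> = ereal 0"
    by (rule Limsup_const) (simp add: prod_filter_eq_bot trivial_limit_at_right_real)
  finally show ?thesis unfolding alexandrov_angle_def by simp
qed

text \<open>If the inequality failed, then at small parameters the comparison angles of the pairs 1,
  2 and 2, 3 would stay below some \<open>\<alpha>\<close> and \<open>\<beta>\<close>, while that of
  1, 3 would exceed \<open>\<alpha> + \<beta>\<close> at some pair. Splitting the planar triangle
  with angle \<open>\<alpha> + \<beta>\<close> at that pair yields a point on the second geodesic
  for which the triangle inequality of the space is violated.\<close>

lemma alexandrov_angle_triangle:
  assumes g1: "\<gamma>1 \<in> unit_germs p" and g2: "\<gamma>2 \<in> unit_germs p" and g3: "\<gamma>3 \<in> unit_germs p"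
  shows "alexandrov_angle \<gamma>1 \<gamma>3 \<le> alexandrov_angle \<gamma>1 \<gamma>2 + alexandrov_angle \<gamma>2 \<gamma>3"
proof (rule ccontr)
  assume neg: "\<not> ?thesis"
  let ?F = "at_right (0::real) \<times>\<^sub>F at_right (0::real)"
  \<comment> \<open>A third of the gap goes to each of \<open>\<alpha>\<close> and
    \<open>\<beta>\<close>. The last third keeps their sum strictly below the angle of 1, 3, hence
    below pi, as the planar splitting requires.\<close>
  define \<delta> where "\<delta> = (alexandrov_angle \<gamma>1 \<gamma>3 - alexandrov_angle \<gamma>1 \<gamma>2 - alexandrov_angle \<gamma>2 \<gamma>3) / 3"
  define \<alpha> \<beta> where "\<alpha> = alexandrov_angle \<gamma>1 \<gamma>2 + \<delta>" and "\<beta> = alexandrov_angle \<gamma>2 \<gamma>3 + \<delta>"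
  have \<delta>: "\<delta> > 0" using neg by (simp add: \<delta>_def)
  have \<alpha>: "0 < \<alpha>" "alexandrov_angle \<gamma>1 \<gamma>2 < \<alpha>" and \<beta>: "0 < \<beta>" "alexandrov_angle \<gamma>2 \<gamma>3 < \<beta>"
    using \<delta> alexandrov_angle_nonneg[OF g1 g2] alexandrov_angle_nonneg[OF g2 g3]
    by (auto simp: \<alpha>_def \<beta>_def)
  have "\<alpha> + \<beta> = alexandrov_angle \<gamma>1 \<gamma>3 - \<delta>" by (simp add: \<alpha>_def \<beta>_def \<delta>_def field_simps)
  then have sum: "\<alpha> + \<beta> < alexandrov_angle \<gamma>1 \<gamma>3" "\<alpha> + \<beta> < pi"
    using \<delta> alexandrov_angle_le_pi[OF g1 g3] by auto
  have "eventually (\<lambda>(s, t). comparison_angle s t (dist (\<gamma>1 s) (\<gamma>2 t)) < \<alpha>) ?F"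
    using Limsup_lessD[of ?F "\<lambda>(s, t). ereal (comparison_angle s t (dist (\<gamma>1 s) (\<gamma>2 t)))" "ereal \<alpha>"]
      \<alpha>(2) unfolding ereal_alexandrov_angle[OF g1 g2, symmetric] by (simp add: case_prod_unfold)
  then obtain r12 where r12: "r12 > 0"
    "\<And>s t. s \<in> {0<..<r12} \<Longrightarrow> t \<in> {0<..<r12} \<Longrightarrow> comparison_angle s t (dist (\<gamma>1 s) (\<gamma>2 t)) < \<alpha>"
    unfolding eventually_at_right0_prod_iff by auto
  have "eventually (\<lambda>(s, t). comparison_angle s t (dist (\<gamma>2 s) (\<gamma>3 t)) < \<beta>) ?F"
    using Limsup_lessD[of ?F "\<lambda>(s, t). ereal (comparison_angle s t (dist (\<gamma>2 s) (\<gamma>3 t)))" "ereal \<beta>"]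
      \<beta>(2) unfolding ereal_alexandrov_angle[OF g2 g3, symmetric] by (simp add: case_prod_unfold)
  then obtain r23 where r23: "r23 > 0"
    "\<And>s t. s \<in> {0<..<r23} \<Longrightarrow> t \<in> {0<..<r23} \<Longrightarrow> comparison_angle s t (dist (\<gamma>2 s) (\<gamma>3 t)) < \<beta>"
    unfolding eventually_at_right0_prod_iff by auto
  obtain b12 where b12: "0 < b12" "\<And>s t. 0 < s \<Longrightarrow> s < b12 \<Longrightarrow> 0 < t \<Longrightarrow> t < b12 \<Longrightarrow>
    dist (\<gamma>1 s) (\<gamma>2 t) \<le> s + t \<and> \<bar>s - t\<bar> \<le> dist (\<gamma>1 s) (\<gamma>2 t)"
    using germ_pair_bounds[OF g1 g2] by blast
  obtain b23 where b23: "0 < b23" "\<And>s t. 0 < s \<Longrightarrow> s < b23 \<Longrightarrow> 0 < t \<Longrightarrow> t < b23 \<Longrightarrow>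
    dist (\<gamma>2 s) (\<gamma>3 t) \<le> s + t \<and> \<bar>s - t\<bar> \<le> dist (\<gamma>2 s) (\<gamma>3 t)"
    using germ_pair_bounds[OF g2 g3] by blast
  obtain b13 where b13: "0 < b13" "\<And>s t. 0 < s \<Longrightarrow> s < b13 \<Longrightarrow> 0 < t \<Longrightarrow> t < b13 \<Longrightarrow>
    dist (\<gamma>1 s) (\<gamma>3 t) \<le> s + t \<and> \<bar>s - t\<bar> \<le> dist (\<gamma>1 s) (\<gamma>3 t)"
    using germ_pair_bounds[OF g1 g3] by blast
  define r where "r = Min {r12, r23, b12, b23, b13}"
  have r: "0 < r" "r \<le> r12" "r \<le> r23" "r \<le> b12" "r \<le> b23" "r \<le> b13"
    unfolding r_def using r12 r23 b12 b23 b13 by auto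
  \<comment> \<open>The upper limit exceeds \<open>\<alpha> + \<beta>\<close>, so pairs with a
    larger comparison angle occur within every radius.\<close>
  have "\<exists>s\<in>{0<..<r}. \<exists>u\<in>{0<..<r}. \<alpha> + \<beta> < comparison_angle s u (dist (\<gamma>1 s) (\<gamma>3 u))"
  proof (rule ccontr)
    assume "\<not> ?thesis"
    then have "eventually (\<lambda>(s, t). ereal (comparison_angle s t (dist (\<gamma>1 s) (\<gamma>3 t))) \<le> ereal (\<alpha> + \<beta>)) ?F"
      unfolding eventually_at_right0_prod_iff using r by (intro exI[of _ r]) (auto simp: not_less)
    then have "Limsup ?F (\<lambda>(s, t). ereal (comparison_angle s t (dist (\<gamma>1 s) (\<gamma>3 t)))) \<le> ereal (\<alpha> + \<beta>)"
      by (intro Limsup_bounded) (auto simp: case_prod_unfold)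
    then show False unfolding ereal_alexandrov_angle[OF g1 g3, symmetric] using sum by simp
  qed
  then obtain s u where su: "0 < s" "s < r" "0 < u" "u < r"
    and a13: "\<alpha> + \<beta> < comparison_angle s u (dist (\<gamma>1 s) (\<gamma>3 u))" by auto
  obtain t where t: "0 < t" "t \<le> max s u"
    "sqrt (s\<^sup>2 + t\<^sup>2 - 2 * s * t * cos \<alpha>) + sqrt (t\<^sup>2 + u\<^sup>2 - 2 * t * u * cos \<beta>) =
      sqrt (s\<^sup>2 + u\<^sup>2 - 2 * s * u * cos (\<alpha> + \<beta>))"
    using planar_triangle_split[OF su(1,3) \<alpha>(1) \<beta>(1) sum(2)] by blast
  \<comment> \<open>The bound by the longer side keeps the splitting point within the radius where
    the estimates for the second geodesic hold.\<close>
  have tr: "t < r" using t su by auto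
  have "dist (\<gamma>1 s) (\<gamma>2 t) < sqrt (s\<^sup>2 + t\<^sup>2 - 2 * s * t * cos \<alpha>)"
    using r12(2)[of s t] b12(2)[of s t] su t tr r \<alpha> \<beta> sum
    by (subst comparison_angle_less_iff(1)[symmetric]) auto
  moreover have "dist (\<gamma>2 t) (\<gamma>3 u) < sqrt (t\<^sup>2 + u\<^sup>2 - 2 * t * u * cos \<beta>)"
    using r23(2)[of t u] b23(2)[of t u] su t tr r \<alpha> \<beta> sum
    by (subst comparison_angle_less_iff(1)[symmetric]) auto
  moreover have "sqrt (s\<^sup>2 + u\<^sup>2 - 2 * s * u * cos (\<alpha> + \<beta>)) < dist (\<gamma>1 s) (\<gamma>3 u)"
    using a13 b13(2)[of s u] su r \<alpha> \<beta> sum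
    by (subst comparison_angle_less_iff(2)[symmetric]) auto
  ultimately show False
    using t(3) dist_triangle[of "\<gamma>1 s" "\<gamma>3 u" "\<gamma>2 t"] by linarith
qed

section \<open>The angle metric on the space of directions\<close>

lemma equiv_same_direction: "equiv (unit_germs p) (same_direction p)"
proof (rule equivI)
  show "refl_on (unit_germs p) (same_direction p)"
    by (auto simp: refl_on_def same_direction_def alexandrov_angle_refl)
  show "sym (same_direction p)"
    by (auto simp: sym_def same_direction_def alexandrov_angle_commute)
  show "trans (same_direction p)"
  proof (rule transI)
    fix x y z assume "(x, y) \<in> same_direction p" "(y, z) \<in> same_direction p"
    then show "(x, z) \<in> same_direction p"
      using alexandrov_angle_triangle[of x p y z] alexandrov_angle_nonneg[of x p z]
      by (auto simp: same_direction_def)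
  qed
  show "same_direction p \<subseteq> unit_germs p \<times> unit_germs p"
    by (auto simp: same_direction_def)
qed

text \<open>\<open>direction_angle\<close> is computed on chosen representatives. The classes are
  nonempty, so the choice lies in its class and the angle facts for germs pass to
  directions.\<close>

lemma some_representative:
  assumes "V \<in> directions p"
  shows "(SOME \<gamma>. \<gamma> \<in> V) \<in> unit_germs p" "same_direction p `` {SOME \<gamma>. \<gamma> \<in> V} = V"
proof -
  have "V \<noteq> {}"
    using assms in_quotient_imp_non_empty[OF equiv_same_direction] unfolding directions_def by blast
  then have S: "(SOME \<gamma>. \<gamma> \<in> V) \<in> V" by (simp add: some_in_eq)
  then show "(SOME \<gamma>. \<gamma> \<in> V) \<in> unit_germs p"
    using assms in_quotient_imp_subset[OF equiv_same_direction] unfolding directions_def by blast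
  show "same_direction p `` {SOME \<gamma>. \<gamma> \<in> V} = V"
    using S assms unfolding directions_def
    by (metis Image_singleton_iff equiv_class_eq equiv_same_direction quotientE)
qed

lemma direction_angle_nonneg: "V \<in> directions p \<Longrightarrow> W \<in> directions p \<Longrightarrow> 0 \<le> direction_angle V W"
  unfolding direction_angle_def by (blast intro: alexandrov_angle_nonneg some_representative(1))

lemma direction_angle_le_pi: "V \<in> directions p \<Longrightarrow> W \<in> directions p \<Longrightarrow> direction_angle V W \<le> pi"
  unfolding direction_angle_def by (blast intro: alexandrov_angle_le_pi some_representative(1))

lemma direction_angle_commute: "direction_angle V W = direction_angle W V"
  unfolding direction_angle_def by (rule alexandrov_angle_commute)

lemma direction_angle_triangle:
  "U \<in> directions p \<Longrightarrow> V \<in> directions p \<Longrightarrow> W \<in> directions p \<Longrightarrow>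
    direction_angle U W \<le> direction_angle U V + direction_angle V W"
  unfolding direction_angle_def by (blast intro: alexandrov_angle_triangle some_representative(1))

lemma direction_angle_eq_0_iff:
  assumes "V \<in> directions p" "W \<in> directions p"
  shows "direction_angle V W = 0 \<longleftrightarrow> V = W"
proof
  assume "direction_angle V W = 0"
  then have "(SOME \<gamma>. \<gamma> \<in> V, SOME \<gamma>. \<gamma> \<in> W) \<in> same_direction p"
    using assms by (simp add: direction_angle_def same_direction_def some_representative(1))
  then show "V = W"
    using some_representative(2)[OF assms(1)] some_representative(2)[OF assms(2)]
      equiv_class_eq[OF equiv_same_direction] by metis
next
  assume "V = W" then show "direction_angle V W = 0"
    using alexandrov_angle_refl[OF some_representative(1)[OF assms(1)]]
    by (simp add: direction_angle_def)
qed

section \<open>The tangent cone as a metric space\<close>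

text \<open>Two vectors of the cone span a planar sector, in which their cone distance is Euclidean.
  Only the cosine of the angle enters, so this covers the cone point too, whose angle is arbitrary
  but multiplied by length 0; it also shows that the square root in \<open>tdist\<close> is taken of
  a nonnegative number.\<close>

lemma tdist_eq_norm_rcis:
  assumes "cos (\<alpha> - \<beta>) = cos (direction_angle (snd V) (snd W))"
  shows "tdist V W = cmod (rcis (fst V) \<alpha> - rcis (fst W) \<beta>)"
proof -
  have "(cmod (rcis (fst V) \<alpha> - rcis (fst W) \<beta>))\<^sup>2 = (fst V)\<^sup>2 + (fst W)\<^sup>2 - 2 * tinner V W"
    unfolding norm_rcis_diff_squared assms tinner_def by simp
  then show ?thesis unfolding tdist_def by (simp add: real_sqrt_unique)
qed

lemma tdist_nonneg: "0 \<le> tdist V W"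
  using tdist_eq_norm_rcis[of "direction_angle (snd V) (snd W)" 0 V W] by simp

lemma tinner_commute: "tinner V W = tinner W V"
  by (simp add: tinner_def direction_angle_commute mult.commute)

lemma tdist_commute: "tdist V W = tdist W V"
  by (simp add: tdist_def tinner_commute add.commute)

lemma tdist_squared: "(tdist V W)\<^sup>2 = (fst V)\<^sup>2 + (fst W)\<^sup>2 - 2 * tinner V W"
  using tdist_eq_norm_rcis[of "direction_angle (snd V) (snd W)" 0 V W]
    norm_rcis_diff_squared[of "fst V" "direction_angle (snd V) (snd W)" "fst W" 0]
  by (simp add: tinner_def)

lemma tinner_cone_point [simp]: "tinner cone_point V = 0" "tinner V cone_point = 0"
  by (simp_all add: tinner_def cone_point_def)

lemma tangent_cone_cases:
  assumes "V \<in> tangent_cone p"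
  obtains "V = cone_point" "fst V = 0" | "0 < fst V" "snd V \<in> directions p"
  using assms unfolding tangent_cone_def cone_point_def by auto

lemma tangent_cone_fst_nonneg: "V \<in> tangent_cone p \<Longrightarrow> 0 \<le> fst V"
  by (auto elim: tangent_cone_cases)

lemma fst_eq_0_iff: "V \<in> tangent_cone p \<Longrightarrow> fst V = 0 \<longleftrightarrow> V = cone_point"
  by (auto simp: tangent_cone_def cone_point_def)

lemma snd_in_directions: "V \<in> tangent_cone p \<Longrightarrow> fst V \<noteq> 0 \<Longrightarrow> snd V \<in> directions p"
  by (auto simp: tangent_cone_def cone_point_def)

lemma tdist_cone_point:
  "V \<in> tangent_cone p \<Longrightarrow> tdist V cone_point = fst V"
  unfolding tdist_def by (simp add: tangent_cone_fst_nonneg) (simp add: cone_point_def tangent_cone_fst_nonneg)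

lemma tdist_cone_point_left:
  "V \<in> tangent_cone p \<Longrightarrow> tdist cone_point V = fst V"
  by (subst tdist_commute) (rule tdist_cone_point)

lemma abs_diff_le_tdist: "\<bar>fst U - fst V\<bar> \<le> tdist U V" if "U \<in> tangent_cone p" "V \<in> tangent_cone p"
  using tdist_eq_norm_rcis[of "direction_angle (snd U) (snd V)" 0 U V] that
    norm_triangle_ineq3[of "rcis (fst U) (direction_angle (snd U) (snd V))" "rcis (fst V) 0"]
  by (simp add: tangent_cone_fst_nonneg)

lemma tdist_le_add: "tdist U V \<le> fst U + fst V" if "U \<in> tangent_cone p" "V \<in> tangent_cone p"
  using tdist_eq_norm_rcis[of "direction_angle (snd U) (snd V)" 0 U V] that
    norm_triangle_ineq4[of "rcis (fst U) (direction_angle (snd U) (snd V))" "rcis (fst V) 0"]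
  by (simp add: tangent_cone_fst_nonneg)

text \<open>Unfold the sectors between \<open>U\<close>, \<open>V\<close> and between
  \<open>V\<close>, \<open>W\<close> side by side in the plane. The planar triangle inequality gives
  the claim as long as the total angle stays in [0, pi], where a larger angle means a longer
  opposite side.\<close>

lemma tdist_triangle:
  assumes U: "U \<in> tangent_cone p" and V: "V \<in> tangent_cone p" and W: "W \<in> tangent_cone p"
  shows "tdist U W \<le> tdist U V + tdist V W"
proof (cases "fst U = 0 \<or> fst V = 0 \<or> fst W = 0")
  case True
  then have "U = cone_point \<or> V = cone_point \<or> W = cone_point"
    using fst_eq_0_iff[OF U] fst_eq_0_iff[OF V] fst_eq_0_iff[OF W] by blast
  then show ?thesis
    using fst_eq_0_iff[OF U] fst_eq_0_iff[OF V] fst_eq_0_iff[OF W] tdist_cone_point[OF U] tdist_cone_point[OF V] tdist_cone_point[OF W]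
      abs_diff_le_tdist[OF U V] abs_diff_le_tdist[OF V W] tdist_le_add[OF U W]
      tdist_cone_point_left[OF V] tdist_cone_point_left[OF W]
    by auto
next
  case False
  then have d: "snd U \<in> directions p" "snd V \<in> directions p" "snd W \<in> directions p"
    using False snd_in_directions[OF U] snd_in_directions[OF V] snd_in_directions[OF W] by blast+
  let ?u = "fst U" and ?v = "fst V" and ?w = "fst W"
  have uvw: "0 \<le> ?u" "0 \<le> ?v" "0 \<le> ?w" using U V W by (auto intro: tangent_cone_fst_nonneg)
  let ?\<alpha> = "direction_angle (snd U) (snd V)" and ?\<gamma> = "direction_angle (snd U) (snd W)"
  \<comment> \<open>Truncating the second angle keeps the total at most pi. It only shortens the
    side from \<open>V\<close> to \<open>W\<close>, and the total still dominates the angle between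
    \<open>U\<close> and \<open>W\<close>: either it is the full sum of angles, or it equals
    pi.\<close>
  define \<beta> where "\<beta> = min (direction_angle (snd V) (snd W)) (pi - ?\<alpha>)"
  have \<beta>: "0 \<le> \<beta>" "\<beta> \<le> direction_angle (snd V) (snd W)" "?\<alpha> + \<beta> \<le> pi" "?\<gamma> \<le> ?\<alpha> + \<beta>"
    unfolding \<beta>_def using d direction_angle_triangle[OF d] direction_angle_le_pi[OF d(1,3)]
    by (auto intro: direction_angle_nonneg direction_angle_le_pi)
  have "tdist U W = sqrt (?u\<^sup>2 + ?w\<^sup>2 - 2 * ?u * ?w * cos ?\<gamma>)"
    by (simp add: tdist_def tinner_def)
  also have "\<dots> \<le> sqrt (?u\<^sup>2 + ?w\<^sup>2 - 2 * ?u * ?w * cos (?\<alpha> + \<beta>))"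
    using \<beta> uvw d by (auto intro!: mult_left_mono cos_monotone_0_pi_le direction_angle_nonneg)
  also have "\<dots> = cmod (rcis ?u ?\<alpha> - rcis ?w (- \<beta>))"
    using norm_rcis_diff_squared[of ?u ?\<alpha> ?w "- \<beta>"] by (simp add: real_sqrt_unique)
  also have "\<dots> \<le> cmod (rcis ?u ?\<alpha> - rcis ?v 0) + cmod (rcis ?v 0 - rcis ?w (- \<beta>))"
    using norm_triangle_ineq[of "rcis ?u ?\<alpha> - rcis ?v 0" "rcis ?v 0 - rcis ?w (- \<beta>)"] by simp
  also have "cmod (rcis ?u ?\<alpha> - rcis ?v 0) = tdist U V"
    by (rule tdist_eq_norm_rcis[symmetric]) simp
  also have "cmod (rcis ?v 0 - rcis ?w (- \<beta>)) = sqrt (?v\<^sup>2 + ?w\<^sup>2 - 2 * ?v * ?w * cos \<beta>)"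
    using norm_rcis_diff_squared[of ?v 0 ?w "- \<beta>"] by (simp add: real_sqrt_unique)
  also have "\<dots> \<le> sqrt (?v\<^sup>2 + ?w\<^sup>2 - 2 * ?v * ?w * cos (direction_angle (snd V) (snd W)))"
    using \<beta> uvw d by (auto intro!: mult_left_mono cos_monotone_0_pi_le direction_angle_le_pi)
  also have "\<dots> = tdist V W" by (simp add: tdist_def tinner_def)
  finally show ?thesis by simp
qed

lemma tdist_eq_0_iff:
  assumes V: "V \<in> tangent_cone p" and W: "W \<in> tangent_cone p"
  shows "tdist V W = 0 \<longleftrightarrow> V = W"
proof (cases "fst V = 0 \<or> fst W = 0")
  case True
  then have "V = cone_point \<or> W = cone_point" using fst_eq_0_iff[OF V] fst_eq_0_iff[OF W] by blast
  then show ?thesis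
    using tdist_cone_point[OF V] tdist_cone_point[OF W] fst_eq_0_iff[OF V] fst_eq_0_iff[OF W]
      tdist_cone_point_left[OF V] tdist_cone_point_left[OF W]
    by auto
next
  case False
  then have d: "snd V \<in> directions p" "snd W \<in> directions p" "0 < fst V" "0 < fst W"
    using False snd_in_directions[OF V] snd_in_directions[OF W]
      tangent_cone_fst_nonneg[OF V] tangent_cone_fst_nonneg[OF W] by (simp_all add: less_le)
  show ?thesis
  proof
    assume 0: "tdist V W = 0"
    then have eq: "fst V = fst W" using abs_diff_le_tdist[OF V W] by simp
    then have "cos (direction_angle (snd V) (snd W)) = cos 0"
      using 0 tdist_squared[of V W] d by (simp add: tinner_def power2_eq_square)
    then have "direction_angle (snd V) (snd W) = 0"
      using cos_inj_pi[of "direction_angle (snd V) (snd W)" 0] d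
      by (simp add: direction_angle_nonneg direction_angle_le_pi)
    then show "V = W" using eq direction_angle_eq_0_iff[OF d(1,2)] by (simp add: prod_eq_iff)
  next
    assume "V = W"
    moreover have "direction_angle (snd W) (snd W) = 0" using d direction_angle_eq_0_iff by blast
    ultimately show "tdist V W = 0" by (simp add: tdist_def tinner_def power2_eq_square)
  qed
qed

section \<open>Topology and Borel sets of the tangent cone\<close>

lemma Metric_space_tangent_cone: "Metric_space (tangent_cone p) tdist"
  by unfold_locales (fact tdist_nonneg tdist_commute tdist_eq_0_iff tdist_triangle)+

lemma cone_point_in_tangent_cone [simp]: "cone_point \<in> tangent_cone p"
  by (simp add: tangent_cone_def)

lemma topspace_tangent_topology [simp]: "topspace (tangent_topology p) = tangent_cone p"
  unfolding tangent_topology_def by (rule Metric_space.topspace_mtopology[OF Metric_space_tangent_cone])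

lemma metrizable_space_tangent_topology: "metrizable_space (tangent_topology p)"
  unfolding tangent_topology_def by (rule Metric_space.metrizable_space_mtopology[OF Metric_space_tangent_cone])

lemma continuous_map_tangent_real:
  assumes "\<And>V W. V \<in> tangent_cone p \<Longrightarrow> W \<in> tangent_cone p \<Longrightarrow> \<bar>f V - f W\<bar> \<le> tdist V W"
  shows "continuous_map (tangent_topology p) euclideanreal f"
proof -
  interpret Metric_space "tangent_cone p" tdist by (rule Metric_space_tangent_cone)
  have "continuous_map (tangent_topology p) Met_TC.mtopology f"
    unfolding tangent_topology_def metric_continuous_map[OF Met_TC.Metric_space_axioms]
  proof (intro conjI ballI allI impI)
    fix a \<epsilon> assume "a \<in> tangent_cone p" "0 < (\<epsilon>::real)"
    then show "\<exists>\<delta>>0. \<forall>x. x \<in> tangent_cone p \<and> tdist a x < \<delta> \<longrightarrow> dist (f a) (f x) < \<epsilon>"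
      using assms[of a] unfolding dist_real_def by (meson le_less_trans)
  qed simp
  then show ?thesis by simp
qed

text \<open>By polarization the inner product is a polynomial in the length of \<open>U\<close> and
  the distance from \<open>U\<close> to \<open>V\<close>, both of which are 1-Lipschitz in
  \<open>U\<close>.\<close>

lemma continuous_map_tinner:
  assumes V: "V \<in> tangent_cone p"
  shows "continuous_map (tangent_topology p) euclideanreal (\<lambda>U. tinner U V)"
proof -
  have "continuous_map (tangent_topology p) euclideanreal fst"
    by (rule continuous_map_tangent_real) (rule abs_diff_le_tdist)
  moreover have "continuous_map (tangent_topology p) euclideanreal (\<lambda>U. tdist U V)"
  proof (rule continuous_map_tangent_real)
    fix U W assume "U \<in> tangent_cone p" "W \<in> tangent_cone p"
    then show "\<bar>tdist U V - tdist W V\<bar> \<le> tdist U W"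
      using Metric_space.mdist_reverse_triangle[OF Metric_space_tangent_cone, of U p V W] V
      by (simp add: tdist_commute[of V W])
  qed
  ultimately have "continuous_map (tangent_topology p) euclideanreal
      (\<lambda>U. ((fst U)\<^sup>2 + (fst V)\<^sup>2 - (tdist U V)\<^sup>2) / 2)"
    by (intro continuous_intros) auto
  then show ?thesis by (simp add: tdist_squared)
qed

lemma space_tangent_borel [simp]: "space (tangent_borel p) = tangent_cone p"
  unfolding tangent_borel_def using openin_subset[of "tangent_topology p"] by (intro space_measure_of) auto

lemma openin_in_sets_tangent_borel: "openin (tangent_topology p) U \<Longrightarrow> U \<in> sets (tangent_borel p)"
  unfolding tangent_borel_def
  by (subst sets_measure_of) (use openin_subset[of "tangent_topology p"] in auto)

lemma closedin_in_sets_tangent_borel: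
  assumes "closedin (tangent_topology p) C"
  shows "C \<in> sets (tangent_borel p)"
proof -
  have "C = space (tangent_borel p) - (tangent_cone p - C)"
    using closedin_subset[OF assms] by auto
  then show ?thesis using assms openin_in_sets_tangent_borel[of p "tangent_cone p - C"]
    by (metis closedin_def sets.compl_sets topspace_tangent_topology)
qed

lemma singleton_in_sets_tangent_borel:
  assumes "V \<in> tangent_cone p"
  shows "{V} \<in> sets (tangent_borel p)"
proof -
  have "closedin (tangent_topology p) {V}"
    using metrizable_imp_t1_space[OF metrizable_space_tangent_topology[of p]] assms
    by (simp add: closedin_t1_singleton)
  then show ?thesis by (rule closedin_in_sets_tangent_borel)
qed

lemma borel_measurable_tangent_borel:
  fixes f :: "'a::metric_space tangent \<Rightarrow> 'b::topological_space"
  assumes "continuous_map (tangent_topology p) euclidean f"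
  shows "f \<in> borel_measurable (tangent_borel p)"
proof (rule borel_measurableI)
  fix S :: "'b set" assume "open S"
  then have "openin (tangent_topology p) {x \<in> topspace (tangent_topology p). f x \<in> S}"
    using assms by (intro openin_continuous_map_preimage) auto
  then show "f -` S \<inter> space (tangent_borel p) \<in> sets (tangent_borel p)"
    by (auto intro!: openin_in_sets_tangent_borel simp: vimage_def Int_def conj_commute)
qed

section \<open>Dilations, logarithms and the Lindelof property\<close>

lemma fst_tscale [simp]: "fst (tscale t V) = t * fst V"
  by (simp add: tscale_def cone_point_def)

lemma tinner_tscale_left [simp]: "tinner (tscale t V) W = t * tinner V W"
  by (auto simp: tscale_def tinner_def cone_point_def)

lemma tinner_tscale_right [simp]: "tinner V (tscale t W) = t * tinner V W"
  by (simp add: tinner_commute[of V])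

lemma tdist_tscale: "0 \<le> t \<Longrightarrow> tdist (tscale t V) (tscale t W) = t * tdist V W"
  by (rule power2_eq_imp_eq)
    (simp_all only: tdist_squared power_mult_distrib, simp_all add: tdist_nonneg power2_eq_square algebra_simps)

lemma tscale_in_tangent_cone: "V \<in> tangent_cone p \<Longrightarrow> 0 \<le> t \<Longrightarrow> tscale t V \<in> tangent_cone p"
  by (auto simp: tscale_def tangent_cone_def cone_point_def)

lemma tscale_one: "V \<in> tangent_cone p \<Longrightarrow> tscale 1 V = V"
  by (auto simp: tscale_def tangent_cone_def cone_point_def)

lemma continuous_map_tscale:
  assumes "0 < t"
  shows "continuous_map (tangent_topology p) (tangent_topology p) (tscale t)"
proof -
  interpret Metric_space "tangent_cone p" tdist by (rule Metric_space_tangent_cone)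
  show ?thesis
    unfolding tangent_topology_def metric_continuous_map[OF Metric_space_axioms]
  proof (intro conjI ballI allI impI)
    show "tscale t ` tangent_cone p \<subseteq> tangent_cone p" using assms tscale_in_tangent_cone[of _ p t] by (simp add: image_subset_iff)
    fix a \<epsilon> assume "0 < (\<epsilon>::real)"
    then show "\<exists>\<delta>>0. \<forall>x. x \<in> tangent_cone p \<and> tdist a x < \<delta> \<longrightarrow> tdist (tscale t a) (tscale t x) < \<epsilon>"
      using assms by (intro exI[of _ "\<epsilon> / t"]) (auto simp: tdist_tscale field_simps)
  qed
qed

lemma log_map_in_tangent_cone: "log_map p v \<in> tangent_cone p"
proof (cases "v \<noteq> p \<and> unique_shortest_path p v")
  case True
  then have "\<exists>\<gamma>. joins UNIV dist \<gamma> p v" by (simp add: unique_shortest_path_def)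
  then have "joins UNIV dist (SOME \<gamma>. joins UNIV dist \<gamma> p v) p v" by (rule someI_ex)
  then have "(SOME \<gamma>. joins UNIV dist \<gamma> p v) \<in> unit_germs p"
    using True by (auto simp: joins_def unit_germs_def intro!: exI[of _ "dist p v"])
  then show ?thesis
    using True by (auto simp: log_map_def tangent_cone_def directions_def intro!: quotientI)
qed (auto simp: log_map_def)

text \<open>By uniqueness the path chosen inside \<open>log_map\<close> agrees with
  \<open>\<gamma>\<close> up to time \<open>s\<close>, and the direction depends only on the germ at
  0.\<close>

lemma log_map_along_geodesic:
  assumes \<gamma>: "geodesic_on UNIV dist e \<gamma>" "\<gamma> 0 = p" and s: "0 < s" "s \<le> e"
    and unique: "unique_shortest_path p (\<gamma> s)"
  shows "log_map p (\<gamma> s) = (s, same_direction p `` {\<gamma>})"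
proof -
  have dist: "dist p (\<gamma> s) = s"
    using \<gamma> s unfolding geodesic_on_def by (metis abs_minus_commute abs_of_pos atLeastAtMost_iff diff_0_right less_eq_real_def order_trans)
  then have join: "joins UNIV dist \<gamma> p (\<gamma> s)"
    using \<gamma> s by (auto simp: joins_def geodesic_on_def)
  define \<gamma>' where "\<gamma>' = (SOME \<gamma>'. joins UNIV dist \<gamma>' p (\<gamma> s))"
  have join': "joins UNIV dist \<gamma>' p (\<gamma> s)" unfolding \<gamma>'_def
    by (rule someI[of "\<lambda>\<gamma>'. joins UNIV dist \<gamma>' p (\<gamma> s)"]) (rule join)
  have "\<gamma>' t = \<gamma> t" if "t \<in> {0..s}" for t
    using unique join join' that dist by (auto simp: unique_shortest_path_def)
  then have angle: "alexandrov_angle \<gamma>' \<gamma>'' = alexandrov_angle \<gamma> \<gamma>''" for \<gamma>''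
    using s by (intro alexandrov_angle_cong)
  have "\<gamma> \<in> unit_germs p" "\<gamma>' \<in> unit_germs p"
    using \<gamma> s join' dist by (auto simp: unit_germs_def joins_def intro: exI[of _ e] exI[of _ s])
  then have "same_direction p `` {\<gamma>'} = same_direction p `` {\<gamma>}"
    using angle by (auto simp: same_direction_def)
  moreover have "\<gamma> s \<noteq> p" using dist s by auto
  ultimately show ?thesis using unique dist by (simp add: log_map_def \<gamma>'_def[symmetric])
qed

text \<open>Each direction is the direction of a geodesic, and nearby points on that geodesic have
  short vectors of this direction as logarithms. Integer dilations of short vectors reach every
  length.\<close>

lemma tangent_cone_eq_scaled_logs:
  assumes e: "log_embeds_ball p e" and r: "0 < r" "r < e"
  shows "tangent_cone p = (\<Union>n. tscale (real (Suc n)) ` log_map p ` cball p r)"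
proof (intro equalityI subsetI)
  fix V assume V: "V \<in> tangent_cone p"
  show "V \<in> (\<Union>n. tscale (real (Suc n)) ` log_map p ` cball p r)"
  proof (cases rule: tangent_cone_cases[OF V])
    case 1
    then have "V = tscale (real (Suc 0)) (log_map p p)" by (simp add: log_map_def tscale_def cone_point_def)
    then show ?thesis using r by (metis UN_I UNIV_I centre_in_cball imageI less_imp_le)
  next
    case 2
    then obtain \<gamma> where \<gamma>: "\<gamma> \<in> unit_germs p" "snd V = same_direction p `` {\<gamma>}"
      unfolding directions_def by (auto elim: quotientE)
    then obtain l where l: "0 < l" "geodesic_on UNIV dist l \<gamma>" "\<gamma> 0 = p"
      unfolding unit_germs_def by blast
    \<comment> \<open>Chosen so that the length of \<open>V\<close> divided by \<open>n + 1\<close>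
      fits both into the domain of the geodesic and into the ball of radius
      \<open>r\<close>.\<close>
    obtain n where n: "fst V / min l r < real n" using reals_Archimedean2 by blast
    define s where "s = fst V / real (Suc n)"
    have s: "0 < s" "s \<le> l" "s \<le> r"
    proof -
      have "fst V < real n * min l r" using n l r by (simp add: pos_divide_less_eq)
      also have "\<dots> \<le> real (Suc n) * min l r" using l r by (intro mult_right_mono) auto
      finally have "s < min l r"
        by (simp only: s_def pos_divide_less_eq of_nat_0_less_iff zero_less_Suc mult.commute)
      then show "s \<le> l" "s \<le> r" by simp_all
      show "0 < s" using 2 by (simp add: s_def)
    qed
    have ds: "dist p (\<gamma> s) = s"
      using l s unfolding geodesic_on_def by (metis abs_minus_commute abs_of_pos atLeastAtMost_iff diff_0_right less_eq_real_def order_trans)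
    then have "log_map p (\<gamma> s) = (s, snd V)"
      unfolding \<gamma>(2) using l s e r by (intro log_map_along_geodesic[of l]) (auto simp: log_embeds_ball_def)
    then have "V = tscale (real (Suc n)) (log_map p (\<gamma> s))"
      using 2 s by (auto simp: tscale_def s_def prod_eq_iff)
    then show ?thesis using ds s by (intro UN_I[of n]) auto
  qed
next
  fix V assume "V \<in> (\<Union>n. tscale (real (Suc n)) ` log_map p ` cball p r)"
  then show "V \<in> tangent_cone p" by (auto intro!: tscale_in_tangent_cone log_map_in_tangent_cone)
qed

text \<open>The logarithm maps a small compact ball to a compact set, and countably many dilations
  of that set cover the cone, which is therefore sigma-compact.\<close>

lemma Lindelof_space_tangent_topology:
  fixes p :: "'a::metric_space"
  assumes lc: "locally_compact_space (euclidean :: 'a topology)" and e: "log_embeds_ball p e"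
  shows "Lindelof_space (tangent_topology p)"
proof -
  have "\<exists>U K. openin euclidean U \<and> compactin euclidean K \<and> p \<in> U \<and> U \<subseteq> K"
    using lc unfolding locally_compact_space_def by (rule bspec) simp
  then obtain U K where UK: "openin euclidean U" "compactin euclidean K" "p \<in> U" "U \<subseteq> K"
    by blast
  then have "open U" "compact K" by auto
  then obtain r0 where r0: "0 < r0" "cball p r0 \<subseteq> U"
    using UK open_contains_cball by blast
  \<comment> \<open>The closed ball must lie in a compact neighbourhood and also inside the open
    ball on which the logarithm is continuous.\<close>
  define r where "r = min r0 (e / 2)"
  have r: "0 < r" "r < e" "r \<le> r0" using r0 e by (auto simp: r_def log_embeds_ball_def)
  have "cball p r = K \<inter> cball p r" using r r0 UK by fastforce
  then have "compact (cball p r)" using \<open>compact K\<close> by (metis closed_cball compact_Int_closed)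
  then have "compactin (top_of_set (ball p e)) (cball p r)"
    using r by (auto simp: compactin_subtopology)
  moreover have "continuous_map (top_of_set (ball p e)) (tangent_topology p) (log_map p)"
    using e unfolding log_embeds_ball_def
    by (auto dest!: homeomorphic_imp_continuous_map simp: continuous_map_in_subtopology)
  ultimately have "compactin (tangent_topology p) (log_map p ` cball p r)"
    by (rule image_compactin)
  then have "compactin (tangent_topology p) (tscale (real (Suc n)) ` log_map p ` cball p r)" for n
    by (rule image_compactin) (rule continuous_map_tscale, simp)
  then have "Lindelof_space (subtopology (tangent_topology p) (tscale (real (Suc n)) ` log_map p ` cball p r))" for n
    by (intro compact_imp_Lindelof_space) (simp add: compactin_subspace)
  then have "Lindelof_space (subtopology (tangent_topology p)
      (\<Union>(range (\<lambda>n. tscale (real (Suc n)) ` log_map p ` cball p r))))"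
    by (intro Lindelof_space_Union) auto
  then show ?thesis
    unfolding tangent_cone_eq_scaled_logs[OF e r(1,2), symmetric]
    by (metis subtopology_topspace topspace_tangent_topology)
qed

text \<open>Only closed subspaces inherit the Lindelof property, so the open set is first written as an
  \<open>F\<^sub>\<sigma>\<close>.\<close>

lemma emeasure_locally_null_open:
  assumes X: "metrizable_space X" "Lindelof_space X" and W: "openin X W"
    and sets: "\<And>U. openin X U \<Longrightarrow> U \<in> sets M"
    and null: "\<And>x. x \<in> W \<Longrightarrow> \<exists>U. openin X U \<and> x \<in> U \<and> emeasure M U = 0"
  shows "emeasure M W = 0"
proof -
  obtain C where C: "\<And>n::nat. closedin X (C n)" "\<Union> (range C) = W"
    using open_imp_fsigma_in[OF X(1) W] unfolding fsigma_in_ascending by blast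
  obtain u where u: "\<And>x. x \<in> W \<Longrightarrow> openin X (u x) \<and> x \<in> u x \<and> emeasure M (u x) = 0"
    using null by metis
  have "\<exists>V. countable V \<and> V \<subseteq> u ` W \<and> C n \<subseteq> \<Union>V" for n
  proof -
    have "\<forall>U\<in>u ` W. openin X U" "C n \<subseteq> \<Union>(u ` W)" using u C(2) by blast+
    moreover have "\<forall>\<U>. (\<forall>U\<in>\<U>. openin X U) \<and> C n \<subseteq> \<Union>\<U> \<longrightarrow>
        (\<exists>V. countable V \<and> V \<subseteq> \<U> \<and> C n \<subseteq> \<Union>V)"
      using Lindelof_space_closedin_subtopology[OF X(2) C(1)[of n]]
      by (simp only: Lindelof_space_subtopology_subset[OF closedin_subset[OF C(1)]])
    ultimately show ?thesis by simp
  qed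
  then obtain V where V: "\<And>n. countable (V n) \<and> V n \<subseteq> u ` W \<and> C n \<subseteq> \<Union>(V n)" by metis
  define \<V> where "\<V> = (\<Union>n. V n)"
  have \<V>: "countable \<V>" "\<V> \<subseteq> u ` W" "W \<subseteq> \<Union>\<V>"
    using V C(2) unfolding \<V>_def by (simp, blast, blast)
  have "\<Union>\<V> \<in> null_sets M"
  proof (rule null_sets_UN'[where N = "\<lambda>x. x", simplified])
    show "countable \<V>" by fact
    show "U \<in> null_sets M" if "U \<in> \<V>" for U using that \<V>(2) u sets by (auto simp: null_sets_def)
  qed
  then show ?thesis using \<V>(3) sets[OF W] by (metis null_setsD1 null_sets_subset)
qed

section \<open>Uniqueness of laws of random fields\<close>

text \<open>The moments with \<open>d = 0\<close> and \<open>d = - pi / 2\<close> are the real and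
  imaginary parts of the Fourier transform, and \<open>s = d = 0\<close> gives the total mass. If
  that mass is nonzero, both measures are normalised by it and Levy's uniqueness theorem applies; if
  it is zero, both vanish.\<close>

lemma finite_real_measure_eqI_cos:
  fixes M1 M2 :: "real measure"
  assumes "finite_measure M1" "finite_measure M2"
    and sets: "sets M1 = sets borel" "sets M2 = sets borel"
    and eq: "\<And>s d. (\<integral>x. cos (s * x + d) \<partial>M1) = (\<integral>x. cos (s * x + d) \<partial>M2)"
  shows "M1 = M2"
proof -
  interpret M1: finite_measure M1 by fact
  interpret M2: finite_measure M2 by fact
  note [measurable_cong] = sets
  have space: "space M1 = UNIV" "space M2 = UNIV" using sets_eq_imp_space_eq[OF sets(1)] sets_eq_imp_space_eq[OF sets(2)] by auto
  define m where "m = measure M1 (space M1)"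
  have m: "measure M1 (space M1) = m" "measure M2 (space M2) = m"
    using eq[of 0 0] by (simp_all add: m_def)
  show ?thesis
  proof (cases "m = 0")
    case True
    then have "emeasure M1 (space M1) = 0" "emeasure M2 (space M2) = 0"
      using m by (simp_all add: M1.emeasure_eq_measure M2.emeasure_eq_measure)
    then have "emeasure M1 A = 0" "emeasure M2 A = 0" for A
      using emeasure_space[of M1 A] emeasure_space[of M2 A] by auto
    then show ?thesis using sets by (intro measure_eqI) auto
  next
    case False
    then have m0: "m > 0" using measure_nonneg[of M1 "space M1"] by (simp add: m_def less_le)
    let ?D = "\<lambda>M. density M (\<lambda>_. ennreal (1 / m))"
    have prob: "prob_space (?D M)" if "measure M (space M) = m" "finite_measure M" for M :: "real measure"
    proof (rule prob_spaceI)
      interpret finite_measure M by fact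
      show "emeasure (?D M) (space (?D M)) = 1"
        using that m0 by (simp add: emeasure_density_const emeasure_eq_measure ennreal_mult[symmetric])
    qed
    have char: "char (?D M) t = Complex ((\<integral>x. cos (t * x + 0) \<partial>M) / m) ((\<integral>x. cos (t * x + - pi / 2) \<partial>M) / m)"
      if "sets M = sets borel" "finite_measure M" for M :: "real measure" and t
    proof -
      interpret finite_measure M by fact
      note [measurable_cong] = that(1)
      have "integrable M (\<lambda>x. iexp (t * x))"
        by (intro integrable_const_bound[where B = 1]) auto
      then have "(\<integral>x. iexp (t * x) \<partial>M) = Complex (\<integral>x. cos (t * x) \<partial>M) (\<integral>x. sin (t * x) \<partial>M)"
        by (intro complex_eqI) (simp_all add: integral_Re[symmetric] integral_Im[symmetric] Re_exp Im_exp)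
      moreover have "char (?D M) t = (\<integral>x. (1 / m) *\<^sub>R iexp (t * x) \<partial>M)"
        unfolding char_def using m0 by (subst integral_density) auto
      moreover have "cos (t * x + - pi / 2) = sin (t * x)" for x
        using sin_cos_eq[of "t * x"] cos_minus[of "pi / 2 - t * x"] by simp
      ultimately show ?thesis
        by (simp add: complex_eq_iff)
    qed
    have "real_distribution (?D M1)" "real_distribution (?D M2)"
      using prob m assms by (auto simp: real_distribution_def real_distribution_axioms_def)
    moreover have "char (?D M1) = char (?D M2)"
      unfolding fun_eq_iff char[OF sets(1) assms(1)] char[OF sets(2) assms(2)] eq by simp
    ultimately have D: "?D M1 = ?D M2" by (rule Levy_uniqueness)
    show ?thesis
    proof (rule measure_eqI)
      show "sets M1 = sets M2" using sets by simp
      fix A assume A: "A \<in> sets M1"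
      then have "ennreal (1 / m) * emeasure M1 A = ennreal (1 / m) * emeasure M2 A"
        using arg_cong[OF D, of "\<lambda>M. emeasure M A"] sets by (simp add: emeasure_density_const)
      then show "emeasure M1 A = emeasure M2 A"
        using m0 by (simp add: ennreal_mult_cancel_left)
    qed
  qed
qed

lemma integral_density_distr_bounded:
  fixes f :: "real \<Rightarrow> real"
  assumes [measurable]: "h \<in> borel_measurable P" "Z \<in> borel_measurable P" "f \<in> borel_measurable borel"
    and "\<And>\<omega>. 0 \<le> h \<omega>"
  shows "(\<integral>x. f x \<partial>distr (density P (\<lambda>\<omega>. ennreal (h \<omega>))) borel Z) = (\<integral>\<omega>. h \<omega> * f (Z \<omega>) \<partial>P)"
  using assms(4) by (subst integral_distr, simp, simp, subst integral_density) auto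

text \<open>The bound 2 is that of \<open>1 + cos\<close> times a product of indicators, the
  densities to which this is applied.\<close>

lemma finite_measure_density_distr:
  fixes h :: "'v \<Rightarrow> real"
  assumes "prob_space P" and [measurable]: "h \<in> borel_measurable P" "Z \<in> borel_measurable P"
    and h: "\<And>\<omega>. 0 \<le> h \<omega>" "\<And>\<omega>. h \<omega> \<le> 2"
  shows "finite_measure (distr (density P (\<lambda>\<omega>. ennreal (h \<omega>))) borel (Z :: _ \<Rightarrow> real))"
proof (rule finite_measure.finite_measure_distr)
  interpret prob_space P by fact
  have "(\<integral>\<^sup>+\<omega>. ennreal (h \<omega>) \<partial>P) \<le> (\<integral>\<^sup>+\<omega>. 2 \<partial>P)"
    using h(2) by (intro nn_integral_mono) (metis ennreal_leI ennreal_numeral zero_le_numeral)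
  also have "\<dots> < \<infinity>" by (simp add: emeasure_space_1)
  finally show "finite_measure (density P (\<lambda>\<omega>. ennreal (h \<omega>)))"
    by (intro finite_measureI) (simp add: emeasure_density cong: nn_integral_cong)
qed simp

lemma prod_indicator_bounds:
  "0 \<le> (\<Prod>k\<in>K. indicator (A k) (x k) :: real)" "(\<Prod>k\<in>K. indicator (A k) (x k) :: real) \<le> 1"
  by (auto intro!: prod_nonneg prod_le_1 simp: indicator_def)

text \<open>The product-to-sum formula absorbs the new factor in coordinate \<open>k\<close> into
  the frequencies and the phase. A cosine moment for the density \<open>W\<close> times
  \<open>1 + cos\<close> is thereby a combination of cosine moments weighted by \<open>W\<close>
  alone, which an induction over the boxed coordinates already controls.\<close>

lemma weighted_cos_moment:
  fixes X :: "'i \<Rightarrow> 'v \<Rightarrow> real" and A :: "'i \<Rightarrow> real set"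
  assumes "prob_space P" "finite J" "k \<in> J" "K \<subseteq> J"
    and X: "\<And>j. j \<in> J \<Longrightarrow> X j \<in> borel_measurable P"
    and A: "\<And>j. j \<in> J \<Longrightarrow> A j \<in> sets borel"
  defines "W \<equiv> \<lambda>\<omega>. \<Prod>j\<in>K. indicator (A j) (X j \<omega>) :: real"
    and "S \<equiv> \<lambda>t c \<omega>. (\<Sum>j\<in>J. t j * X j \<omega>) + c"
  shows "(\<integral>\<omega>. W \<omega> * (1 + cos (S t c \<omega>)) * cos (s * X k \<omega> + d) \<partial>P) =
    (\<integral>\<omega>. W \<omega> * cos (S ((\<lambda>_. 0)(k := s)) d \<omega>) \<partial>P) +
    (\<integral>\<omega>. W \<omega> * cos (S (t(k := t k + s)) (c + d) \<omega>) \<partial>P) / 2 +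
    (\<integral>\<omega>. W \<omega> * cos (S (t(k := t k - s)) (c - d) \<omega>) \<partial>P) / 2"
proof -
  interpret prob_space P by fact
  have [measurable]: "X j \<in> borel_measurable P" "A j \<in> sets borel" if "j \<in> J" for j using X A that by auto
  have [measurable]: "W \<in> borel_measurable P" "S t c \<in> borel_measurable P" for t c
    unfolding W_def S_def using subsetD[OF \<open>K \<subseteq> J\<close>] by measurable
  have int: "integrable P (\<lambda>\<omega>. W \<omega> * cos (S t c \<omega>))" for t c
  proof (intro integrable_const_bound[where B = 1] AE_I2)
    fix \<omega>
    have "\<bar>W \<omega>\<bar> \<le> 1"
      unfolding W_def using prod_indicator_bounds[of A "\<lambda>j. X j \<omega>" K] by simp
    then show "norm (W \<omega> * cos (S t c \<omega>)) \<le> 1" by (simp add: abs_mult mult_le_one)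
  qed measurable
  have sum: "(\<Sum>j\<in>J. t j * X j \<omega>) = t k * X k \<omega> + (\<Sum>j\<in>J - {k}. t j * X j \<omega>)" for t \<omega>
    using \<open>finite J\<close> \<open>k \<in> J\<close> by (rule sum.remove)
  have S: "S ((\<lambda>_. 0)(k := s)) d \<omega> = s * X k \<omega> + d"
    "S (t(k := t k + s)) (c + d) \<omega> = S t c \<omega> + (s * X k \<omega> + d)"
    "S (t(k := t k - s)) (c - d) \<omega> = S t c \<omega> - (s * X k \<omega> + d)" for \<omega>
    unfolding S_def sum by (simp_all add: algebra_simps)
  have product: "w * (1 + cos a) * cos b = w * cos b + (w * cos (a + b) / 2 + w * cos (a - b) / 2)"
    for w a b :: real
    by (simp add: cos_add cos_diff field_simps)
  have "(\<integral>\<omega>. W \<omega> * (1 + cos (S t c \<omega>)) * cos (s * X k \<omega> + d) \<partial>P) =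
    (\<integral>\<omega>. W \<omega> * cos (S ((\<lambda>_. 0)(k := s)) d \<omega>) + (W \<omega> * cos (S (t(k := t k + s)) (c + d) \<omega>) / 2 +
      W \<omega> * cos (S (t(k := t k - s)) (c - d) \<omega>) / 2) \<partial>P)"
    unfolding S product ..
  also have "\<dots> = (\<integral>\<omega>. W \<omega> * cos (S ((\<lambda>_. 0)(k := s)) d \<omega>) \<partial>P) +
    ((\<integral>\<omega>. W \<omega> * cos (S (t(k := t k + s)) (c + d) \<omega>) \<partial>P) / 2 +
    (\<integral>\<omega>. W \<omega> * cos (S (t(k := t k - s)) (c - d) \<omega>) \<partial>P) / 2)"
    using int by (subst Bochner_Integration.integral_add | intro Bochner_Integration.integrable_add integrable_divide | simp)+
  finally show ?thesis by simp
qed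

text \<open>The one-dimensional uniqueness theorem is applied one coordinate at a time, to the positive
  measures with densities \<open>1 + cos\<close>.\<close>

lemma boxed_cos_moments_eq:
  fixes X :: "'i \<Rightarrow> 'v \<Rightarrow> real" and Y :: "'i \<Rightarrow> 'w \<Rightarrow> real" and A :: "'i \<Rightarrow> real set"
  assumes P: "prob_space P" and Q: "prob_space Q" and J: "finite J" and K: "K \<subseteq> J"
    and X: "\<And>j. j \<in> J \<Longrightarrow> X j \<in> borel_measurable P"
    and Y: "\<And>j. j \<in> J \<Longrightarrow> Y j \<in> borel_measurable Q"
    and A: "\<And>j. j \<in> J \<Longrightarrow> A j \<in> sets borel"
    and law: "\<And>t. distr P borel (\<lambda>\<omega>. \<Sum>j\<in>J. t j * X j \<omega>) = distr Q borel (\<lambda>\<omega>. \<Sum>j\<in>J. t j * Y j \<omega>)"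
  shows "(\<integral>\<omega>. (\<Prod>j\<in>K. indicator (A j) (X j \<omega>)) * cos ((\<Sum>j\<in>J. t j * X j \<omega>) + c) \<partial>P) =
    (\<integral>\<omega>. (\<Prod>j\<in>K. indicator (A j) (Y j \<omega>)) * cos ((\<Sum>j\<in>J. t j * Y j \<omega>) + c) \<partial>Q)"
proof -
  have [measurable]: "X j \<in> borel_measurable P" "Y j \<in> borel_measurable Q" "A j \<in> sets borel"
    if "j \<in> J" for j using X Y A that by auto
  have "finite K" using J K by (rule rev_finite_subset)
  then show ?thesis using K
  proof (induction K arbitrary: t c)
    case empty
    have "(\<integral>\<omega>. cos ((\<Sum>j\<in>J. t j * X j \<omega>) + c) \<partial>P) = (\<integral>x. cos (x + c) \<partial>distr P borel (\<lambda>\<omega>. \<Sum>j\<in>J. t j * X j \<omega>))"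
      by (subst integral_distr) auto
    also have "\<dots> = (\<integral>\<omega>. cos ((\<Sum>j\<in>J. t j * Y j \<omega>) + c) \<partial>Q)"
      unfolding law by (subst integral_distr) auto
    finally show ?case by simp
  next
    case (insert k K)
    then have k: "k \<in> J" and KJ: "K \<subseteq> J" by auto
    define WX where "WX = (\<lambda>\<omega>. \<Prod>j\<in>K. indicator (A j) (X j \<omega>) :: real)"
    define WY where "WY = (\<lambda>\<omega>. \<Prod>j\<in>K. indicator (A j) (Y j \<omega>) :: real)"
    define hX where "hX = (\<lambda>t c \<omega>. WX \<omega> * (1 + cos ((\<Sum>j\<in>J. t j * X j \<omega>) + c)))"
    define hY where "hY = (\<lambda>t c \<omega>. WY \<omega> * (1 + cos ((\<Sum>j\<in>J. t j * Y j \<omega>) + c)))"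
    have [measurable]: "WX \<in> borel_measurable P" "WY \<in> borel_measurable Q"
      unfolding WX_def WY_def using subsetD[OF KJ] by measurable
    have [measurable]: "hX t c \<in> borel_measurable P" "hY t c \<in> borel_measurable Q" for t c
      unfolding hX_def hY_def by measurable
    have W: "0 \<le> WX \<omega>" "WX \<omega> \<le> 1" "0 \<le> WY \<omega>'" "WY \<omega>' \<le> 1" for \<omega> \<omega>'
      unfolding WX_def WY_def by (rule prod_indicator_bounds)+
    have cb: "0 \<le> 1 + cos x" "1 + cos x \<le> 2" for x :: real
      using cos_ge_minus_one[of x] cos_le_one[of x] by linarith+
    have h: "0 \<le> hX t c \<omega>" "hX t c \<omega> \<le> 2" "0 \<le> hY t c \<omega>'" "hY t c \<omega>' \<le> 2" for t c \<omega> \<omega>'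
      unfolding hX_def hY_def using W cb mult_mono[OF W(2) cb(2)] mult_mono[OF W(4) cb(2)] by auto
    \<comment> \<open>The images under coordinate \<open>k\<close> of the two weighted measures have
      equal cosine moments by the induction hypothesis, hence coincide. Evaluating both on
      \<open>A k\<close> inserts the new indicator.\<close>
    have boxed: "(\<integral>\<omega>. hX t c \<omega> * indicator (A k) (X k \<omega>) \<partial>P) = (\<integral>\<omega>. hY t c \<omega> * indicator (A k) (Y k \<omega>) \<partial>Q)"
      for t c
    proof -
      let ?M1 = "distr (density P (\<lambda>\<omega>. ennreal (hX t c \<omega>))) borel (X k)"
      let ?M2 = "distr (density Q (\<lambda>\<omega>. ennreal (hY t c \<omega>))) borel (Y k)"
      have "?M1 = ?M2"
      proof (rule finite_real_measure_eqI_cos)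
        show "finite_measure ?M1" "finite_measure ?M2"
          using P Q k h by (auto intro!: finite_measure_density_distr)
        fix s d
        have "(\<integral>x. cos (s * x + d) \<partial>?M1) = (\<integral>\<omega>. hX t c \<omega> * cos (s * X k \<omega> + d) \<partial>P)"
          using k h by (intro integral_density_distr_bounded) auto
        also have "\<dots> = (\<integral>\<omega>. hY t c \<omega> * cos (s * Y k \<omega> + d) \<partial>Q)"
          unfolding hX_def hY_def WX_def WY_def
          by (rule trans[OF weighted_cos_moment[OF P J k KJ X A]], assumption, assumption)
            (rule trans[OF _ weighted_cos_moment[OF Q J k KJ Y A, symmetric]],
              simp only: insert.IH[OF KJ], assumption, assumption)
        also have "\<dots> = (\<integral>x. cos (s * x + d) \<partial>?M2)"
          using k h by (intro integral_density_distr_bounded[symmetric]) auto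
        finally show "(\<integral>x. cos (s * x + d) \<partial>?M1) = (\<integral>x. cos (s * x + d) \<partial>?M2)" .
      qed simp_all
      moreover have "(\<integral>\<omega>. hX t c \<omega> * indicator (A k) (X k \<omega>) \<partial>P) = (\<integral>x. indicator (A k) x \<partial>?M1)"
        using k h by (intro integral_density_distr_bounded[symmetric]) auto
      moreover have "(\<integral>\<omega>. hY t c \<omega> * indicator (A k) (Y k \<omega>) \<partial>Q) = (\<integral>x. indicator (A k) x \<partial>?M2)"
        using k h by (intro integral_density_distr_bounded[symmetric]) auto
      ultimately show ?thesis by simp
    qed
    \<comment> \<open>The summand 1 in the density is removed by subtracting the case of zero
      frequencies and phase \<open>pi / 2\<close>, in which the cosine vanishes.\<close>
    have split: "(\<Prod>j\<in>insert k K. indicator (A j) (Z j)) * cos ((\<Sum>j\<in>J. t j * Z j) + c) =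
      (\<Prod>j\<in>K. indicator (A j) (Z j)) * (1 + cos ((\<Sum>j\<in>J. t j * Z j) + c)) * indicator (A k) (Z k) -
      (\<Prod>j\<in>K. indicator (A j) (Z j)) * (1 + cos ((\<Sum>j\<in>J. 0 * Z j) + pi / 2)) * indicator (A k) (Z k)"
      for Z :: "'i \<Rightarrow> real"
      using insert.hyps by (simp add: algebra_simps)
    have intX: "integrable P (\<lambda>\<omega>. hX t c \<omega> * indicator (A k) (X k \<omega>))" for t c
      using P h k by (intro finite_measure.integrable_const_bound[where B = 2] prob_space.finite_measure)
        (auto simp: indicator_def)
    have intY: "integrable Q (\<lambda>\<omega>. hY t c \<omega> * indicator (A k) (Y k \<omega>))" for t c
      using Q h k by (intro finite_measure.integrable_const_bound[where B = 2] prob_space.finite_measure)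
        (auto simp: indicator_def)
    show ?case
      unfolding split
      using boxed[of t c] boxed[of "\<lambda>_. 0" "pi / 2"] intX[of t c] intX[of "\<lambda>_. 0" "pi / 2"]
        intY[of t c] intY[of "\<lambda>_. 0" "pi / 2"]
      by (simp only: hX_def hY_def WX_def WY_def Bochner_Integration.integral_diff)
  qed
qed

text \<open>A form of the Cramer-Wold device. Boxes in finitely many coordinates determine a finite
  measure on the product, and their probabilities are integrals of products of indicators.\<close>

lemma equal_in_lawI_linear_combinations:
  assumes X: "random_field P I X" and Y: "random_field Q I Y"
    and law: "\<And>J t. finite J \<Longrightarrow> J \<subseteq> I \<Longrightarrow>
      distr P borel (\<lambda>\<omega>. \<Sum>j\<in>J. t j * X j \<omega>) = distr Q borel (\<lambda>\<omega>. \<Sum>j\<in>J. t j * Y j \<omega>)"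
  shows "equal_in_law I P X Q Y"
  unfolding equal_in_law_def
proof (intro conjI X Y)
  interpret P: prob_space P using X by (simp add: random_field_def)
  interpret Q: prob_space Q using Y by (simp add: random_field_def)
  have [measurable]: "X i \<in> borel_measurable P" "Y i \<in> borel_measurable Q" if "i \<in> I" for i
    using X Y that by (auto simp: random_field_def)
  have mX: "(\<lambda>\<omega>. \<lambda>i\<in>I. X i \<omega>) \<in> measurable P (\<Pi>\<^sub>M i\<in>I. borel)"
    and mY: "(\<lambda>\<omega>. \<lambda>i\<in>I. Y i \<omega>) \<in> measurable Q (\<Pi>\<^sub>M i\<in>I. borel)"
    by measurable
  have box: "emeasure (distr R (\<Pi>\<^sub>M i\<in>I. borel) (\<lambda>\<omega>. \<lambda>i\<in>I. Z i \<omega>)) (prod_emb I (\<lambda>_. borel) J (Pi\<^sub>E J A)) =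
      ennreal (\<integral>\<omega>. (\<Prod>j\<in>J. indicator (A j) (Z j \<omega>)) \<partial>R)"
    if R: "prob_space R" and Z: "\<And>i. i \<in> I \<Longrightarrow> Z i \<in> borel_measurable R"
      and mZ: "(\<lambda>\<omega>. \<lambda>i\<in>I. Z i \<omega>) \<in> measurable R (\<Pi>\<^sub>M i\<in>I. borel)"
      and J: "finite J" "J \<subseteq> I" and A: "\<And>i. i \<in> J \<Longrightarrow> A i \<in> sets borel"
    for R :: "'z measure" and Z :: "_ \<Rightarrow> 'z \<Rightarrow> real" and J A
  proof -
    interpret R: prob_space R by fact
    let ?B = "{\<omega> \<in> space R. \<forall>j\<in>J. Z j \<omega> \<in> A j}"
    have "(\<lambda>\<omega>. \<lambda>i\<in>I. Z i \<omega>) -` prod_emb I (\<lambda>_. borel) J (Pi\<^sub>E J A) \<inter> space R = ?B"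
      using J by (auto simp: prod_emb_def PiE_iff subset_iff)
    then have "emeasure (distr R (\<Pi>\<^sub>M i\<in>I. borel) (\<lambda>\<omega>. \<lambda>i\<in>I. Z i \<omega>)) (prod_emb I (\<lambda>_. borel) J (Pi\<^sub>E J A)) =
        emeasure R ?B"
      using mZ J A by (subst emeasure_distr) (auto intro!: sets_PiM_I)
    moreover have "(\<integral>\<omega>. (\<Prod>j\<in>J. indicator (A j) (Z j \<omega>)) \<partial>R) = (\<integral>\<omega>. indicator ?B \<omega> \<partial>R :: real)"
      using J(1) by (intro Bochner_Integration.integral_cong) (auto simp: indicator_def prod_eq_1_iff prod_zero_iff)
    moreover have "?B \<inter> space R = ?B" by blast
    ultimately show ?thesis by (simp add: R.emeasure_eq_measure)
  qed
  show "distr P (\<Pi>\<^sub>M i\<in>I. borel) (\<lambda>\<omega>. \<lambda>i\<in>I. X i \<omega>) = distr Q (\<Pi>\<^sub>M i\<in>I. borel) (\<lambda>\<omega>. \<lambda>i\<in>I. Y i \<omega>)"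
  proof (rule measure_eqI_PiM_infinite)
    show "finite_measure (distr P (\<Pi>\<^sub>M i\<in>I. borel) (\<lambda>\<omega>. \<lambda>i\<in>I. X i \<omega>))"
      by (rule P.finite_measure_distr[OF mX])
    fix A :: "_ \<Rightarrow> real set" and J assume J: "finite J" "J \<subseteq> I" and A: "\<And>i. i \<in> J \<Longrightarrow> A i \<in> sets borel"
    \<comment> \<open>With zero frequencies and phase the cosine is 1, so only the box
      remains.\<close>
    have "(\<integral>\<omega>. (\<Prod>j\<in>J. indicator (A j) (X j \<omega>)) \<partial>P :: real) = (\<integral>\<omega>. (\<Prod>j\<in>J. indicator (A j) (Y j \<omega>)) \<partial>Q)"
      using boxed_cos_moments_eq[OF P.prob_space_axioms Q.prob_space_axioms J(1) order_refl _ _ A law[OF J], where t = "\<lambda>_. 0" and c = 0] J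
      by (simp add: subset_iff)
    then show "emeasure (distr P (\<Pi>\<^sub>M i\<in>I. borel) (\<lambda>\<omega>. \<lambda>i\<in>I. X i \<omega>)) (prod_emb I (\<lambda>_. borel) J (Pi\<^sub>E J A)) =
        emeasure (distr Q (\<Pi>\<^sub>M i\<in>I. borel) (\<lambda>\<omega>. \<lambda>i\<in>I. Y i \<omega>)) (prod_emb I (\<lambda>_. borel) J (Pi\<^sub>E J A))"
      using box[OF P.prob_space_axioms _ mX J A] box[OF Q.prob_space_axioms _ mY J A] by simp
  qed simp_all
qed

section \<open>Gaussian vectors and positive combinations\<close>

text \<open>A Cholesky factorization, obtained by eliminating one index at a time. A zero pivot
  forces its whole row to vanish; a positive pivot allows completing the square.\<close>

lemma positive_semidefinite_factorization:
  fixes a :: "'i \<Rightarrow> 'i \<Rightarrow> real"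
  assumes "finite I" and "\<And>i j. a i j = a j i"
    and "\<And>x. 0 \<le> (\<Sum>i\<in>I. \<Sum>j\<in>I. a i j * x i * x j)"
  shows "\<exists>c. \<forall>i\<in>I. \<forall>j\<in>I. a i j = (\<Sum>k\<in>I. c k i * c k j)"
  using assms
proof (induction I arbitrary: a rule: finite_induct)
  case empty then show ?case by simp
next
  case (insert p I)
  note sym = insert.prems(1)
  have quad: "(\<Sum>i\<in>insert p I. \<Sum>j\<in>insert p I. a i j * x i * x j) =
    a p p * (x p)\<^sup>2 + 2 * x p * (\<Sum>i\<in>I. a p i * x i) + (\<Sum>i\<in>I. \<Sum>j\<in>I. a i j * x i * x j)" for x
  proof -
    have "(\<Sum>i\<in>I. a i p * x i * x p) = x p * (\<Sum>i\<in>I. a p i * x i)"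
      by (simp add: sum_distrib_left sym[of _ p] algebra_simps)
    moreover have "(\<Sum>j\<in>I. a p j * x p * x j) = x p * (\<Sum>i\<in>I. a p i * x i)"
      by (simp add: sum_distrib_left algebra_simps)
    ultimately show ?thesis
      using insert.hyps by (simp add: sum.distrib power2_eq_square algebra_simps)
  qed
  have app: "0 \<le> a p p"
  proof -
    have "(\<Sum>i\<in>I. a p i * (if i = p then 1 else 0)) = 0"
      "(\<Sum>i\<in>I. \<Sum>j\<in>I. a i j * (if i = p then 1 else 0) * (if j = p then 1 else 0)) = 0"
      using insert.hyps by (auto intro!: sum.neutral)
    then show ?thesis
      using insert.prems(2)[of "\<lambda>i. if i = p then 1 else 0"] unfolding quad by simp
  qed
  show ?case
  proof (cases "a p p = 0")
    case True
    have zero: "a p j = 0" if j: "j \<in> I" for j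
    proof (rule ccontr)
      assume nz: "a p j \<noteq> 0"
      \<comment> \<open>With coordinate \<open>l\<close> at \<open>p\<close> and 1 at
        \<open>j\<close> the form takes the value -1.\<close>
      define l where "l = - (a j j + 1) / (2 * a p j)"
      define x where "x = (\<lambda>i. if i = p then l else if i = j then 1 else 0)"
      have xj: "(\<Sum>k\<in>I. f k * x k) = f j" for f
      proof -
        have "(\<Sum>k\<in>I. f k * x k) = (\<Sum>k\<in>I. if k = j then f k else 0)"
          using insert.hyps by (intro sum.cong) (auto simp: x_def)
        then show ?thesis using j insert.hyps by simp
      qed
      have "(\<Sum>i\<in>I. \<Sum>k\<in>I. a i k * x i * x k) = (\<Sum>i\<in>I. (a i j * x i))"
        by (intro sum.cong refl xj)
      then have "0 \<le> 2 * l * a p j + a j j"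
        using insert.prems(2)[of x] True xj[of "a p"] xj[of "\<lambda>i. a i j"]
        unfolding quad by (simp add: x_def)
      moreover have "2 * l * a p j = - (a j j + 1)" using nz by (simp add: l_def)
      ultimately show False by linarith
    qed
    have "0 \<le> (\<Sum>i\<in>I. \<Sum>j\<in>I. a i j * x i * x j)" for x
    proof -
      have "(\<Sum>i\<in>I. a p i * x i) = 0" using zero by (intro sum.neutral) auto
      then show ?thesis using insert.prems(2)[of x] True unfolding quad by simp
    qed
    then have "\<exists>c. \<forall>i\<in>I. \<forall>j\<in>I. a i j = (\<Sum>k\<in>I. c k i * c k j)"
      by (rule insert.IH[OF sym])
    then obtain c where c: "\<forall>i\<in>I. \<forall>j\<in>I. a i j = (\<Sum>k\<in>I. c k i * c k j)" ..
    let ?c = "\<lambda>k i. if k = p \<or> i = p then 0 else c k i"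
    have "a i j = (\<Sum>k\<in>insert p I. ?c k i * ?c k j)" if "i \<in> insert p I" "j \<in> insert p I" for i j
    proof (cases "i = p \<or> j = p")
      case T: True
      then have "a i j = 0" using zero[of i] zero[of j] that \<open>a p p = 0\<close> sym[of i p] by auto
      then show ?thesis using T by (auto intro!: sum.neutral[symmetric])
    next
      case False
      then have "(\<Sum>k\<in>I. ?c k i * ?c k j) = (\<Sum>k\<in>I. c k i * c k j)"
        using insert.hyps by (intro sum.cong) auto
      then show ?thesis using c False that insert.hyps by simp
    qed
    then show ?thesis by (intro exI[of _ ?c]) blast
  next
    case False
    then have pos: "0 < a p p" using app by simp
    \<comment> \<open>The Schur complement of the pivot.\<close>
    define b where "b = (\<lambda>i j. a i j - a p i * a p j / a p p)"
    have bsym: "b i j = b j i" for i j by (simp add: b_def sym[of i j] mult.commute)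
    have "0 \<le> (\<Sum>i\<in>I. \<Sum>j\<in>I. b i j * x i * x j)" for x
    proof -
      let ?s = "\<Sum>i\<in>I. a p i * x i"
      \<comment> \<open>The coordinate at \<open>p\<close> that minimises the quadratic form; the
        minimum is the form of the Schur complement.\<close>
      let ?x = "x(p := - ?s / a p p)"
      have "(\<Sum>i\<in>I. a p i * ?x i) = ?s"
        "(\<Sum>i\<in>I. \<Sum>j\<in>I. a i j * ?x i * ?x j) = (\<Sum>i\<in>I. \<Sum>j\<in>I. a i j * x i * x j)"
        using insert.hyps by (auto intro!: sum.cong)
      then have "0 \<le> (\<Sum>i\<in>I. \<Sum>j\<in>I. a i j * x i * x j) - ?s * ?s / a p p"
        using insert.prems(2)[of ?x] pos unfolding quad by (simp add: power2_eq_square field_simps)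
      also have "?s * ?s / a p p = (\<Sum>i\<in>I. \<Sum>j\<in>I. a p i * a p j / a p p * x i * x j)"
        unfolding sum_product sum_divide_distrib by (simp add: algebra_simps)
      finally show ?thesis by (simp add: b_def algebra_simps sum_subtractf)
    qed
    then have "\<exists>c. \<forall>i\<in>I. \<forall>j\<in>I. b i j = (\<Sum>k\<in>I. c k i * c k j)"
      by (rule insert.IH[OF bsym])
    then obtain c where c: "\<forall>i\<in>I. \<forall>j\<in>I. b i j = (\<Sum>k\<in>I. c k i * c k j)" ..
    let ?c = "\<lambda>k i. if k = p then a p i / sqrt (a p p) else if i = p then 0 else c k i"
    have "a i j = (\<Sum>k\<in>insert p I. ?c k i * ?c k j)" if "i \<in> insert p I" "j \<in> insert p I" for i j
    proof -
      have p: "?c p i * ?c p j = a p i * a p j / a p p"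
        using pos by simp
      have "(\<Sum>k\<in>I. ?c k i * ?c k j) = b i j"
      proof (cases "i = p \<or> j = p")
        case True
        then have "b i j = 0" using pos sym[of i p] by (auto simp: b_def)
        moreover have "(\<Sum>k\<in>I. ?c k i * ?c k j) = 0"
          using True insert.hyps by (intro sum.neutral) auto
        ultimately show ?thesis by simp
      next
        case False
        then have "(\<Sum>k\<in>I. ?c k i * ?c k j) = (\<Sum>k\<in>I. c k i * c k j)"
          using insert.hyps by (intro sum.cong) auto
        then show ?thesis using c False that by simp
      qed
      then show ?thesis using p insert.hyps by (simp add: b_def)
    qed
    then show ?thesis by (intro exI[of _ ?c]) blast
  qed
qed

lemma distr_standard_normal_combination:
  fixes a :: "'i \<Rightarrow> real"
  assumes I: "finite I"
  defines "N \<equiv> PiM I (\<lambda>_. density lborel std_normal_density)"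
  shows "distr N borel (\<lambda>z. \<Sum>i\<in>I. a i * z i) = normal_law 0 (\<Sum>i\<in>I. (a i)\<^sup>2)"
proof -
  let ?n = "density lborel (\<lambda>x. ennreal (std_normal_density x))"
  have n: "prob_space ?n" by (rule prob_space_normal_density) simp
  have setsN: "sets N = sets (PiM I (\<lambda>_. borel))" unfolding N_def by (intro sets_PiM_cong) auto
  interpret prob_space N unfolding N_def by (intro prob_space_PiM n)
  have [measurable]: "(\<lambda>z. z i) \<in> borel_measurable N" if "i \<in> I" for i
    using that unfolding measurable_cong_sets[OF setsN refl] by measurable
  have marginal: "distr N borel (\<lambda>z. z i) = ?n" if "i \<in> I" for i
  proof -
    have "distr N borel (\<lambda>z. z i) = distr N ?n (\<lambda>z. z i)" by (rule distr_cong) auto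
    also have "\<dots> = ?n" unfolding N_def by (rule distr_PiM_component) (use n that in auto)
    finally show ?thesis .
  qed
  \<comment> \<open>Zero coefficients are dropped because a summand of variance 0 has no density,
    while the theorem on sums of independent normals asks for positive deviations. If nothing
    remains, the law is the point mass at 0.\<close>
  define K where "K = {i\<in>I. a i \<noteq> 0}"
  have K: "finite K" "K \<subseteq> I" using I by (auto simp: K_def)
  have sums: "(\<Sum>i\<in>I. a i * z i) = (\<Sum>i\<in>K. a i * z i)" "(\<Sum>i\<in>I. (a i)\<^sup>2) = (\<Sum>i\<in>K. (a i)\<^sup>2)" for z
    using I by (auto simp: K_def intro!: sum.mono_neutral_right)
  show ?thesis
  proof (cases "K = {}")
    case True
    then show ?thesis unfolding sums by (simp add: normal_law_def distr_const)
  next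
    case False
    then have pos: "0 < (\<Sum>i\<in>K. (a i)\<^sup>2)" using K by (intro sum_pos) (auto simp: K_def)
    have "distr N (PiM K (\<lambda>_. borel)) (\<lambda>z. \<lambda>i\<in>K. z i) = distr N (PiM K (\<lambda>_. ?n)) (\<lambda>z. \<lambda>i\<in>K. z i)"
      by (rule distr_cong) (auto intro!: sets_PiM_cong)
    also have "\<dots> = PiM K (\<lambda>_. ?n)"
      unfolding N_def using distr_PiM_reindex[of I "\<lambda>_. ?n" "\<lambda>i. i" K] n K by auto
    also have "\<dots> = PiM K (\<lambda>i. distr N borel (\<lambda>z. z i))"
      using marginal K by (intro PiM_cong) auto
    finally have "indep_vars (\<lambda>_. borel) (\<lambda>i z. z i) K"
      using False K by (subst indep_vars_iff_distr_eq_PiM') auto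
    then have indep: "indep_vars (\<lambda>_. borel) (\<lambda>i z. a i * z i) K"
      by (rule indep_vars_compose2[where Y = "\<lambda>i x. a i * x"]) simp
    have "distributed N lborel (\<lambda>z. z i) (normal_density 0 1)" if "i \<in> I" for i
    proof -
      have "distr N lborel (\<lambda>z. z i) = distr N borel (\<lambda>z. z i)" by (rule distr_cong) auto
      then show ?thesis using that marginal by (simp add: distributed_def)
    qed
    then have normal: "distributed N lborel (\<lambda>z. a i * z i) (normal_density 0 \<bar>a i\<bar>)" if "i \<in> K" for i
      using normal_density_affine[of "\<lambda>z. z i" 0 1 "a i" 0] that by (auto simp: K_def)
    have "distributed N lborel (\<lambda>z. \<Sum>i\<in>K. a i * z i) (normal_density (\<Sum>i\<in>K. 0) (sqrt (\<Sum>i\<in>K. \<bar>a i\<bar>\<^sup>2)))"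
      by (rule sum_indep_normal[OF K(1) False indep _ normal]) (simp_all add: K_def)
    then have "distr N lborel (\<lambda>z. \<Sum>i\<in>K. a i * z i) = normal_law 0 (\<Sum>i\<in>K. (a i)\<^sup>2)"
      using pos by (simp add: distributed_def normal_law_def)
    moreover have "distr N lborel (\<lambda>z. \<Sum>i\<in>K. a i * z i) = distr N borel (\<lambda>z. \<Sum>i\<in>K. a i * z i)"
      by (rule distr_cong) auto
    ultimately show ?thesis unfolding sums by simp
  qed
qed

text \<open>The factorization writes \<open>\<Sigma> u u\<close> as a sum of squares of inner
  products with vectors \<open>w k\<close>. Combining the \<open>w k\<close> with independent
  standard normal coefficients gives a vector with the required variances. Its law lives on the
  vector space itself, where the identity serves as \<open>N\<close>.\<close>

lemma centered_normal_vector_exists: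
  fixes \<Sigma> :: "'e::euclidean_space \<Rightarrow> 'e \<Rightarrow> real"
  assumes bilinear: "bilinear \<Sigma>" and sym: "\<And>u v. \<Sigma> u v = \<Sigma> v u" and psd: "\<And>u. 0 \<le> \<Sigma> u u"
  obtains P :: "'e measure" and N where "centered_normal_vector \<Sigma> P N"
proof -
  have expand: "\<Sigma> (\<Sum>i\<in>Basis. x i *\<^sub>R i) (\<Sum>i\<in>Basis. x i *\<^sub>R i) = (\<Sum>i\<in>Basis. \<Sum>j\<in>Basis. \<Sigma> i j * x i * x j)" for x
  proof -
    have lin: "linear (\<Sigma> u)" "linear (\<lambda>u. \<Sigma> u v)" for u v
      using bilinear unfolding bilinear_def by auto
    have *: "\<Sigma> u (\<Sum>j\<in>Basis. x j *\<^sub>R j) = (\<Sum>j\<in>Basis. x j * \<Sigma> u j)"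
      "\<Sigma> (\<Sum>i\<in>Basis. x i *\<^sub>R i) v = (\<Sum>i\<in>Basis. x i * \<Sigma> i v)" for u v
      by (simp_all add: linear_sum[OF lin(1)] linear_scale[OF lin(1)]
          linear_sum[OF lin(2)] linear_scale[OF lin(2)])
    show ?thesis unfolding *(2) unfolding *(1) by (simp only: sum_distrib_left mult_ac)
  qed
  have "0 \<le> (\<Sum>i\<in>Basis. \<Sum>j\<in>Basis. \<Sigma> i j * x i * x j)" for x
    using psd unfolding expand[symmetric] .
  then have "\<exists>c. \<forall>i\<in>Basis. \<forall>j\<in>Basis. \<Sigma> i j = (\<Sum>k\<in>(Basis :: 'e set). c k i * c k j)"
    by (rule positive_semidefinite_factorization[OF finite_Basis sym])
  then obtain c where c: "\<forall>i\<in>Basis. \<forall>j\<in>Basis. \<Sigma> i j = (\<Sum>k\<in>(Basis :: 'e set). c k i * c k j)" ..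
  define w where "w = (\<lambda>k. \<Sum>i\<in>Basis. c k i *\<^sub>R i :: 'e)"
  have var: "\<Sigma> u u = (\<Sum>k\<in>Basis. (u \<bullet> w k)\<^sup>2)" for u
  proof -
    have "\<Sigma> u u = (\<Sum>i\<in>Basis. \<Sum>j\<in>Basis. \<Sum>k\<in>Basis. (c k i * (u \<bullet> i)) * (c k j * (u \<bullet> j)))"
      using expand[of "\<lambda>i. u \<bullet> i"] unfolding euclidean_representation
      by (simp add: c sum_distrib_left sum_distrib_right mult_ac cong: sum.cong)
    also have "\<dots> = (\<Sum>k\<in>Basis. \<Sum>i\<in>Basis. \<Sum>j\<in>Basis. (c k i * (u \<bullet> i)) * (c k j * (u \<bullet> j)))"
      by (rule trans[OF sum.cong[OF refl sum.swap] sum.swap])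
    also have "\<dots> = (\<Sum>k\<in>Basis. (u \<bullet> w k)\<^sup>2)"
      by (simp add: w_def inner_sum_right power2_eq_square sum_product)
    finally show ?thesis .
  qed
  let ?n = "density lborel (\<lambda>x. ennreal (std_normal_density x))"
  define P0 where "P0 = PiM (Basis :: 'e set) (\<lambda>_. ?n)"
  have n: "prob_space ?n" by (rule prob_space_normal_density) simp
  interpret P0: prob_space P0 unfolding P0_def by (intro prob_space_PiM n)
  have sets0: "sets P0 = sets (PiM Basis (\<lambda>_. borel))" unfolding P0_def by (intro sets_PiM_cong) auto
  have [measurable]: "(\<lambda>z. z k) \<in> borel_measurable P0" if "k \<in> Basis" for k
    using that unfolding measurable_cong_sets[OF sets0 refl] by measurable
  define P where "P = distr P0 borel (\<lambda>z. \<Sum>k\<in>Basis. z k *\<^sub>R w k)"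
  have "distr P borel (\<lambda>x. u \<bullet> x) = normal_law 0 (\<Sigma> u u)" for u
  proof -
    have "distr P borel (\<lambda>x. u \<bullet> x) = distr P0 borel (\<lambda>z. \<Sum>k\<in>Basis. (u \<bullet> w k) * z k)"
      unfolding P_def by (subst distr_distr) (auto simp: o_def inner_sum_right mult.commute)
    also have "\<dots> = normal_law 0 (\<Sum>k\<in>Basis. (u \<bullet> w k)\<^sup>2)"
      unfolding P0_def by (rule distr_standard_normal_combination) simp
    finally show ?thesis by (simp add: var)
  qed
  moreover have "prob_space P" unfolding P_def by (rule P0.prob_space_distr) measurable
  ultimately have "centered_normal_vector \<Sigma> P (\<lambda>x. x)"
    by (simp add: centered_normal_vector_def) (simp add: P_def)
  then show thesis by (rule that)
qed

text \<open>A Gaussian field is only known to have some variance for each linear combination; this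
  identifies that variance with a second moment, which the covariance determines.\<close>

lemma normal_law_second_moment:
  assumes v: "0 \<le> v" and X: "X \<in> borel_measurable P" and law: "distr P borel X = normal_law 0 v"
  shows "integrable P (\<lambda>\<omega>. (X \<omega>)\<^sup>2)" "(\<integral>\<omega>. (X \<omega>)\<^sup>2 \<partial>P) = v"
proof -
  have "integrable (normal_law 0 v) (\<lambda>x. x\<^sup>2) \<and> (\<integral>x. x\<^sup>2 \<partial>normal_law 0 v) = v"
  proof (cases "v = 0")
    case True
    then show ?thesis
      by (simp add: normal_law_def integral_return integrable_iff_bounded nn_integral_return)
  next
    case False
    then have s: "0 < sqrt v" using v by simp
    show ?thesis
      using False v integrable_normal_moment[OF s, of 0 2] integral_normal_moment_even[OF s, of 0 1]
      by (simp add: normal_law_def integrable_density integral_density)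
  qed
  then show "integrable P (\<lambda>\<omega>. (X \<omega>)\<^sup>2)" "(\<integral>\<omega>. (X \<omega>)\<^sup>2 \<partial>P) = v"
    unfolding law[symmetric] using X by (simp_all add: integrable_distr_eq integral_distr)
qed

text \<open>Let \<open>C\<close> be the convex cone of nonnegative combinations. If 0 were outside
  its relative interior, a supporting hyperplane at 0 would give a functional nonnegative on
  \<open>C\<close> and positive on the relative interior; balance makes it vanish on
  \<open>S\<close>, hence on \<open>C\<close>. So \<open>C\<close> contains a small ball of its span
  around 0, and rescaling reaches every vector of the span.\<close>

lemma positive_combinations_exhaust_span:
  fixes S :: "'e::euclidean_space set"
  assumes balanced: "\<And>u. (\<And>x. x \<in> S \<Longrightarrow> 0 \<le> u \<bullet> x) \<Longrightarrow> (\<And>x. x \<in> S \<Longrightarrow> u \<bullet> x = 0)"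
    and v: "v \<in> span S"
  shows "\<exists>Y c. finite Y \<and> Y \<subseteq> S \<and> (\<forall>y. 0 \<le> c y) \<and> v = (\<Sum>y\<in>Y. c y *\<^sub>R y)"
proof -
  define C where "C = {(\<Sum>y\<in>Y. c y *\<^sub>R y) |Y c. finite Y \<and> Y \<subseteq> S \<and> (\<forall>y. (0::real) \<le> c y)}"
  have C0: "0 \<in> C" unfolding C_def by (auto intro!: exI[of _ "{}"] exI[of _ "\<lambda>_. 0"])
  have scale: "t *\<^sub>R x \<in> C" if x: "x \<in> C" and t: "0 \<le> t" for t x
  proof -
    obtain Y c where "x = (\<Sum>y\<in>Y. c y *\<^sub>R y)" "finite Y" "Y \<subseteq> S" "\<forall>y. 0 \<le> c y"
      using x unfolding C_def by blast
    then show ?thesis unfolding C_def using t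
      by (auto simp: scaleR_sum_right intro!: exI[of _ Y] exI[of _ "\<lambda>y. t * c y"])
  qed
  have add: "x + x' \<in> C" if x: "x \<in> C" "x' \<in> C" for x x'
  proof -
    obtain Y c where Y: "x = (\<Sum>y\<in>Y. c y *\<^sub>R y)" "finite Y" "Y \<subseteq> S" "\<forall>y. 0 \<le> c y"
      using x unfolding C_def by blast
    obtain Y' c' where Y': "x' = (\<Sum>y\<in>Y'. c' y *\<^sub>R y)" "finite Y'" "Y' \<subseteq> S" "\<forall>y. 0 \<le> c' y"
      using x unfolding C_def by blast
    let ?c = "\<lambda>y. (if y \<in> Y then c y else 0) + (if y \<in> Y' then c' y else 0)"
    have "(\<Sum>y\<in>Y. c y *\<^sub>R y) = (\<Sum>y\<in>Y \<union> Y'. (if y \<in> Y then c y else 0) *\<^sub>R y)"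
      "(\<Sum>y\<in>Y'. c' y *\<^sub>R y) = (\<Sum>y\<in>Y \<union> Y'. (if y \<in> Y' then c' y else 0) *\<^sub>R y)"
      using Y Y' by (auto intro!: sum.mono_neutral_cong_left)
    then have "x + x' = (\<Sum>y\<in>Y \<union> Y'. ?c y *\<^sub>R y)"
      unfolding Y(1) Y'(1) by (simp add: sum.distrib scaleR_add_left)
    then show ?thesis unfolding C_def mem_Collect_eq
      using Y(2-4) Y'(2-4) by (intro exI[of _ "Y \<union> Y'"] exI[of _ ?c] conjI) auto
  qed
  have SC: "S \<subseteq> C"
  proof
    fix x assume "x \<in> S"
    then show "x \<in> C" unfolding C_def by (auto intro!: exI[of _ "{x}"] exI[of _ "\<lambda>_. 1"])
  qed
  have convex: "convex C"
    unfolding convex_def by (intro ballI allI impI add scale)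
  have "0 \<in> rel_interior C"
  proof (rule ccontr)
    assume "0 \<notin> rel_interior C"
    then obtain a where a: "\<forall>y\<in>C. a \<bullet> 0 \<le> a \<bullet> y" "\<forall>y\<in>rel_interior C. a \<bullet> 0 < a \<bullet> y"
      by (rule supporting_hyperplane_rel_boundary[OF convex C0]) auto
    have "a \<bullet> x = 0" if "x \<in> S" for x
      by (rule balanced[OF _ that]) (use a(1) SC in auto)
    then have "a \<bullet> y = 0" if y: "y \<in> C" for y
    proof -
      obtain Y c where "y = (\<Sum>y\<in>Y. c y *\<^sub>R y)" "Y \<subseteq> S"
        using y unfolding C_def by blast
      then show ?thesis using \<open>\<And>x. x \<in> S \<Longrightarrow> a \<bullet> x = 0\<close>
        by (simp add: inner_sum_right subset_iff)
    qed
    moreover obtain y where "y \<in> rel_interior C"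
      using rel_interior_eq_empty[OF convex] C0 by blast
    ultimately show False using a(2) rel_interior_subset by fastforce
  qed
  then obtain e where e: "0 < e" "ball 0 e \<inter> affine hull C \<subseteq> C"
    unfolding mem_rel_interior_ball by blast
  have "affine hull C = span C" using C0 by (simp add: affine_hull_span_0 hull_inc)
  then have vC: "t *\<^sub>R v \<in> affine hull C" for t
    using v span_mono[OF SC] by (auto intro: span_scale)
  \<comment> \<open>Brings \<open>v\<close> into the ball of radius \<open>e\<close>; adding 1 to
    the norm allows \<open>v = 0\<close>.\<close>
  define t where "t = e / (2 * (norm v + 1))"
  have t: "0 < t" using e by (simp add: t_def add_nonneg_pos)
  have "norm (t *\<^sub>R v) < e"
  proof -
    have "norm (t *\<^sub>R v) = e * (norm v / (2 * (norm v + 1)))" using e by (simp add: t_def)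
    also have "\<dots> < e * 1" using e by (intro mult_strict_left_mono) (auto simp: divide_simps add_nonneg_pos)
    finally show ?thesis by simp
  qed
  then have "t *\<^sub>R v \<in> C" using e vC by auto
  then have "v \<in> C" using scale[of "t *\<^sub>R v" "1 / t"] t by simp
  then show ?thesis unfolding C_def by blast
qed

section \<open>Pushforwards, kernels and sampled measures\<close>

text \<open>If some preimage is not measurable, then the set function behind \<open>distr\<close> is not additive, and
  \<open>distr\<close> is the null measure.\<close>

lemma measurable_if_distr_nonzero:
  assumes "prob_space M" and f: "f \<in> space M \<rightarrow> space N" and nz: "emeasure (distr M N f) A \<noteq> 0"
  shows "f \<in> measurable M N"
proof (rule measurableI)
  interpret prob_space M by fact
  let ?m = "\<lambda>B. emeasure M (f -` B \<inter> space M)"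
  have D: "emeasure (distr M N f) = (\<lambda>B. if B \<in> sets N \<and> measure_space (space N) (sets N) ?m then ?m B else 0)"
    unfolding distr_def emeasure_measure_of_conv sets.sigma_sets_eq ..
  then have ms: "measure_space (space N) (sets N) ?m" using nz by (auto split: if_splits)
  then have D: "emeasure (distr M N f) B = ?m B" if "B \<in> sets N" for B
    using that D by simp
  fix B assume B: "B \<in> sets N"
  \<comment> \<open>The preimages of a set and of its complement have total mass 1, so one of them
    has nonzero mass. Since \<open>emeasure\<close> is 0 off the sigma-algebra, that one is
    measurable, and with it the other.\<close>
  have "?m B + ?m (space N - B) = ?m (space N)"
    using plus_emeasure[of B "distr M N f" "space N - B"] B sets.sets_into_space[OF B] D
    by (simp add: sets.compl_sets Un_absorb1)
  also have "?m (space N) = 1"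
    using f emeasure_space_1 by (simp add: Int_absorb1 subset_vimage_iff Pi_iff image_subset_iff subsetI vimage_def)
  finally have "?m B \<noteq> 0 \<or> ?m (space N - B) \<noteq> 0" by auto
  then show "f -` B \<inter> space M \<in> sets M"
  proof
    assume "?m (space N - B) \<noteq> 0"
    then have "f -` (space N - B) \<inter> space M \<in> sets M" using emeasure_notin_sets by blast
    moreover have "f -` B \<inter> space M = space M - (f -` (space N - B) \<inter> space M)"
      using f by auto
    ultimately show ?thesis by (metis sets.compl_sets)
  qed (use emeasure_notin_sets in blast)
qed (use f in auto)

text \<open>Measurability of the masses of fixed sets is all that a Gaussian mass provides, and its
  total mass need not be at most 1. The usual extension from indicators to nonnegative functions
  works without any bound on the mass.\<close>

lemma borel_measurable_nn_integral_kernel: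
  assumes sets: "\<And>\<omega>. \<omega> \<in> space P \<Longrightarrow> sets (K \<omega>) = sets M"
    and K: "\<And>B. B \<in> sets M \<Longrightarrow> (\<lambda>\<omega>. emeasure (K \<omega>) B) \<in> borel_measurable P"
    and f: "f \<in> borel_measurable M"
  shows "(\<lambda>\<omega>. \<integral>\<^sup>+x. f x \<partial>K \<omega>) \<in> borel_measurable P"
proof -
  have meas: "g \<in> borel_measurable (K \<omega>)" if "g \<in> borel_measurable M" "\<omega> \<in> space P" for g :: "_ \<Rightarrow> ennreal" and \<omega>
    using that sets by (simp cong: measurable_cong_sets)
  show ?thesis using f
  proof induction
    case (cong f g)
    then have "(\<lambda>\<omega>. \<integral>\<^sup>+x. f x \<partial>K \<omega>) \<in> borel_measurable P \<longleftrightarrow> (\<lambda>\<omega>. \<integral>\<^sup>+x. g x \<partial>K \<omega>) \<in> borel_measurable P"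
      by (intro measurable_cong nn_integral_cong) (auto dest!: sets sets_eq_imp_space_eq)
    then show ?case using cong by simp
  next
    case (set B)
    then have "(\<lambda>\<omega>. \<integral>\<^sup>+x. indicator B x \<partial>K \<omega>) \<in> borel_measurable P \<longleftrightarrow> (\<lambda>\<omega>. emeasure (K \<omega>) B) \<in> borel_measurable P"
      by (intro measurable_cong nn_integral_indicator) (simp add: sets)
    then show ?case using K[OF set] by simp
  next
    case (mult f c)
    then have "(\<lambda>\<omega>. \<integral>\<^sup>+x. c * f x \<partial>K \<omega>) \<in> borel_measurable P \<longleftrightarrow> (\<lambda>\<omega>. c * \<integral>\<^sup>+x. f x \<partial>K \<omega>) \<in> borel_measurable P"
      by (intro measurable_cong nn_integral_cmult meas)
    then show ?case using mult by simp
  next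
    case (add f g)
    then have "(\<lambda>\<omega>. \<integral>\<^sup>+x. f x + g x \<partial>K \<omega>) \<in> borel_measurable P \<longleftrightarrow>
        (\<lambda>\<omega>. (\<integral>\<^sup>+x. f x \<partial>K \<omega>) + (\<integral>\<^sup>+x. g x \<partial>K \<omega>)) \<in> borel_measurable P"
      by (intro measurable_cong nn_integral_add meas)
    then show ?case using add by (simp add: ac_simps)
  next
    case (seq F)
    then have "(\<lambda>\<omega>. \<integral>\<^sup>+x. (SUP i. F i) x \<partial>K \<omega>) \<in> borel_measurable P \<longleftrightarrow>
        (\<lambda>\<omega>. SUP i. (\<integral>\<^sup>+x. F i x \<partial>K \<omega>)) \<in> borel_measurable P"
      unfolding SUP_apply by (intro measurable_cong nn_integral_monotone_convergence_SUP meas)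
    then show ?case using seq by (simp add: ac_simps)
  qed
qed

section \<open>Second moments and Frechet means in Euclidean space\<close>

lemma integrable_mult_of_square_integrable:
  fixes f g :: "'v \<Rightarrow> real"
  assumes "f \<in> borel_measurable M" "g \<in> borel_measurable M"
    and "integrable M (\<lambda>x. (f x)\<^sup>2)" "integrable M (\<lambda>x. (g x)\<^sup>2)"
  shows "integrable M (\<lambda>x. f x * g x)"
proof (rule Bochner_Integration.integrable_bound)
  show "integrable M (\<lambda>x. (f x)\<^sup>2 + (g x)\<^sup>2)" using assms by simp
  show "AE x in M. norm (f x * g x) \<le> norm ((f x)\<^sup>2 + (g x)\<^sup>2)"
  proof (rule AE_I2)
    fix x
    have "0 \<le> (\<bar>f x\<bar> - \<bar>g x\<bar>)\<^sup>2" by simp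
    then have "2 * (\<bar>f x\<bar> * \<bar>g x\<bar>) \<le> (f x)\<^sup>2 + (g x)\<^sup>2" by (simp add: power2_diff)
    moreover have "0 \<le> \<bar>f x\<bar> * \<bar>g x\<bar>" by (intro mult_nonneg_nonneg) auto
    ultimately have "\<bar>f x\<bar> * \<bar>g x\<bar> \<le> (f x)\<^sup>2 + (g x)\<^sup>2" by linarith
    then show "norm (f x * g x) \<le> norm ((f x)\<^sup>2 + (g x)\<^sup>2)" by (simp add: abs_mult)
  qed
qed (use assms in simp)

text \<open>Expanding the square, the Frechet function at \<open>q\<close> is half of the squared
  norm of \<open>q - m\<close> up to a constant, with \<open>m\<close> the expectation, so its
  unique minimizer is \<open>m\<close>. This turns the first condition on a collapse into centering
  and square integrability.\<close>

lemma frechet_mean_euclidean: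
  fixes \<nu> :: "'e::euclidean_space measure"
  assumes \<nu>: "prob_space \<nu>" "sets \<nu> = sets borel" and b: "has_frechet_mean \<nu> 0"
  shows "integrable \<nu> (\<lambda>x. (norm x)\<^sup>2)" "integrable \<nu> (\<lambda>x. x)" "(\<integral>x. x \<partial>\<nu>) = 0"
proof -
  interpret prob_space \<nu> by fact
  note [measurable_cong] = \<nu>(2)
  have "integrable \<nu> (\<lambda>x. (dist 0 x)\<^sup>2)" using b unfolding has_frechet_mean_def by blast
  then show sq: "integrable \<nu> (\<lambda>x. (norm x)\<^sup>2)" by simp
  have "norm x \<le> 1 + (norm x)\<^sup>2" for x :: 'e
  proof -
    have "0 \<le> (norm x - 1)\<^sup>2" by simp
    then have "2 * norm x \<le> 1 + (norm x)\<^sup>2" unfolding power2_diff by simp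
    then show ?thesis using norm_ge_zero[of x] by linarith
  qed
  then have bound: "norm x \<le> norm (1 + (norm x)\<^sup>2)" for x :: 'e
    unfolding real_norm_def by (rule order_trans[OF _ abs_ge_self])
  show int: "integrable \<nu> (\<lambda>x. x)"
  proof (rule Bochner_Integration.integrable_bound)
    show "integrable \<nu> (\<lambda>x. 1 + (norm x)\<^sup>2)" using sq by simp
  qed (measurable, rule AE_I2, rule bound)
  define m where "m = (\<integral>x. x \<partial>\<nu>)"
  have F: "frechet_function \<nu> q = ((norm q)\<^sup>2 - 2 * (q \<bullet> m) + (\<integral>x. (norm x)\<^sup>2 \<partial>\<nu>)) / 2" for q
  proof -
    have "(dist q x)\<^sup>2 = (norm q)\<^sup>2 - 2 * (q \<bullet> x) + (norm x)\<^sup>2" for x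
      by (simp add: dist_norm power2_norm_eq_inner inner_diff_left inner_diff_right inner_commute)
    moreover have "(\<integral>x. (norm q)\<^sup>2 - 2 * (q \<bullet> x) + (norm x)\<^sup>2 \<partial>\<nu>) =
        (norm q)\<^sup>2 - 2 * (q \<bullet> m) + (\<integral>x. (norm x)\<^sup>2 \<partial>\<nu>)"
      using sq int by (simp add: m_def prob_space)
    ultimately show ?thesis by (simp add: frechet_function_def)
  qed
  show "(\<integral>x. x \<partial>\<nu>) = 0"
  proof (rule ccontr)
    assume "\<not> ?thesis"
    then have "frechet_function \<nu> 0 < frechet_function \<nu> m"
      using b by (simp add: has_frechet_mean_def m_def)
    then have "m \<bullet> m < 0" unfolding F by (simp add: power2_norm_eq_inner)
    then show False using inner_ge_zero[of m] by linarith
  qed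
qed

section \<open>Measurable nonnegative coefficients and degenerate normal vectors\<close>

lemma orthonormal_expansion_subspace:
  fixes W :: "'e::euclidean_space set"
  assumes "subspace W"
  shows "\<exists>B. finite B \<and> B \<subseteq> W \<and> (\<forall>w\<in>W. (\<Sum>b\<in>B. (w \<bullet> b) *\<^sub>R b) = w)"
proof -
  obtain B where B: "B \<subseteq> W" "pairwise orthogonal B" "\<And>x. x \<in> B \<Longrightarrow> norm x = 1"
    "independent B" "card B = dim W" "span B = W"
    by (rule orthonormal_basis_subspace[OF assms]) (rule that; simp)
  have "finite B" using B(4) by (rule independent_imp_finite)
  moreover from this have "(\<Sum>b\<in>B. (w \<bullet> b) *\<^sub>R b) = w" if "w \<in> W" for w
    using that B by (intro orthonormal_basis_expand) auto
  ultimately show ?thesis using B(1) by blast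
qed

text \<open>Choosing a combination separately for each \<open>n\<close> would say nothing about
  measurability in \<open>n\<close>. Choices are made only for the finitely many vectors
  \<open>b\<close> and \<open>- b\<close>; this also confines all combinations to one finite set
  \<open>Y\<close>.\<close>

lemma positive_coefficient_functions:
  fixes S :: "'e::euclidean_space set"
  assumes balanced: "\<And>u. (\<And>x. x \<in> S \<Longrightarrow> 0 \<le> u \<bullet> x) \<Longrightarrow> (\<And>x. x \<in> S \<Longrightarrow> u \<bullet> x = 0)"
  shows "\<exists>Y (c :: 'e \<Rightarrow> 'e \<Rightarrow> real). finite Y \<and> Y \<subseteq> S \<and> (\<forall>n y. 0 \<le> c n y) \<and>
    (\<forall>y. (\<lambda>n. c n y) \<in> borel_measurable borel) \<and> (\<forall>n\<in>span S. (\<Sum>y\<in>Y. c n y *\<^sub>R y) = n)"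
proof -
  obtain B where fB: "finite B" and B: "B \<subseteq> span S"
    and expand: "\<And>w. w \<in> span S \<Longrightarrow> (\<Sum>b\<in>B. (w \<bullet> b) *\<^sub>R b) = w"
    using orthonormal_expansion_subspace[OF subspace_span[of S]] by auto
  have "\<forall>v\<in>span S. \<exists>Y c. finite Y \<and> Y \<subseteq> S \<and> (\<forall>y. 0 \<le> c y) \<and> v = (\<Sum>y\<in>Y. c y *\<^sub>R y)"
    by (intro ballI positive_combinations_exhaust_span balanced)
  then obtain Yv cv where v: "\<And>v. v \<in> span S \<Longrightarrow> finite (Yv v) \<and> Yv v \<subseteq> S \<and> (\<forall>y. 0 \<le> cv v y) \<and>
      v = (\<Sum>y\<in>Yv v. cv v y *\<^sub>R y)"
    by metis
  have pm: "b \<in> span S" "- b \<in> span S" if "b \<in> B" for b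
    using that B by (auto intro: span_neg)
  define Y where "Y = (\<Union>b\<in>B. Yv b \<union> Yv (- b))"
  define d where "d = (\<lambda>v y. if y \<in> Yv v then cv v y else 0)"
  define c where "c = (\<lambda>n y. \<Sum>b\<in>B. max 0 (n \<bullet> b) * d b y + max 0 (- (n \<bullet> b)) * d (- b) y)"
  have Y: "finite Y" "Y \<subseteq> S" unfolding Y_def using fB v pm by blast+
  have d: "(\<Sum>y\<in>Y. d v y *\<^sub>R y) = v" if "v \<in> span S" "Yv v \<subseteq> Y" for v
  proof -
    have "(\<Sum>y\<in>Y. d v y *\<^sub>R y) = (\<Sum>y\<in>Yv v. cv v y *\<^sub>R y)"
      using Y that by (intro sum.mono_neutral_cong_right) (auto simp: d_def)
    then show ?thesis using v that by metis
  qed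
  have "(\<Sum>y\<in>Y. c n y *\<^sub>R y) = n" if n: "n \<in> span S" for n
  proof -
    have "(\<Sum>y\<in>Y. c n y *\<^sub>R y) = (\<Sum>b\<in>B. max 0 (n \<bullet> b) *\<^sub>R (\<Sum>y\<in>Y. d b y *\<^sub>R y) +
        max 0 (- (n \<bullet> b)) *\<^sub>R (\<Sum>y\<in>Y. d (- b) y *\<^sub>R y))"
      unfolding c_def scaleR_sum_left
      by (subst sum.swap) (simp add: scaleR_sum_right scaleR_add_left sum.distrib)
    also have "\<dots> = (\<Sum>b\<in>B. (n \<bullet> b) *\<^sub>R b)"
    proof (intro sum.cong refl)
      fix b assume b: "b \<in> B"
      then have "Yv b \<subseteq> Y" "Yv (- b) \<subseteq> Y" by (auto simp: Y_def)
      then have "(\<Sum>y\<in>Y. d b y *\<^sub>R y) = b" "(\<Sum>y\<in>Y. d (- b) y *\<^sub>R y) = - b"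
        by (simp_all add: d pm[OF b])
      then show "max 0 (n \<bullet> b) *\<^sub>R (\<Sum>y\<in>Y. d b y *\<^sub>R y) + max 0 (- (n \<bullet> b)) *\<^sub>R (\<Sum>y\<in>Y. d (- b) y *\<^sub>R y) =
          (n \<bullet> b) *\<^sub>R b"
        by (simp add: max_def flip: scaleR_minus_left)
    qed
    also have "\<dots> = n" using n by (rule expand)
    finally show ?thesis .
  qed
  moreover have "0 \<le> c n y" for n y
    unfolding c_def d_def using v pm by (auto intro!: sum_nonneg add_nonneg_nonneg mult_nonneg_nonneg)
  moreover have "(\<lambda>n. c n y) \<in> borel_measurable borel" for y
    unfolding c_def by measurable
  ultimately show ?thesis using Y by (intro exI[of _ Y] exI[of _ c]) simp
qed

text \<open>In directions orthogonal to \<open>W\<close> the variance is 0, so the component of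
  \<open>N\<close> there vanishes almost surely. Finitely many such directions suffice to identify
  \<open>N\<close> with its projection to \<open>W\<close>.\<close>

lemma AE_normal_vector_in_subspace:
  fixes W :: "'e::euclidean_space set"
  assumes N: "centered_normal_vector \<Sigma> P N" and W: "subspace W"
    and degenerate: "\<And>u. (\<And>w. w \<in> W \<Longrightarrow> u \<bullet> w = 0) \<Longrightarrow> \<Sigma> u u = 0"
  shows "AE \<omega> in P. N \<omega> \<in> W"
proof -
  obtain B where fB: "finite B" and B: "B \<subseteq> W"
    and expand: "\<And>w. w \<in> W \<Longrightarrow> (\<Sum>b\<in>B. (w \<bullet> b) *\<^sub>R b) = w"
    using orthonormal_expansion_subspace[OF W] by auto
  have [measurable]: "N \<in> borel_measurable P" using N by (simp add: centered_normal_vector_def)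
  \<comment> \<open>The component of \<open>e\<close> orthogonal to \<open>W\<close>.\<close>
  define u where "u = (\<lambda>e. e - (\<Sum>b\<in>B. (e \<bullet> b) *\<^sub>R b) :: 'e)"
  have "AE \<omega> in P. u e \<bullet> N \<omega> = 0" for e
  proof -
    have "u e \<bullet> w = 0" if "w \<in> W" for w
    proof -
      have "(\<Sum>b\<in>B. (w \<bullet> b) *\<^sub>R b) = w"
        using that by (rule expand)
      then have "e \<bullet> w = (\<Sum>b\<in>B. (w \<bullet> b) * (e \<bullet> b))"
        by (metis (no_types, lifting) inner_scaleR_right inner_sum_right sum.cong)
      then show ?thesis by (simp add: u_def inner_diff_left inner_sum_left inner_commute[of w] mult.commute)
    qed
    then have "\<Sigma> (u e) (u e) = 0" by (rule degenerate)
    then have "distr P borel (\<lambda>\<omega>. u e \<bullet> N \<omega>) = return borel 0"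
      using N by (simp add: centered_normal_vector_def normal_law_def)
    moreover have "AE x in return borel (0::real). x = 0" by (simp add: AE_return)
    ultimately have "AE x in distr P borel (\<lambda>\<omega>. u e \<bullet> N \<omega>). x = 0" by (simp only:)
    then show ?thesis by (rule AE_distrD[rotated]) measurable
  qed
  then have "AE \<omega> in P. \<forall>e\<in>Basis. u e \<bullet> N \<omega> = 0" by (intro AE_finite_allI) auto
  then show ?thesis
  proof (rule AE_mp, intro AE_I2 impI)
    fix \<omega> assume orth: "\<forall>e\<in>Basis. u e \<bullet> N \<omega> = 0"
    have "N \<omega> = (\<Sum>b\<in>B. (N \<omega> \<bullet> b) *\<^sub>R b)"
    proof (rule euclidean_eqI)
      fix e :: 'e assume e: "e \<in> Basis"
      have "u e \<bullet> N \<omega> = e \<bullet> N \<omega> - (\<Sum>b\<in>B. (e \<bullet> b) * (b \<bullet> N \<omega>))"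
        by (simp only: u_def inner_diff_left inner_sum_left inner_scaleR_left)
      moreover have "(\<Sum>b\<in>B. (N \<omega> \<bullet> b) *\<^sub>R b) \<bullet> e = (\<Sum>b\<in>B. (e \<bullet> b) * (b \<bullet> N \<omega>))"
        by (simp add: inner_sum_left inner_commute[of e] inner_commute[of "N \<omega>"] mult.commute)
      ultimately show "N \<omega> \<bullet> e = (\<Sum>b\<in>B. (N \<omega> \<bullet> b) *\<^sub>R b) \<bullet> e"
        using orth e by (simp only: inner_commute[of "N \<omega>" e])
    qed
    also have "\<dots> \<in> W" using B W by (intro subspace_sum subspace_scale) auto
    finally show "N \<omega> \<in> W" .
  qed
qed

text \<open>The representing set in \<open>sampled_from\<close> is not unique, since it may contain
  points of weight 0. The atoms are its points of positive weight, and they carry the whole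
  measure.\<close>

lemma nn_integral_sampled:
  assumes \<Delta>: "sampled_from b A \<Delta>" and A: "A \<subseteq> tangent_cone b" and g: "g \<in> borel_measurable (tangent_borel b)"
  shows "atoms \<Delta> \<subseteq> tangent_cone b" and "(\<integral>\<^sup>+y. g y \<partial>\<Delta>) = (\<Sum>y\<in>atoms \<Delta>. g y * ennreal (measure \<Delta> {y}))"
proof -
  obtain Y c where Y: "finite Y" "Y \<subseteq> A" "\<And>y. y \<in> Y \<Longrightarrow> 0 \<le> c y"
    and em: "\<And>B. B \<in> sets (tangent_borel b) \<Longrightarrow> emeasure \<Delta> B = (\<Sum>y\<in>Y \<inter> B. ennreal (c y))"
    and sets: "sets \<Delta> = sets (tangent_borel b)"
    using \<Delta> unfolding sampled_from_def by blast
  have space: "space \<Delta> = tangent_cone b" using sets_eq_imp_space_eq[OF sets] by simp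
  have YT: "Y \<subseteq> tangent_cone b" using Y(2) A by blast
  have point: "emeasure \<Delta> {y} = (if y \<in> Y then ennreal (c y) else 0)" if "y \<in> tangent_cone b" for y
    using em[OF singleton_in_sets_tangent_borel[OF that]] by auto
  have atoms: "atoms \<Delta> = {y\<in>Y. measure \<Delta> {y} \<noteq> 0}"
    unfolding atoms_def space using point YT by (auto simp: measure_def split: if_splits)
  show "atoms \<Delta> \<subseteq> tangent_cone b" using atoms YT by auto
  have Y_sets: "Y \<in> sets \<Delta>"
    using sets.finite_UN[OF Y(1), of "\<lambda>y. {y}" "tangent_borel b"] singleton_in_sets_tangent_borel YT sets by auto
  have "emeasure \<Delta> (space \<Delta> - Y) = 0"
    using em[of "space \<Delta> - Y"] sets.compl_sets[OF Y_sets] sets by simp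
  then have "AE y in \<Delta>. y \<in> Y"
    by (intro AE_I[of _ _ "space \<Delta> - Y"]) (use Y_sets in auto)
  then have "(\<integral>\<^sup>+y. g y \<partial>\<Delta>) = (\<integral>\<^sup>+y. g y * indicator Y y \<partial>\<Delta>)"
    by (intro nn_integral_cong_AE) auto
  also have "\<dots> = (\<Sum>y\<in>Y. g y * emeasure \<Delta> {y})"
    using Y(1) singleton_in_sets_tangent_borel[OF subsetD[OF YT]]
    by (intro nn_integral_indicator_finite) (simp_all only: sets)
  also have "\<dots> = (\<Sum>y\<in>Y. g y * ennreal (measure \<Delta> {y}))"
    using point YT Y(3) by (intro sum.cong refl) (auto simp: measure_def)
  also have "\<dots> = (\<Sum>y\<in>atoms \<Delta>. g y * ennreal (measure \<Delta> {y}))"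
    using Y(1) unfolding atoms by (intro sum.mono_neutral_right) auto
  finally show "(\<integral>\<^sup>+y. g y \<partial>\<Delta>) = (\<Sum>y\<in>atoms \<Delta>. g y * ennreal (measure \<Delta> {y}))" .
qed

text \<open>The range of the sum varies with the measure, so measurability in a random measure is
  invisible on the left. On the right it follows from that of integrals; both integrals are finite,
  hence \<open>enn2real\<close> is faithful.\<close>

lemma sum_atoms_eq_nn_integral:
  fixes f :: "'a::metric_space tangent \<Rightarrow> real"
  assumes \<Delta>: "sampled_from b A \<Delta>" and A: "A \<subseteq> tangent_cone b"
    and f[measurable]: "f \<in> borel_measurable (tangent_borel b)"
  shows "(\<Sum>y\<in>atoms \<Delta>. measure \<Delta> {y} * f y) =
    enn2real (\<integral>\<^sup>+y. ennreal (f y) \<partial>\<Delta>) - enn2real (\<integral>\<^sup>+y. ennreal (- f y) \<partial>\<Delta>)"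
proof -
  have "enn2real (\<integral>\<^sup>+y. ennreal (g y) \<partial>\<Delta>) = (\<Sum>y\<in>atoms \<Delta>. measure \<Delta> {y} * max 0 (g y))"
    if "g \<in> borel_measurable (tangent_borel b)" for g :: "'a tangent \<Rightarrow> real"
  proof -
    have "(\<integral>\<^sup>+y. ennreal (g y) \<partial>\<Delta>) = (\<Sum>y\<in>atoms \<Delta>. ennreal (g y) * ennreal (measure \<Delta> {y}))"
      using that by (intro nn_integral_sampled(2)[OF \<Delta> A]) simp
    also have "\<dots> = (\<Sum>y\<in>atoms \<Delta>. ennreal (measure \<Delta> {y} * max 0 (g y)))"
      by (intro sum.cong refl) (simp add: ennreal_mult ennreal_max_0 mult.commute)
    also have "\<dots> = ennreal (\<Sum>y\<in>atoms \<Delta>. measure \<Delta> {y} * max 0 (g y))"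
      by (intro sum_ennreal) simp
    finally show ?thesis by (simp add: sum_nonneg)
  qed
  note this[of f] this[of "\<lambda>y. - f y"]
  moreover have "measure \<Delta> {y} * f y = measure \<Delta> {y} * max 0 (f y) - measure \<Delta> {y} * max 0 (- f y)" for y
    by (simp add: max_def)
  ultimately show ?thesis by (simp add: sum_subtractf)
qed

section \<open>Gaussian masses on the collapse\<close>

locale collapsed_localized_measure =
  fixes \<mu> :: "'a::metric_space measure" and b :: 'a and L :: "'a tangent \<Rightarrow> 'e::euclidean_space"
  assumes locally_compact: "locally_compact_space (euclidean :: 'a topology)"
    and log_embeds: "\<exists>e. log_embeds_ball b e"
    and localized: "localized \<mu> b"
    and collapse: "tangential_collapse \<mu> b L"
begin

abbreviation "\<nu> \<equiv> collapsed_measure \<mu> b L"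

lemma prob_space_mu: "prob_space \<mu>"
  using localized unfolding localized_def by (rule conjunct1)

lemma
  shows collapse_continuous: "continuous_map (tangent_topology b) euclidean L"
    and collapse_cone_point: "L cone_point = 0"
    and collapse_inner: "\<And>U V. U \<in> fluctuating_cone \<mu> b \<Longrightarrow> V \<in> tangent_cone b \<Longrightarrow> tinner U V = L U \<bullet> L V"
  using collapse unfolding tangential_collapse_def by blast+

lemma collapse_frechet_mean: "has_frechet_mean \<nu> 0"
  using collapse unfolding tangential_collapse_def by metis

lemma collapse_measurable [measurable]: "L \<in> borel_measurable (tangent_borel b)"
  using collapse_continuous by (rule borel_measurable_tangent_borel)

lemma sets_tangent_measure [simp, measurable_cong]: "sets (tangent_measure \<mu> b) = sets (tangent_borel b)"
  by (simp add: tangent_measure_def)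

lemma space_tangent_measure [simp]: "space (tangent_measure \<mu> b) = tangent_cone b"
  by (simp add: tangent_measure_def)

lemma sets_collapsed_measure [simp, measurable_cong]: "sets \<nu> = sets borel"
  by (simp add: collapsed_measure_def)

text \<open>The null measure has no Frechet mean, so the pushforward under the logarithm is not the junk
  value of \<open>distr\<close> at a non-measurable map.\<close>

lemma log_map_measurable [measurable]: "log_map b \<in> measurable \<mu> (tangent_borel b)"
proof (rule ccontr)
  assume not: "log_map b \<notin> measurable \<mu> (tangent_borel b)"
  have "emeasure (tangent_measure \<mu> b) A = 0" for A
  proof (rule ccontr)
    assume "emeasure (tangent_measure \<mu> b) A \<noteq> 0"
    then have "log_map b \<in> measurable \<mu> (tangent_borel b)"
      unfolding tangent_measure_def using log_map_in_tangent_cone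
      by (intro measurable_if_distr_nonzero prob_space_mu) auto
    then show False using not by contradiction
  qed
  then have "emeasure \<nu> (space \<nu>) = 0"
    by (simp add: collapsed_measure_def emeasure_distr)
  \<comment> \<open>Under the null measure everything holds almost everywhere. The Frechet function
    is then constantly 0, contradicting its strict minimum at 0 when compared with a basis
    vector.\<close>
  then have "AE x in \<nu>. P x" for P
    by (intro AE_I[of _ _ "space \<nu>"] sets.top) blast
  then have "frechet_function \<nu> q = 0" for q
    by (simp add: frechet_function_def integral_eq_zero_AE)
  moreover obtain e :: 'e where "e \<in> Basis" using nonempty_Basis by blast
  then have "e \<noteq> 0" by auto
  ultimately show False using collapse_frechet_mean unfolding has_frechet_mean_def by (metis less_irrefl)
qed

lemma prob_space_tangent_measure: "prob_space (tangent_measure \<mu> b)"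
  unfolding tangent_measure_def by (rule prob_space.prob_space_distr[OF prob_space_mu]) measurable

lemma prob_space_collapsed_measure: "prob_space \<nu>"
  unfolding collapsed_measure_def
  by (rule prob_space.prob_space_distr[OF prob_space_tangent_measure]) measurable

lemmas collapsed_moments =
  frechet_mean_euclidean[OF prob_space_collapsed_measure sets_collapsed_measure collapse_frechet_mean]

text \<open>By definition the complement is open and each of its points has a null neighbourhood.
  The Lindelof property reduces these neighbourhoods to countably many.\<close>

lemma AE_tangent_support: "AE V in tangent_measure \<mu> b. V \<in> tangent_support \<mu> b"
proof (rule AE_I)
  let ?W = "tangent_cone b - tangent_support \<mu> b"
  have local: "\<exists>U. openin (tangent_topology b) U \<and> x \<in> U \<and> emeasure (tangent_measure \<mu> b) U = 0"
    if "x \<in> ?W" for x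
    using that unfolding tangent_support_def by (auto simp: not_gr_zero)
  have "openin (tangent_topology b) ?W"
  proof (subst openin_subopen, intro ballI)
    fix x assume "x \<in> ?W"
    then obtain U where U: "openin (tangent_topology b) U" "x \<in> U" "emeasure (tangent_measure \<mu> b) U = 0"
      using local by blast
    then have "U \<subseteq> ?W"
      using openin_subset[OF U(1)] by (auto simp: tangent_support_def)
    then show "\<exists>T. openin (tangent_topology b) T \<and> x \<in> T \<and> T \<subseteq> ?W" using U by blast
  qed
  then show "?W \<in> sets (tangent_measure \<mu> b)" by (simp add: openin_in_sets_tangent_borel)
  have "Lindelof_space (tangent_topology b)"
    using log_embeds Lindelof_space_tangent_topology[OF locally_compact] by blast
  then show "emeasure (tangent_measure \<mu> b) ?W = 0"
    using \<open>openin (tangent_topology b) ?W\<close> _ local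
    by (rule emeasure_locally_null_open[OF metrizable_space_tangent_topology])
      (simp add: openin_in_sets_tangent_borel)
qed auto

text \<open>The function has integral 0 because the collapsed measure is centered, and it is
  nonnegative almost everywhere, so it vanishes almost everywhere. The set where it is positive is
  open and null, and such a set contains no point of the support.\<close>

lemma support_balanced:
  assumes u: "\<And>V. V \<in> tangent_support \<mu> b \<Longrightarrow> 0 \<le> u \<bullet> L V" and V: "V \<in> tangent_support \<mu> b"
  shows "u \<bullet> L V = 0"
proof (rule ccontr)
  interpret \<tau>: prob_space "tangent_measure \<mu> b" by (rule prob_space_tangent_measure)
  assume "u \<bullet> L V \<noteq> 0"
  then have pos: "0 < u \<bullet> L V" using u[OF V] by simp
  have mean: "(\<integral>V. L V \<partial>tangent_measure \<mu> b) = 0" "integrable (tangent_measure \<mu> b) L"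
    using collapsed_moments(2,3) unfolding collapsed_measure_def
    by (simp_all add: integral_distr integrable_distr_eq)
  have "AE V in tangent_measure \<mu> b. 0 \<le> u \<bullet> L V"
    using AE_tangent_support by (rule eventually_mono) (rule u)
  moreover have "(\<integral>V. u \<bullet> L V \<partial>tangent_measure \<mu> b) = 0" "integrable (tangent_measure \<mu> b) (\<lambda>V. u \<bullet> L V)"
    using mean by simp_all
  ultimately have "AE V in tangent_measure \<mu> b. u \<bullet> L V = 0"
    using integral_nonneg_eq_0_iff_AE[of "tangent_measure \<mu> b" "\<lambda>V. u \<bullet> L V"] by simp
  then have "AE V in tangent_measure \<mu> b. V \<notin> {V \<in> tangent_cone b. L V \<in> {x. 0 < u \<bullet> x}}"
    by (auto elim: eventually_mono)
  moreover have op: "openin (tangent_topology b) {V \<in> tangent_cone b. L V \<in> {x. 0 < u \<bullet> x}}"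
    using openin_continuous_map_preimage[OF collapse_continuous, of "{x. 0 < u \<bullet> x}"]
    by (simp add: open_halfspace_gt[of 0 u, simplified])
  ultimately have "emeasure (tangent_measure \<mu> b) {V \<in> tangent_cone b. L V \<in> {x. 0 < u \<bullet> x}} = 0"
    by (subst (asm) AE_iff_measurable[OF _ refl]) (auto intro: openin_in_sets_tangent_borel simp: Int_absorb1 cong: conj_cong)
  moreover have "V \<in> {V \<in> tangent_cone b. L V \<in> {x. 0 < u \<bullet> x}}"
    using V pos by (simp add: tangent_support_def)
  ultimately show False using V op unfolding tangent_support_def by force
qed

section \<open>Covariance of the collapsed measure\<close>

lemma covariance_eq: "covariance_form \<nu> u v = (\<integral>x. (u \<bullet> x) * (v \<bullet> x) \<partial>\<nu>)"
  by (simp add: covariance_form_def collapsed_moments)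

lemma integrable_inner_products: "integrable \<nu> (\<lambda>x. (u \<bullet> x) * (v \<bullet> x))"
proof -
  have "integrable \<nu> (\<lambda>x. (u \<bullet> x)\<^sup>2)" for u
  proof (rule Bochner_Integration.integrable_bound)
    show "integrable \<nu> (\<lambda>x. (norm u)\<^sup>2 * (norm x)\<^sup>2)" using collapsed_moments(1) by simp
    have "(u \<bullet> x)\<^sup>2 \<le> (norm u * norm x)\<^sup>2" for x
      using Cauchy_Schwarz_ineq2[of u x] by (metis abs_ge_zero power2_abs power_mono)
    then show "AE x in \<nu>. norm ((u \<bullet> x)\<^sup>2) \<le> norm ((norm u)\<^sup>2 * (norm x)\<^sup>2)"
      by (intro AE_I2) (simp add: power_mult_distrib)
  qed measurable
  then show ?thesis by (intro integrable_mult_of_square_integrable) measurable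
qed

lemma bilinear_covariance: "bilinear (covariance_form \<nu>)"
  unfolding bilinear_def
proof (intro conjI allI linearI)
  show "covariance_form \<nu> u (v + w) = covariance_form \<nu> u v + covariance_form \<nu> u w"
    "covariance_form \<nu> (v + w) u = covariance_form \<nu> v u + covariance_form \<nu> w u" for u v w
    by (simp_all add: covariance_eq inner_add_left distrib_left distrib_right integrable_inner_products)
  show "covariance_form \<nu> u (r *\<^sub>R v) = r *\<^sub>R covariance_form \<nu> u v"
    "covariance_form \<nu> (r *\<^sub>R v) u = r *\<^sub>R covariance_form \<nu> v u" for u v r
    by (simp_all add: covariance_eq mult.left_commute[of _ r] mult.assoc[of r])
qed

lemma covariance_commute: "covariance_form \<nu> u v = covariance_form \<nu> v u"
  by (simp add: covariance_eq mult.commute)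

lemma covariance_nonneg: "0 \<le> covariance_form \<nu> u u"
  by (simp add: covariance_eq)

lemma covariance_degenerate:
  assumes "\<And>w. w \<in> span (L ` tangent_support \<mu> b) \<Longrightarrow> u \<bullet> w = 0"
  shows "covariance_form \<nu> u u = 0"
proof -
  have "covariance_form \<nu> u u = (\<integral>V. (u \<bullet> L V) * (u \<bullet> L V) \<partial>tangent_measure \<mu> b)"
    unfolding covariance_eq unfolding collapsed_measure_def by (simp add: integral_distr)
  also have "\<dots> = 0"
    by (intro integral_eq_zero_AE, rule eventually_mono[OF AE_tangent_support])
      (simp add: assms span_base)
  finally show ?thesis .
qed

section \<open>Construction of the mass, and inner products on the closed cone\<close>

lemma tangent_support_subset_closed_rays: "tangent_support \<mu> b \<subseteq> closed_rays \<mu> b"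
proof -
  have "tangent_support \<mu> b \<subseteq> {tscale \<alpha> X |\<alpha> X. 0 \<le> \<alpha> \<and> X \<in> tangent_support \<mu> b}"
  proof
    fix V assume V: "V \<in> tangent_support \<mu> b"
    then have "tscale 1 V = V" by (intro tscale_one[of V b]) (simp add: tangent_support_def)
    then show "V \<in> {tscale \<alpha> X |\<alpha> X. 0 \<le> \<alpha> \<and> X \<in> tangent_support \<mu> b}"
      using V by (intro CollectI exI[of _ 1] exI[of _ V]) simp
  qed
  moreover have "{tscale \<alpha> X |\<alpha> X. 0 \<le> \<alpha> \<and> X \<in> tangent_support \<mu> b} \<subseteq> topspace (tangent_topology b)"
  proof (rule subsetI, elim CollectE exE conjE)
    fix V \<alpha> X assume "V = tscale \<alpha> X" "0 \<le> \<alpha>" "X \<in> tangent_support \<mu> b"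
    then show "V \<in> topspace (tangent_topology b)"
      using tscale_in_tangent_cone[of X b \<alpha>] by (simp add: tangent_support_def)
  qed
  ultimately show ?thesis
    unfolding closed_rays_def by (rule order_trans[OF _ closure_of_subset])
qed

lemma closed_rays_subset: "closed_rays \<mu> b \<subseteq> tangent_cone b"
  unfolding closed_rays_def using closure_of_subset_topspace[of "tangent_topology b"] by simp

lemma gaussian_mass_exists:
  fixes P :: "'w measure"
  assumes N: "collapsed_normal \<mu> b L P N"
  shows "\<exists>\<Gamma>. gaussian_mass \<mu> b L P N \<Gamma>"
proof -
  let ?S = "tangent_support \<mu> b"
  have ST: "?S \<subseteq> tangent_cone b" by (auto simp: tangent_support_def)
  have [measurable]: "N \<in> borel_measurable P"
    using N by (simp add: collapsed_normal_def centered_normal_vector_def)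
  have balanced: "u \<bullet> x = 0" if "\<And>x. x \<in> L ` ?S \<Longrightarrow> 0 \<le> u \<bullet> x" "x \<in> L ` ?S" for u x
    using that support_balanced[of u] by auto
  have "\<exists>Y (c :: 'e \<Rightarrow> 'e \<Rightarrow> real). finite Y \<and> Y \<subseteq> L ` ?S \<and> (\<forall>n y. 0 \<le> c n y) \<and>
    (\<forall>y. (\<lambda>n. c n y) \<in> borel_measurable borel) \<and> (\<forall>n\<in>span (L ` ?S). (\<Sum>y\<in>Y. c n y *\<^sub>R y) = n)"
    by (rule positive_coefficient_functions) (rule balanced)
  then obtain Y and c :: "'e \<Rightarrow> 'e \<Rightarrow> real" where Y: "finite Y" "Y \<subseteq> L ` ?S"
    and c: "\<forall>n y. 0 \<le> c n y" "\<forall>y. (\<lambda>n. c n y) \<in> borel_measurable borel"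
      "\<forall>n\<in>span (L ` ?S). (\<Sum>y\<in>Y. c n y *\<^sub>R y) = n"
    by (elim exE conjE)
  have [measurable]: "(\<lambda>n. c n y) \<in> borel_measurable borel" for y using c by blast
  \<comment> \<open>One tangent vector of the support for each point of \<open>Y\<close>;
    injectivity on \<open>Z\<close> makes sums over \<open>Z\<close> and over \<open>Y\<close>
    interchangeable.\<close>
  obtain Z where Z: "Z \<subseteq> ?S" "inj_on L Z" "L ` Z = Y"
    using Y(2) by (auto simp: subset_image_inj)
  have fZ: "finite Z" using Z Y(1) by (metis finite_imageD)
  have ZT: "Z \<subseteq> tangent_cone b" using Z ST by blast
  \<comment> \<open>\<open>point_measure\<close> lives on all subsets of \<open>Z\<close>; the
    pushforward under the identity only transfers it to the Borel sets of the tangent cone.\<close>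
  define \<Gamma> where "\<Gamma> = (\<lambda>\<omega>. distr (point_measure Z (\<lambda>z. ennreal (c (N \<omega>) (L z)))) (tangent_borel b) (\<lambda>z. z))"
  have sets: "sets (\<Gamma> \<omega>) = sets (tangent_borel b)" and space: "space (\<Gamma> \<omega>) = tangent_cone b" for \<omega>
    by (simp_all add: \<Gamma>_def)
  have em: "emeasure (\<Gamma> \<omega>) B = (\<Sum>z\<in>Z \<inter> B. ennreal (c (N \<omega>) (L z)))" if "B \<in> sets (tangent_borel b)" for \<omega> B
    unfolding \<Gamma>_def using that fZ ZT
    by (subst emeasure_distr) (auto simp: space_point_measure emeasure_point_measure_finite Int_commute)
  have "sampled_from b (closed_rays \<mu> b) (\<Gamma> \<omega>)" for \<omega>
    unfolding sampled_from_def using sets em fZ Z c(1) tangent_support_subset_closed_rays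
    by (intro conjI exI[of _ Z] exI[of _ "\<lambda>z. c (N \<omega>) (L z)"]) auto
  moreover have "(\<lambda>\<omega>. emeasure (\<Gamma> \<omega>) B) \<in> borel_measurable P" if "B \<in> sets (tangent_borel b)" for B
    unfolding em[OF that] by measurable
  moreover have "AE \<omega> in P. mass_image L (\<Gamma> \<omega>) = N \<omega>"
  proof -
    have point: "measure (\<Gamma> \<omega>) {z} = (if z \<in> Z then c (N \<omega>) (L z) else 0)" if "z \<in> tangent_cone b" for \<omega> z
      using em[OF singleton_in_sets_tangent_borel[OF that]] c(1) by (simp add: measure_def)
    have "mass_image L (\<Gamma> \<omega>) = (\<Sum>z\<in>Z. c (N \<omega>) (L z) *\<^sub>R L z)" for \<omega>
    proof -
      have "mass_image L (\<Gamma> \<omega>) = (\<Sum>z\<in>atoms (\<Gamma> \<omega>). c (N \<omega>) (L z) *\<^sub>R L z)"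
        unfolding mass_image_def by (intro sum.cong refl) (auto simp: atoms_def space point split: if_splits)
      also have "\<dots> = (\<Sum>z\<in>Z. c (N \<omega>) (L z) *\<^sub>R L z)"
        using fZ ZT by (intro sum.mono_neutral_left) (auto simp: atoms_def space point split: if_splits)
      finally show ?thesis .
    qed
    also have "(\<Sum>z\<in>Z. c (N \<omega>) (L z) *\<^sub>R L z) = (\<Sum>y\<in>Y. c (N \<omega>) y *\<^sub>R y)" for \<omega>
      using sum.reindex[OF Z(2), of "\<lambda>y. c (N \<omega>) y *\<^sub>R y"] Z(3) by simp
    finally have image: "mass_image L (\<Gamma> \<omega>) = (\<Sum>y\<in>Y. c (N \<omega>) y *\<^sub>R y)" for \<omega> .
    \<comment> \<open>The coefficients reproduce only vectors of the span, so the section identity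
      is obtained almost surely.\<close>
    have "AE \<omega> in P. N \<omega> \<in> span (L ` ?S)"
      using N unfolding collapsed_normal_def
      by (rule AE_normal_vector_in_subspace) (auto intro: covariance_degenerate)
    then show ?thesis
      by (rule eventually_mono) (use c(3) image in simp)
  qed
  ultimately show ?thesis using N unfolding gaussian_mass_def by blast
qed

text \<open>The collapse preserves these inner products on the fluctuating cone by assumption. Both
  sides are continuous, so the set where they agree is closed and contains the closure.\<close>

lemma collapse_inner_closed:
  assumes X: "X \<in> closed_fluctuating_cone \<mu> b" and V: "V \<in> tangent_cone b"
  shows "tinner V X = L V \<bullet> L X"
proof -
  have "continuous_map (tangent_topology b) euclideanreal (\<lambda>U. L U \<bullet> L V)"
    using continuous_map_compose[OF collapse_continuous, of euclideanreal "\<lambda>x. x \<bullet> L V"]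
    by (simp add: o_def continuous_intros)
  then have "continuous_map (tangent_topology b) euclideanreal (\<lambda>U. tinner U V - L U \<bullet> L V)"
    using continuous_map_tinner[OF V] by (intro continuous_map_diff)
  then have "closedin (tangent_topology b) {U \<in> topspace (tangent_topology b). tinner U V - L U \<bullet> L V \<in> {0}}"
    by (rule closedin_continuous_map_preimage) simp
  moreover have "fluctuating_cone \<mu> b \<subseteq> {U \<in> topspace (tangent_topology b). tinner U V - L U \<bullet> L V \<in> {0}}"
    using collapse_inner[OF _ V] by (auto simp: fluctuating_cone_def escape_cone_def)
  ultimately have "closed_fluctuating_cone \<mu> b \<subseteq> {U \<in> topspace (tangent_topology b). tinner U V - L U \<bullet> L V \<in> {0}}"
    unfolding closed_fluctuating_cone_def by (rule closure_of_minimal[rotated])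
  then have "tinner X V = L X \<bullet> L V" using X by auto
  then show ?thesis by (simp add: tinner_commute[of V] inner_commute)
qed

lemma closed_fluctuating_cone_subset: "closed_fluctuating_cone \<mu> b \<subseteq> tangent_cone b"
  unfolding closed_fluctuating_cone_def using closure_of_subset_topspace[of "tangent_topology b"] by simp

end

section \<open>Equality in law\<close>

context collapsed_localized_measure
begin

lemma mass_inner_eq_sum:
  assumes \<Delta>: "sampled_from b (closed_rays \<mu> b) \<Delta>" and X: "X \<in> closed_fluctuating_cone \<mu> b"
  shows "mass_inner \<Delta> X = (\<Sum>y\<in>atoms \<Delta>. measure \<Delta> {y} * (L y \<bullet> L X))"
proof -
  have atoms: "atoms \<Delta> \<subseteq> tangent_cone b"
    by (rule nn_integral_sampled(1)[OF \<Delta> closed_rays_subset, of "\<lambda>_. 0"]) simp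
  show ?thesis
    unfolding mass_inner_def
    by (intro sum.cong refl) (simp add: collapse_inner_closed[OF X subsetD[OF atoms]])
qed

lemma mass_inner_eq:
  assumes "sampled_from b (closed_rays \<mu> b) \<Delta>" and "X \<in> closed_fluctuating_cone \<mu> b"
  shows "mass_inner \<Delta> X = mass_image L \<Delta> \<bullet> L X"
  unfolding mass_inner_eq_sum[OF assms] mass_image_def by (simp add: inner_sum_left)

lemma mass_inner_measurable:
  assumes \<Gamma>: "gaussian_mass \<mu> b L P N \<Gamma>" and X: "X \<in> closed_fluctuating_cone \<mu> b"
  shows "(\<lambda>\<omega>. mass_inner (\<Gamma> \<omega>) X) \<in> borel_measurable P"
proof -
  have sampled: "sampled_from b (closed_rays \<mu> b) (\<Gamma> \<omega>)" if "\<omega> \<in> space P" for \<omega>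
    using \<Gamma> that by (simp add: gaussian_mass_def)
  have kernel: "(\<lambda>\<omega>. emeasure (\<Gamma> \<omega>) B) \<in> borel_measurable P" if "B \<in> sets (tangent_borel b)" for B
    using \<Gamma> that by (simp add: gaussian_mass_def)
  have [measurable]: "(\<lambda>\<omega>. \<integral>\<^sup>+y. f y \<partial>\<Gamma> \<omega>) \<in> borel_measurable P"
    if "f \<in> borel_measurable (tangent_borel b)" for f
    using sampled kernel that
    by (intro borel_measurable_nn_integral_kernel[where M = "tangent_borel b"]) (auto simp: sampled_from_def)
  have "mass_inner (\<Gamma> \<omega>) X = enn2real (\<integral>\<^sup>+y. ennreal (L y \<bullet> L X) \<partial>\<Gamma> \<omega>) -
      enn2real (\<integral>\<^sup>+y. ennreal (- (L y \<bullet> L X)) \<partial>\<Gamma> \<omega>)" if "\<omega> \<in> space P" for \<omega>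
    unfolding mass_inner_eq_sum[OF sampled[OF that] X]
    by (rule sum_atoms_eq_nn_integral[OF sampled[OF that] closed_rays_subset]) measurable
  then show ?thesis by (subst measurable_cong) measurable
qed

text \<open>Almost surely a linear combination of these inner products is a single linear functional
  of \<open>N\<close>, and the laws of such functionals are exactly what defines a normal vector
  here.\<close>

lemma mass_inner_combination_law:
  assumes \<Gamma>: "gaussian_mass \<mu> b L P N \<Gamma>" and J: "finite J" "J \<subseteq> closed_fluctuating_cone \<mu> b"
  shows "distr P borel (\<lambda>\<omega>. \<Sum>X\<in>J. t X * mass_inner (\<Gamma> \<omega>) X) =
    normal_law 0 (covariance_form \<nu> (\<Sum>X\<in>J. t X *\<^sub>R L X) (\<Sum>X\<in>J. t X *\<^sub>R L X))"
proof -
  have N: "centered_normal_vector (covariance_form \<nu>) P N"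
    using \<Gamma> by (simp add: gaussian_mass_def collapsed_normal_def)
  then have [measurable]: "N \<in> borel_measurable P" by (simp add: centered_normal_vector_def)
  have [measurable]: "(\<lambda>\<omega>. mass_inner (\<Gamma> \<omega>) X) \<in> borel_measurable P" if "X \<in> J" for X
    using mass_inner_measurable[OF \<Gamma>] J(2) that by blast
  have "AE \<omega> in P. mass_image L (\<Gamma> \<omega>) = N \<omega>" using \<Gamma> by (simp add: gaussian_mass_def)
  then have "AE \<omega> in P. (\<Sum>X\<in>J. t X * mass_inner (\<Gamma> \<omega>) X) = (\<Sum>X\<in>J. t X *\<^sub>R L X) \<bullet> N \<omega>"
  proof (rule AE_mp, intro AE_I2 impI)
    fix \<omega> assume \<omega>: "\<omega> \<in> space P" "mass_image L (\<Gamma> \<omega>) = N \<omega>"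
    have "mass_inner (\<Gamma> \<omega>) X = L X \<bullet> N \<omega>" if "X \<in> J" for X
      using mass_inner_eq[of "\<Gamma> \<omega>" X] \<Gamma> \<omega> J(2) that by (auto simp: gaussian_mass_def inner_commute)
    then show "(\<Sum>X\<in>J. t X * mass_inner (\<Gamma> \<omega>) X) = (\<Sum>X\<in>J. t X *\<^sub>R L X) \<bullet> N \<omega>"
      by (simp add: inner_sum_left)
  qed
  then have "distr P borel (\<lambda>\<omega>. \<Sum>X\<in>J. t X * mass_inner (\<Gamma> \<omega>) X) =
      distr P borel (\<lambda>\<omega>. (\<Sum>X\<in>J. t X *\<^sub>R L X) \<bullet> N \<omega>)"
    by (intro distr_cong_AE) auto
  also have "\<dots> = normal_law 0 (covariance_form \<nu> (\<Sum>X\<in>J. t X *\<^sub>R L X) (\<Sum>X\<in>J. t X *\<^sub>R L X))"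
    using N by (simp add: centered_normal_vector_def)
  finally show ?thesis .
qed

lemma covariance_sum:
  "covariance_form \<nu> (\<Sum>X\<in>J. t X *\<^sub>R L X) (\<Sum>X\<in>J. t X *\<^sub>R L X) =
    (\<Sum>X\<in>J. \<Sum>Y\<in>J. t X * t Y * covariance_form \<nu> (L X) (L Y))"
proof -
  have lin: "linear (covariance_form \<nu> u)" "linear (\<lambda>u. covariance_form \<nu> u v)" for u v
    using bilinear_covariance unfolding bilinear_def by auto
  have *: "covariance_form \<nu> u (\<Sum>Y\<in>J. t Y *\<^sub>R L Y) = (\<Sum>Y\<in>J. t Y * covariance_form \<nu> u (L Y))"
    "covariance_form \<nu> (\<Sum>X\<in>J. t X *\<^sub>R L X) v = (\<Sum>X\<in>J. t X * covariance_form \<nu> (L X) v)" for u v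
    by (simp_all add: linear_sum[OF lin(1)] linear_scale[OF lin(1)]
        linear_sum[OF lin(2)] linear_scale[OF lin(2)])
  show ?thesis unfolding *(2) unfolding *(1) by (simp add: sum_distrib_left mult.assoc)
qed

end

section \<open>The tangent field along rays\<close>

lemma unit_tangent_of:
  assumes "X \<in> tangent_cone p" "X \<noteq> cone_point"
  shows "(1, snd X) \<in> unit_tangents p" "tscale (fst X) (1, snd X) = X"
proof -
  have "fst X \<noteq> 0" using assms fst_eq_0_iff by blast
  then show "(1, snd X) \<in> unit_tangents p" "tscale (fst X) (1, snd X) = X"
    using snd_in_directions[OF assms(1)] by (simp_all add: unit_tangents_def tscale_def)
qed

lemma unit_tangents_subset: "unit_tangents p \<subseteq> tangent_cone p"
  by (auto simp: unit_tangents_def tangent_cone_def)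

locale tangent_gaussian_field =
  fixes \<mu> :: "'a::metric_space measure" and b :: 'a and Q :: "'v measure" and G
  assumes field: "gaussian_tangent_field \<mu> b Q G"
begin

lemma prob_space_field: "prob_space Q"
  using field by (simp add: gaussian_tangent_field_def centered_gaussian_field_def random_field_def)

lemma field_unit_covariance: "V \<in> unit_tangents b \<Longrightarrow> W \<in> unit_tangents b \<Longrightarrow>
    (\<integral>\<omega>. G V \<omega> * G W \<omega> \<partial>Q) = tangent_cov \<mu> b V W"
  using field by (simp add: gaussian_tangent_field_def)

lemma field_tscale: "V \<in> tangent_cone b \<Longrightarrow> 0 \<le> t \<Longrightarrow> \<omega> \<in> space Q \<Longrightarrow> G (tscale t V) \<omega> = t * G V \<omega>"
  using field by (simp add: gaussian_tangent_field_def)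

lemma field_cone_point: "\<omega> \<in> space Q \<Longrightarrow> G cone_point \<omega> = 0"
  using field_tscale[of cone_point 0 \<omega>] by (simp add: tscale_def)

lemma field_eq_unit:
  assumes X: "X \<in> tangent_cone b" "X \<noteq> cone_point" and \<omega>: "\<omega> \<in> space Q"
  shows "G X \<omega> = fst X * G (1, snd X) \<omega>"
proof -
  have "(1, snd X) \<in> tangent_cone b" using unit_tangent_of(1)[OF X] unit_tangents_subset by blast
  from field_tscale[OF this tangent_cone_fst_nonneg[OF X(1)] \<omega>]
  show ?thesis unfolding unit_tangent_of(2)[OF X] .
qed

lemma field_measurable:
  assumes "X \<in> tangent_cone b"
  shows "G X \<in> borel_measurable Q"
proof (cases "X = cone_point")
  case True
  then have "G X \<in> borel_measurable Q \<longleftrightarrow> (\<lambda>_. 0 :: real) \<in> borel_measurable Q"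
    by (intro measurable_cong) (simp add: field_cone_point)
  then show ?thesis by simp
next
  case False
  have "G (1, snd X) \<in> borel_measurable Q"
    using field unit_tangent_of(1)[OF assms False]
    by (simp add: gaussian_tangent_field_def centered_gaussian_field_def random_field_def)
  moreover have "G X \<in> borel_measurable Q \<longleftrightarrow> (\<lambda>\<omega>. fst X * G (1, snd X) \<omega>) \<in> borel_measurable Q"
    using assms False by (intro measurable_cong field_eq_unit)
  ultimately show ?thesis by simp
qed

text \<open>The field is assumed Gaussian on unit vectors only. Homogeneity reduces each term to its
  direction, and terms at the cone point vanish.\<close>

lemma field_combination_law:
  assumes J: "finite J" "J \<subseteq> tangent_cone b"
  shows "\<exists>v\<ge>0. distr Q borel (\<lambda>\<omega>. \<Sum>X\<in>J. t X * G X \<omega>) = normal_law 0 v"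
proof -
  let ?u = "\<lambda>X :: 'a tangent. (1 :: real, snd X)" and ?J = "J - {cone_point}"
  \<comment> \<open>Several vectors of \<open>J\<close> may lie on the same ray, so their
    contributions to its unit vector are added up.\<close>
  define a where "a = (\<lambda>V. \<Sum>X\<in>{X \<in> ?J. ?u X = V}. t X * fst X)"
  have "(\<Sum>X\<in>J. t X * G X \<omega>) = (\<Sum>V\<in>?u ` ?J. a V * G V \<omega>)" if \<omega>: "\<omega> \<in> space Q" for \<omega>
  proof -
    have "(\<Sum>X\<in>J. t X * G X \<omega>) = (\<Sum>X\<in>?J. t X * G X \<omega>)"
      using J(1) field_cone_point[OF \<omega>] by (intro sum.mono_neutral_right) auto
    also have "\<dots> = (\<Sum>X\<in>?J. t X * fst X * G (?u X) \<omega>)"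
      using \<omega> by (intro sum.cong refl) (simp add: subsetD[OF J(2)] field_eq_unit)
    also have "\<dots> = (\<Sum>V\<in>?u ` ?J. \<Sum>X\<in>{X \<in> ?J. ?u X = V}. t X * fst X * G (?u X) \<omega>)"
      using J(1) by (intro sum.image_gen) simp
    also have "\<dots> = (\<Sum>V\<in>?u ` ?J. a V * G V \<omega>)"
      unfolding a_def sum_distrib_right by (intro sum.cong refl) auto
    finally show ?thesis .
  qed
  then have eq: "distr Q borel (\<lambda>\<omega>. \<Sum>X\<in>J. t X * G X \<omega>) = distr Q borel (\<lambda>\<omega>. \<Sum>V\<in>?u ` ?J. a V * G V \<omega>)"
    by (intro distr_cong) auto
  have "?u ` ?J \<subseteq> unit_tangents b" using J(2) unit_tangent_of(1) by blast
  moreover have "finite (?u ` ?J)" using J(1) by simp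
  moreover have "\<forall>J a. finite J \<longrightarrow> J \<subseteq> unit_tangents b \<longrightarrow>
      (\<exists>v\<ge>0. distr Q borel (\<lambda>\<omega>. \<Sum>i\<in>J. a i * G i \<omega>) = normal_law 0 v)"
    using field unfolding gaussian_tangent_field_def centered_gaussian_field_def by blast
  ultimately show ?thesis unfolding eq by simp
qed

lemma field_square_integrable:
  assumes "X \<in> tangent_cone b"
  shows "integrable Q (\<lambda>\<omega>. (G X \<omega>)\<^sup>2)"
proof -
  obtain v where "0 \<le> v" "distr Q borel (G X) = normal_law 0 v"
    using field_combination_law[of "{X}" "\<lambda>_. 1"] assms by auto
  then show ?thesis using field_measurable[OF assms] by (intro normal_law_second_moment(1))
qed

lemma field_product_integrable:
  "X \<in> tangent_cone b \<Longrightarrow> Y \<in> tangent_cone b \<Longrightarrow> integrable Q (\<lambda>\<omega>. G X \<omega> * G Y \<omega>)"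
  by (intro integrable_mult_of_square_integrable field_measurable field_square_integrable)

end

section \<open>Comparison of the two fields\<close>

locale collapsed_gaussian_field = collapsed_localized_measure \<mu> b L + tangent_gaussian_field \<mu> b Q G
  for \<mu> :: "'a::metric_space measure" and b L and Q :: "'v measure" and G
begin

text \<open>After scaling back from unit vectors, all inner products with logarithms become inner
  products of their images under \<open>L\<close>, so the covariance of the field is an integral
  against the collapsed measure.\<close>

lemma field_covariance:
  assumes X: "X \<in> closed_fluctuating_cone \<mu> b" and Y: "Y \<in> closed_fluctuating_cone \<mu> b"
  shows "(\<integral>\<omega>. G X \<omega> * G Y \<omega> \<partial>Q) = covariance_form \<nu> (L X) (L Y)"
proof (cases "X = cone_point \<or> Y = cone_point")
  case True
  then have "(\<integral>\<omega>. G X \<omega> * G Y \<omega> \<partial>Q) = (\<integral>\<omega>. 0 \<partial>Q)"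
    by (intro Bochner_Integration.integral_cong refl) (auto simp: field_cone_point)
  then show ?thesis using True by (auto simp: covariance_eq collapse_cone_point)
next
  case False
  let ?X = "(1, snd X)" and ?Y = "(1, snd Y)"
  have T: "X \<in> tangent_cone b" "Y \<in> tangent_cone b"
    using X Y closed_fluctuating_cone_subset by auto
  have inner: "fst Z * tinner (log_map b y) (1, snd Z) = L (log_map b y) \<bullet> L Z"
    if Z: "Z \<in> closed_fluctuating_cone \<mu> b" "Z \<noteq> cone_point" for y Z
  proof -
    have "Z \<in> tangent_cone b" using Z closed_fluctuating_cone_subset by auto
    then have "fst Z * tinner (log_map b y) (1, snd Z) = tinner (log_map b y) Z"
      using tinner_tscale_right[of "log_map b y" "fst Z" "(1, snd Z)"] unit_tangent_of(2) Z(2) by metis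
    then show ?thesis using collapse_inner_closed[OF Z(1) log_map_in_tangent_cone] by simp
  qed
  have distr: "(\<integral>x. f x \<partial>\<nu>) = (\<integral>y. f (L (log_map b y)) \<partial>\<mu>)"
    if [measurable]: "f \<in> borel_measurable borel" for f :: "_ \<Rightarrow> real"
    unfolding collapsed_measure_def tangent_measure_def by (simp add: integral_distr)
  \<comment> \<open>On the closed fluctuating cone the centering term vanishes, being the inner
    product with the mean of the collapsed measure.\<close>
  have mean: "fst Z * tangent_mean \<mu> b (1, snd Z) = 0"
    if Z: "Z \<in> closed_fluctuating_cone \<mu> b" "Z \<noteq> cone_point" for Z
  proof -
    have "fst Z * tangent_mean \<mu> b (1, snd Z) = (\<integral>y. L (log_map b y) \<bullet> L Z \<partial>\<mu>)"
      unfolding tangent_mean_def inner[OF Z, symmetric] by simp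
    also have "\<dots> = (\<integral>x. x \<bullet> L Z \<partial>\<nu>)" by (subst distr) auto
    also have "\<dots> = (\<integral>x. x \<partial>\<nu>) \<bullet> L Z" using collapsed_moments(2) by simp
    finally show ?thesis using collapsed_moments(3) by simp
  qed
  have "(\<integral>\<omega>. G X \<omega> * G Y \<omega> \<partial>Q) = (\<integral>\<omega>. (fst X * fst Y) * (G ?X \<omega> * G ?Y \<omega>) \<partial>Q)"
    using False T by (intro Bochner_Integration.integral_cong refl) (simp add: field_eq_unit)
  also have "\<dots> = (fst X * fst Y) * (\<integral>\<omega>. G ?X \<omega> * G ?Y \<omega> \<partial>Q)" by simp
  also have "(\<integral>\<omega>. G ?X \<omega> * G ?Y \<omega> \<partial>Q) = tangent_cov \<mu> b ?X ?Y"
    using field_unit_covariance unit_tangent_of(1)[OF T(1)] unit_tangent_of(1)[OF T(2)] False by simp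
  also have "(fst X * fst Y) * tangent_cov \<mu> b ?X ?Y =
      (\<integral>y. (fst X * (tinner (log_map b y) ?X - tangent_mean \<mu> b ?X)) *
        (fst Y * (tinner (log_map b y) ?Y - tangent_mean \<mu> b ?Y)) \<partial>\<mu>)"
    unfolding tangent_cov_def integral_mult_right_zero[symmetric] by (simp only: mult_ac)
  also have "\<dots> = (\<integral>y. (L X \<bullet> L (log_map b y)) * (L Y \<bullet> L (log_map b y)) \<partial>\<mu>)"
    using False X Y by (simp add: right_diff_distrib inner mean inner_commute)
  also have "\<dots> = covariance_form \<nu> (L X) (L Y)"
    unfolding covariance_eq by (subst distr) auto
  finally show ?thesis .
qed

text \<open>The law is normal with an unspecified variance, which is computed as the second moment
  by expanding the square into covariances.\<close>

lemma field_combination_law_collapsed: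
  assumes J: "finite J" "J \<subseteq> closed_fluctuating_cone \<mu> b"
  shows "distr Q borel (\<lambda>\<omega>. \<Sum>X\<in>J. t X * G X \<omega>) =
    normal_law 0 (covariance_form \<nu> (\<Sum>X\<in>J. t X *\<^sub>R L X) (\<Sum>X\<in>J. t X *\<^sub>R L X))"
proof -
  have JT: "J \<subseteq> tangent_cone b" using J(2) closed_fluctuating_cone_subset by auto
  obtain v where v: "0 \<le> v" "distr Q borel (\<lambda>\<omega>. \<Sum>X\<in>J. t X * G X \<omega>) = normal_law 0 v"
    using field_combination_law[OF J(1) JT] by blast
  have "(\<lambda>\<omega>. \<Sum>X\<in>J. t X * G X \<omega>) \<in> borel_measurable Q"
    using field_measurable JT by (intro borel_measurable_sum borel_measurable_times) auto
  then have "v = (\<integral>\<omega>. (\<Sum>X\<in>J. t X * G X \<omega>)\<^sup>2 \<partial>Q)"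
    using normal_law_second_moment(2)[OF v(1) _ v(2)] by simp
  also have "\<dots> = (\<integral>\<omega>. (\<Sum>X\<in>J. \<Sum>Y\<in>J. t X * t Y * (G X \<omega> * G Y \<omega>)) \<partial>Q)"
    by (simp add: power2_eq_square sum_product mult_ac)
  also have "\<dots> = (\<Sum>X\<in>J. \<Sum>Y\<in>J. t X * t Y * (\<integral>\<omega>. G X \<omega> * G Y \<omega> \<partial>Q))"
    by (simp add: field_product_integrable subsetD[OF JT])
  also have "\<dots> = (\<Sum>X\<in>J. \<Sum>Y\<in>J. t X * t Y * covariance_form \<nu> (L X) (L Y))"
    by (intro sum.cong refl) (simp add: field_covariance subsetD[OF J(2)])
  finally show ?thesis unfolding v(2) covariance_sum by simp
qed

lemma field_equal_in_law:
  assumes \<Gamma>: "gaussian_mass \<mu> b L P N \<Gamma>"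
  shows "equal_in_law (closed_fluctuating_cone \<mu> b) Q G P (\<lambda>X \<omega>. mass_inner (\<Gamma> \<omega>) X)"
proof (rule equal_in_lawI_linear_combinations)
  show "random_field Q (closed_fluctuating_cone \<mu> b) G"
    using prob_space_field field_measurable closed_fluctuating_cone_subset by (auto simp: random_field_def)
  have "prob_space P"
    using \<Gamma> by (simp add: gaussian_mass_def collapsed_normal_def centered_normal_vector_def)
  then show "random_field P (closed_fluctuating_cone \<mu> b) (\<lambda>X \<omega>. mass_inner (\<Gamma> \<omega>) X)"
    using mass_inner_measurable[OF \<Gamma>] by (simp add: random_field_def)
  show "distr Q borel (\<lambda>\<omega>. \<Sum>X\<in>J. t X * G X \<omega>) = distr P borel (\<lambda>\<omega>. \<Sum>X\<in>J. t X * mass_inner (\<Gamma> \<omega>) X)"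
    if "finite J" "J \<subseteq> closed_fluctuating_cone \<mu> b" for J t
    using field_combination_law_collapsed[OF that] mass_inner_combination_law[OF \<Gamma> that] by simp
qed

end

theorem theorem6p12:
  fixes \<kappa> :: real and d :: nat and S :: "nat \<Rightarrow> 'a::metric_space set"
    and \<mu> :: "'a measure" and b :: 'a
    and L :: "'a tangent \<Rightarrow> 'e::euclidean_space"
  assumes "smoothly_stratified_space \<kappa> d S"
    and "localized \<mu> b"
    and "tangential_collapse \<mu> b L"
  shows
    "(\<exists>(P :: 'e measure) N \<Gamma>. gaussian_mass \<mu> b L P N \<Gamma>) \<and>
     (\<forall>(P :: 'w measure) N. collapsed_normal \<mu> b L P N \<longrightarrow> (\<exists>\<Gamma>. gaussian_mass \<mu> b L P N \<Gamma>)) \<and>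
     (\<forall>(P :: 'w measure) N \<Gamma> (Q :: 'v measure) G.
        gaussian_mass \<mu> b L P N \<Gamma> \<longrightarrow> gaussian_tangent_field \<mu> b Q G \<longrightarrow>
        equal_in_law (closed_fluctuating_cone \<mu> b) Q G P (\<lambda>X \<omega>. mass_inner (\<Gamma> \<omega>) X))"
proof (intro conjI allI impI)
  interpret collapsed_localized_measure \<mu> b L
    using assms unfolding smoothly_stratified_space_def by unfold_locales blast+
  \<comment> \<open>An arbitrary type \<open>'w\<close> may be too small to carry a normal vector
    with this covariance; the type \<open>'e\<close> always carries its law.\<close>
  obtain P :: "'e measure" and N where "collapsed_normal \<mu> b L P N"
    unfolding collapsed_normal_def
    by (rule centered_normal_vector_exists[OF bilinear_covariance covariance_commute covariance_nonneg])
  then show "\<exists>(P :: 'e measure) N \<Gamma>. gaussian_mass \<mu> b L P N \<Gamma>"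
    using gaussian_mass_exists by blast
  show "\<exists>\<Gamma>. gaussian_mass \<mu> b L P N \<Gamma>" if "collapsed_normal \<mu> b L P N" for P :: "'w measure" and N
    using that by (rule gaussian_mass_exists)
  fix P :: "'w measure" and N \<Gamma> and Q :: "'v measure" and G
  assume \<Gamma>: "gaussian_mass \<mu> b L P N \<Gamma>" and G: "gaussian_tangent_field \<mu> b Q G"
  interpret collapsed_gaussian_field \<mu> b L Q G by unfold_locales (rule G)
  show "equal_in_law (closed_fluctuating_cone \<mu> b) Q G P (\<lambda>X \<omega>. mass_inner (\<Gamma> \<omega>) X)"
    using \<Gamma> by (rule field_equal_in_law)
qed

end
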